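(* Suppose $F:\mathcal W\to\mathbb R$ satisfies the following assumptions: (1) $F$ is G\^ateaux smooth, continuous in the cut norm, and a class function. (2) For all $\{0,1\}$-valued graphons $f\in\mathcal W_{[0,1]}$, the Taylor polynomials $P_n(f):=\sum_{m=0}^n\frac1{m!}d^mF(0;f,f,\dots,f)$ converge to $F(f)$ as $n\to\infty$. (3) The Taylor series $P(F)(-)=\sum_{m=0}^\infty\sum_{H\in\mathcal H_m}a_H\,t(H,-)$ of $F$ is absolutely convergent on $\mathcal W_{[0,1]}$. Then $a_H=0$ for all multigraphs $H\in\mathcal H$ that are not simple graphs, and $$F(f)=P(F)(f)=\sum_{m\ge0}\sum_{H\in\mathcal G_m}a_H\,t(H,f)\qquad\text{for all } f\in\mathcal W_{[0,1]}.$$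
   Context: $\mathcal W$ is the vector space of bounded symmetric measurable functions $f:[0,1]^2\to\mathbb R$, and $\mathcal W_{[0,1]}\subset\mathcal W$ the set of those with values in $[0,1]$ (graphons). The cut norm is $\|f\|_{\rm cut}=\sup_{S,T\subset[0,1]}\left|\int_{S\times T}f\right|$. $S_{[0,1]}$ is the group of invertible Lebesgue measure-preserving maps of $[0,1]$, $f^\sigma(x,y)=f(\sigma(x),\sigma(y))$, $\delta_\Box(f,g)=\inf_{\psi\in S_{[0,1]}}\|f-g^\psi\|_{\rm cut}$; write $f\sim g$ if $\delta_\Box(f,g)=0$. A class function is a function with $F(f)=F(g)$ whenever $f\sim g$. G\^ateaux derivatives: $dF(f;g)=\lim_{\lambda\to0}\frac1\lambda(F(f+\lambda g)-F(f))$ and inductively $d^nF(f;g_1,\dots,g_n)=\lim_{\lambda\to0}\frac1\lambda(d^{n-1}F(f+\lambda g_n;g_1,\dots,g_{n-1})-d^{n-1}F(f;g_1,\dots,g_{n-1}))$; $d^0F(0)=F(0)$. $F:\mathcal W\to\mathbb R$ is G\^ateaux smooth if for every $f\in\mathcal W$, $m\in\mathbb N$ and $g_1,\dots,g_m\in\mathcal W$, the function $(\lambda_1,\dots,\lambda_m)\mapsto F(f+\sum\lambda_ig_i)$ is $C^\infty$ on $\mathbb R^m$. Multigraphs are finite, undirected, without loops, possibly with multiple edges; an edge $e$ has endpoints $\{e_s,e_t\}$. $\mathcal H_m$ (resp. $\mathcal G_m$) is the set of isomorphism classes of multigraphs (resp. simple graphs) with $m$ edges and no isolated vertices; $\mathcal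 H=\bigcup_{m\ge0}\mathcal H_m$. $t(H,f)=\int_{[0,1]^{V(H)}}\prod_{e\in E(H)}f(x_{e_s},x_{e_t})\prod_idx_i$, with $t(H,f)\equiv1$ if $H$ has no edges. For $1\le a<b\le p$, $e^p_{(a,b)}$ is the indicator function of $\left(\frac{a-1}p,\frac ap\right]\times\left(\frac{b-1}p,\frac bp\right]$ plus that of $\left(\frac{b-1}p,\frac bp\right]\times\left(\frac{a-1}p,\frac ap\right]$; $\mathcal W_p=\mathcal W_{[0,1]}\cap\operatorname{span}_{\mathbb R}\{e^p_{(a,b)}\}_{1\le a<b\le p}$ and $\mathcal W_{\bf p}=\bigcup_{p\ge1}\mathcal W_p$. The Taylor series $P(F)$ of a smooth class function $F$ is the formal series $\sum_{m\ge0}\sum_{H\in\mathcal H_m}a_Ht(H,-)$, where the $a_H$ are the (unique) real scalars such that for all $m\ge0$ and all $f\in\bigcup_{\sigma\in S_{[0,1]}}\{g^\sigma:g\in\mathcal W_{\bf p}\}$ one has $\sum_{H\in\mathcal H_m}a_Ht(H,f)=\frac1{m!}d^mF(0;f,\dots,f)$. The series is absolutely convergent at $f$ if $\sum_{m\ge0}\sum_{H\in\mathcal H_m}|a_H|\,t(H,|f|)<\infty$; its value at $f$ is $\lim_{M\to\infty}\sum_{m\le M}\sum_{H\in\mathcal H_m}a_Ht(H,f)$. *)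

theory Defs
  imports "HOL-Analysis.Analysis" "HOL-Library.Multiset"
begin

section \<open>Kernels, graphons and the cut distance\<close>

type_synonym kernel = "real \<times> real \<Rightarrow> real"

text \<open>
  A function on the unit square is represented by its extension by zero to the whole plane.
  Measurability is Lebesgue measurability.
\<close>

definition kernels :: "kernel set" where
  "kernels = {f. f \<in> borel_measurable (lebesgue :: (real \<times> real) measure)
     \<and> bounded (range f)
     \<and> (\<forall>x y. f (x, y) = f (y, x))
     \<and> (\<forall>z. z \<notin> {0..1} \<times> {0..1} \<longrightarrow> f z = 0)}"

definition graphons :: "kernel set" where
  "graphons = {f \<in> kernels. \<forall>z. f z \<in> {0..1}}"

definition cut_norm :: "kernel \<Rightarrow> real" where
  "cut_norm f =
     (SUP (S, T) \<in> {(S, T). S \<in> sets lebesgue \<and> T \<in> sets lebesgue \<and> S \<subseteq> {0..1} \<and> T \<subseteq> {0..1}}.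
        \<bar>LINT z : S \<times> T | lebesgue. f z\<bar>)"

text \<open>
  A self-map of the unit interval is extended to the real line by the identity, so that the
  pullback of a kernel again vanishes outside the unit square.
\<close>

definition mp_maps :: "(real \<Rightarrow> real) set" where
  "mp_maps = {\<sigma>. \<sigma> permutes {0..1}
     \<and> \<sigma> \<in> lebesgue_on {0..1} \<rightarrow>\<^sub>M lebesgue_on {0..1}
     \<and> inv \<sigma> \<in> lebesgue_on {0..1} \<rightarrow>\<^sub>M lebesgue_on {0..1}
     \<and> distr (lebesgue_on {0..1}) (lebesgue_on {0..1}) \<sigma> = lebesgue_on {0..1}}"

definition pullback :: "kernel \<Rightarrow> (real \<Rightarrow> real) \<Rightarrow> kernel" where
  "pullback f \<sigma> = (\<lambda>(x, y). f (\<sigma> x, \<sigma> y))"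

definition cut_dist :: "kernel \<Rightarrow> kernel \<Rightarrow> real" where
  "cut_dist f g = (INF \<psi> \<in> mp_maps. cut_norm (\<lambda>z. f z - pullback g \<psi> z))"

definition cut_continuous :: "(kernel \<Rightarrow> real) \<Rightarrow> bool" where
  "cut_continuous F \<longleftrightarrow>
     (\<forall>f\<in>kernels. \<forall>\<epsilon>>0. \<exists>\<delta>>0. \<forall>g\<in>kernels. cut_norm (\<lambda>z. g z - f z) < \<delta> \<longrightarrow> \<bar>F g - F f\<bar> < \<epsilon>)"

definition class_function :: "(kernel \<Rightarrow> real) \<Rightarrow> bool" where
  "class_function F \<longleftrightarrow> (\<forall>f\<in>kernels. \<forall>g\<in>kernels. cut_dist f g = 0 \<longrightarrow> F f = F g)"


section \<open>Gateaux derivatives and smoothness\<close>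

text \<open>
  \<open>gateaux F n g f\<close> is the derivative of order \<open>n\<close> at \<open>f\<close> in the
  directions \<open>g 0, \<dots>, g (n - 1)\<close>, taken in this order.
\<close>

primrec gateaux :: "(kernel \<Rightarrow> real) \<Rightarrow> nat \<Rightarrow> (nat \<Rightarrow> kernel) \<Rightarrow> kernel \<Rightarrow> real" where
  "gateaux F 0 g f = F f"
| "gateaux F (Suc n) g f =
     Lim (at 0) (\<lambda>l. (gateaux F n g (\<lambda>z. f z + l * g n z) - gateaux F n g f) / l)"

primrec iter_partial :: "nat list \<Rightarrow> ((nat \<Rightarrow> real) \<Rightarrow> real) \<Rightarrow> (nat \<Rightarrow> real) \<Rightarrow> real" where
  "iter_partial [] \<phi> = \<phi>"
| "iter_partial (i # is) \<phi> = (\<lambda>x. deriv (\<lambda>s. iter_partial is \<phi> (x(i := s))) (x i))"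

text \<open>
  The dimension \<open>m\<close> varies, so a function on \<open>m\<close>-dimensional space is represented by a function
  of a sequence that depends on the coordinates below \<open>m\<close> only. For such functions, continuity
  with respect to the product topology on sequences is continuity on \<open>m\<close>-dimensional space.
\<close>

definition smooth_on_coords :: "nat \<Rightarrow> ((nat \<Rightarrow> real) \<Rightarrow> real) \<Rightarrow> bool" where
  "smooth_on_coords m \<phi> \<longleftrightarrow>
     (\<forall>is. set is \<subseteq> {..<m} \<longrightarrow>
        continuous_on UNIV (iter_partial is \<phi>)
        \<and> (\<forall>i<m. \<forall>x. (\<lambda>s. iter_partial is \<phi> (x(i := s))) field_differentiable at (x i)))"

definition gateaux_smooth :: "(kernel \<Rightarrow> real) \<Rightarrow> bool" where
  "gateaux_smooth F \<longleftrightarrow>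
     (\<forall>f\<in>kernels. \<forall>m. \<forall>g. (\<forall>i<m. g i \<in> kernels) \<longrightarrow>
        smooth_on_coords m (\<lambda>l. F (\<lambda>z. f z + (\<Sum>i<m. l i * g i z))))"

definition taylor_term :: "(kernel \<Rightarrow> real) \<Rightarrow> nat \<Rightarrow> kernel \<Rightarrow> real" where
  "taylor_term F m f = 1 / fact m * gateaux F m (\<lambda>_. f) (\<lambda>_. 0)"

definition taylor_poly :: "(kernel \<Rightarrow> real) \<Rightarrow> nat \<Rightarrow> kernel \<Rightarrow> real" where
  "taylor_poly F n f = (\<Sum>m\<le>n. taylor_term F m f)"


section \<open>Multigraphs and homomorphism densities\<close>

text \<open>
  A multigraph is a finite vertex set together with a multiset of two-element sets of vertices.
  Taking the vertices to be natural numbers loses no isomorphism class.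
\<close>

type_synonym multigraph = "nat set \<times> nat set multiset"

definition multigraphs :: "multigraph set" where
  "multigraphs = {(V, E). finite V \<and> (\<forall>e\<in>#E. e \<subseteq> V \<and> card e = 2)}"

definition simple :: "multigraph \<Rightarrow> bool" where
  "simple = (\<lambda>(V, E). \<forall>e. count E e \<le> 1)"

definition no_isolated :: "multigraph \<Rightarrow> bool" where
  "no_isolated = (\<lambda>(V, E). \<forall>v\<in>V. \<exists>e\<in>#E. v \<in> e)"

definition graph_iso :: "(multigraph \<times> multigraph) set" where
  "graph_iso = {((V, E), (V', E')). (V, E) \<in> multigraphs \<and> (V', E') \<in> multigraphs
     \<and> (\<exists>\<phi>. bij_betw \<phi> V V' \<and> image_mset (image \<phi>) E = E')}"

definition multigraph_classes :: "nat \<Rightarrow> multigraph set set" where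
  "multigraph_classes m =
     {H \<in> multigraphs. no_isolated H \<and> size (snd H) = m} // graph_iso"

definition simple_classes :: "nat \<Rightarrow> multigraph set set" where
  "simple_classes m =
     {H \<in> multigraphs. simple H \<and> no_isolated H \<and> size (snd H) = m} // graph_iso"

text \<open>
  Edges are oriented from the smaller to the larger endpoint, which is immaterial because kernels
  are symmetric. The product measure is completed because kernels are only Lebesgue measurable.
\<close>

definition hom_density :: "multigraph \<Rightarrow> kernel \<Rightarrow> real" where
  "hom_density = (\<lambda>(V, E) f.
     LINT x | completion (\<Pi>\<^sub>M v\<in>V. restrict_space lborel {0..1}).
       (\<Prod>e\<in>#E. f (x (Min e), x (Max e))))"

definition class_density :: "multigraph set \<Rightarrow> kernel \<Rightarrow> real" where
  "class_density C = hom_density (SOME H. H \<in> C)"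


section \<open>Step kernels and Taylor series\<close>

definition step_basis :: "nat \<Rightarrow> nat \<Rightarrow> nat \<Rightarrow> kernel" where
  "step_basis p a b =
     (let I = (\<lambda>k::nat. {(real k - 1) / real p <.. real k / real p})
      in (\<lambda>z. indicator (I a \<times> I b) z + indicator (I b \<times> I a) z))"

definition step_graphons :: "nat \<Rightarrow> kernel set" where
  "step_graphons p = graphons \<inter>
     {f. \<exists>c. f = (\<lambda>z. \<Sum>(a, b) \<in> {(a, b). 1 \<le> a \<and> a < b \<and> b \<le> p}. c a b * step_basis p a b z)}"

definition all_step_graphons :: "kernel set" where
  "all_step_graphons = (\<Union>p\<in>{1..}. step_graphons p)"

text \<open>
  \<open>taylor_coeffs F a\<close> says that \<open>a\<close> is the family of coefficients, indexed by isomorphism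
  classes of multigraphs, of the Taylor series of \<open>F\<close>.
\<close>

definition taylor_coeffs :: "(kernel \<Rightarrow> real) \<Rightarrow> (multigraph set \<Rightarrow> real) \<Rightarrow> bool" where
  "taylor_coeffs F a \<longleftrightarrow>
     (\<forall>m. \<forall>f \<in> (\<Union>\<sigma>\<in>mp_maps. {pullback g \<sigma> | g. g \<in> all_step_graphons}).
        (\<Sum>H\<in>multigraph_classes m. a H * class_density H f) = taylor_term F m f)"

definition abs_convergent_at :: "(multigraph set \<Rightarrow> real) \<Rightarrow> kernel \<Rightarrow> bool" where
  "abs_convergent_at a f \<longleftrightarrow>
     summable (\<lambda>m. \<Sum>H\<in>multigraph_classes m. \<bar>a H\<bar> * class_density H (\<lambda>z. \<bar>f z\<bar>))"

end

theory Submission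
  imports Defs "HOL-Probability.Infinite_Product_Measure"
begin

text \<open>
  On \<open>{0, 1}\<close>-valued step graphons the densities of a multigraph and of its underlying simple
  graph agree, so there \<open>F\<close> is the series \<open>G\<close> obtained from its Taylor series by replacing each
  multigraph by its simplification. Given a \<open>[0, 1]\<close>-valued step graphon, refine its grid and
  sample each pair of cells independently: the resulting random \<open>{0, 1}\<close>-valued step graphon is
  close in cut norm in the mean, and simple graph densities are almost preserved in expectation;
  hence \<open>F = G\<close> on all step graphons. Along a ray through a step graphon, \<open>G\<close> is a power series
  whose coefficient of degree \<open>k\<close> collects the multigraphs whose simplification has \<open>k\<close> edges.
  By smoothness it is also the Taylor term of degree \<open>k\<close>, so the linear independence of the
  densities of multigraphs with \<open>k\<close> edges forces \<open>a\<close> to vanish on nonsimple classes. Every graphon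
  is an almost everywhere limit of step graphons, which carries the identity over.
\<close>


section \<open>Isomorphism classes of multigraphs\<close>

text \<open>On {0, 1}-valued graphons a density does not see multiplicities, so convergence of the
  Taylor polynomials there cannot by itself separate a multigraph from its simplification. What
  separates them is degree: on the ray s f a multigraph with m edges is scaled by s^m, the
  simplification of a nonsimple one by a smaller power, and the Gateaux derivatives at 0 record
  degrees. Sampling is compatible with simplification because a random indicator u with mean w
  satisfies E u^k = w and not w^k: a sampled multiple edge counts like a single one. The step
  graphons that determine the coefficients vanish on the diagonal blocks. Refinement and sampling
  respect this, and in the final approximation it disturbs only a null set. Every interchange of
  limits (refinement of the grid, regrouping by degree, approximation of a graphon) rests on one
  majorant: absolute convergence at the constant graphon 1, where all densities are 1, makes the sum
  of all \<bar>a_H\<bar> finite.\<close>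

abbreviation rep :: "multigraph set \<Rightarrow> multigraph" where
  "rep C \<equiv> SOME H. H \<in> C"

definition simplification :: "multigraph \<Rightarrow> multigraph" where
  "simplification = (\<lambda>(V, E). (V, mset_set (set_mset E)))"

lemma multigraphsD:
  assumes "(V, E) \<in> multigraphs"
  shows "finite V" "\<And>e. e \<in># E \<Longrightarrow> e \<subseteq> V" "\<And>e. e \<in># E \<Longrightarrow> card e = 2"
  using assms by (auto simp: multigraphs_def)

lemma edge_endpoints:
  assumes "(V, E) \<in> multigraphs" "e \<in># E"
  shows "Min e \<in> V" "Max e \<in> V" "Min e \<noteq> Max e"
proof -
  have c: "card e = 2" by (rule multigraphsD(3)[OF assms])
  then have e: "finite e" "e \<noteq> {}" by (auto intro: card_ge_0_finite)
  show "Min e \<in> V" "Max e \<in> V" using e multigraphsD(2)[OF assms] by (meson Min_in Max_in subsetD)+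
  show "Min e \<noteq> Max e"
  proof
    assume "Min e = Max e"
    then have "x = Min e" if "x \<in> e" for x using e that by (metis Max_ge Min_le antisym)
    then have "e \<subseteq> {Min e}" by auto
    then show False using c card_mono[of "{Min e}" e] by simp
  qed
qed

lemma equiv_graph_iso: "equiv multigraphs graph_iso"
proof (rule equivI)
  show "graph_iso \<subseteq> multigraphs \<times> multigraphs"
    by (auto simp: graph_iso_def)
  show "refl_on multigraphs graph_iso"
  proof (rule refl_onI)
    fix H assume H: "H \<in> multigraphs"
    obtain V E where [simp]: "H = (V, E)" by (cases H)
    have "bij_betw (\<lambda>x. x) V V" "image_mset (image (\<lambda>x. x)) E = E"
      by (simp_all add: bij_betw_def image_mset_cong[of E _ "\<lambda>e. e"])
    then show "(H, H) \<in> graph_iso"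
      using H unfolding graph_iso_def by auto
  qed
  show "sym graph_iso"
  proof (rule symI, clarify)
    fix V E V' E' assume "((V, E), (V', E')) \<in> graph_iso"
    then obtain \<phi> where H: "(V, E) \<in> multigraphs" "(V', E') \<in> multigraphs"
      and b: "bij_betw \<phi> V V'" and E': "E' = image_mset (image \<phi>) E"
      by (auto simp: graph_iso_def)
    have "image_mset (image (inv_into V \<phi>)) E' = image_mset (\<lambda>e. e) E"
      unfolding E' multiset.map_comp
    proof (rule image_mset_cong)
      fix e assume "e \<in># E"
      then have "e \<subseteq> V" using multigraphsD(2)[OF H(1)] by simp
      then show "(image (inv_into V \<phi>) \<circ> image \<phi>) e = e"
        using b inv_into_image_cancel[of \<phi> V e] by (simp add: bij_betw_def)
    qed
    then show "((V', E'), (V, E)) \<in> graph_iso"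
      using H bij_betw_inv_into[OF b] unfolding graph_iso_def by auto
  qed
  show "trans graph_iso"
  proof (rule transI, clarify)
    fix V E V' E' V'' E''
    assume "((V, E), (V', E')) \<in> graph_iso" "((V', E'), (V'', E'')) \<in> graph_iso"
    then obtain \<phi> \<psi> where H: "(V, E) \<in> multigraphs" "(V'', E'') \<in> multigraphs"
      and b: "bij_betw \<phi> V V'" "bij_betw \<psi> V' V''"
      and E: "E' = image_mset (image \<phi>) E" "E'' = image_mset (image \<psi>) E'"
      by (auto simp: graph_iso_def)
    have "image_mset (image (\<psi> \<circ> \<phi>)) E = E''"
      unfolding E multiset.map_comp by (rule image_mset_cong) (simp add: image_comp)
    then show "((V, E), (V'', E'')) \<in> graph_iso"
      using H bij_betw_trans[OF b] unfolding graph_iso_def by auto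
  qed
qed

lemma graph_iso_invariants:
  assumes "(H, H') \<in> graph_iso"
  shows "no_isolated H \<Longrightarrow> no_isolated H'" "size (snd H') = size (snd H)"
    "simple H \<Longrightarrow> simple H'"
proof -
  obtain V E V' E' where [simp]: "H = (V, E)" "H' = (V', E')" by (cases H, cases H')
  obtain \<phi> where H: "(V, E) \<in> multigraphs" and b: "bij_betw \<phi> V V'"
    and E': "E' = image_mset (image \<phi>) E"
    using assms by (auto simp: graph_iso_def)
  show "size (snd H') = size (snd H)" by (simp add: E')
  show "no_isolated H'" if "no_isolated H"
  proof -
    have "\<exists>e\<in>#E'. v \<in> e" if v: "v \<in> V'" for v
    proof -
      obtain x where x: "x \<in> V" "v = \<phi> x" using v b unfolding bij_betw_def by blast
      then obtain e where "e \<in># E" "x \<in> e" using \<open>no_isolated H\<close> by (auto simp: no_isolated_def)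
      then show ?thesis using x by (auto simp: E')
    qed
    then show ?thesis by (simp add: no_isolated_def)
  qed
  show "simple H'" if s: "simple H"
  proof -
    have inj: "inj_on (image \<phi>) (set_mset E)"
    proof (rule inj_onI)
      fix c d assume "c \<in># E" "d \<in># E" "\<phi> ` c = \<phi> ` d"
      then show "c = d"
        using b multigraphsD(2)[OF H] inj_on_image_eq_iff[of \<phi> V c d] by (simp add: bij_betw_def)
    qed
    have "count E' e \<le> 1" for e
    proof (cases "e \<in># E'")
      case True
      then obtain d where d: "d \<in># E" "e = \<phi> ` d" by (auto simp: E')
      have "count E' e = (\<Sum>c | c \<in># E \<and> e = \<phi> ` c. count E c)"
        unfolding E' by (rule count_image_mset')
      also have "{c. c \<in># E \<and> e = \<phi> ` c} = {d}"
        using d inj by (auto simp: inj_on_def)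
      finally show ?thesis using s by (simp add: simple_def)
    qed (simp add: not_in_iff)
    then show ?thesis by (simp add: simple_def)
  qed
qed

lemma multigraph_classesD:
  assumes "C \<in> multigraph_classes m" "H \<in> C"
  shows "H \<in> multigraphs" "no_isolated H" "size (snd H) = m" "C = graph_iso `` {H}"
proof -
  obtain H0 where H0: "H0 \<in> multigraphs" "no_isolated H0" "size (snd H0) = m" "C = graph_iso `` {H0}"
    using assms(1) by (auto simp: multigraph_classes_def quotient_def)
  with assms(2) have iso: "(H0, H) \<in> graph_iso" by auto
  show "H \<in> multigraphs" using iso by (auto simp: graph_iso_def)
  show "no_isolated H" "size (snd H) = m"
    using graph_iso_invariants[OF iso] H0 by auto
  show "C = graph_iso `` {H}"
    unfolding H0(4) using equiv_class_eq[OF equiv_graph_iso iso] .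
qed

lemma rep_in:
  assumes "C \<in> multigraph_classes m"
  shows "rep C \<in> C"
proof -
  have "C \<noteq> {}"
  proof -
    obtain H0 where H0: "H0 \<in> multigraphs" "C = graph_iso `` {H0}"
      using assms(1) by (auto simp: multigraph_classes_def quotient_def)
    then show ?thesis using equiv_class_self[OF equiv_graph_iso, of H0] by blast
  qed
  then show ?thesis by (simp add: some_in_eq)
qed

text \<open>Two premises remain, the same membership twice, so instances read
  \<open>repD(1)[OF C C]\<close>.\<close>

lemmas repD = multigraph_classesD[OF _ rep_in]

lemma graph_iso_class_in:
  assumes "H \<in> multigraphs" "no_isolated H"
  shows "graph_iso `` {H} \<in> multigraph_classes (size (snd H))"
  using assms by (auto simp: multigraph_classes_def intro!: quotientI)

lemma multigraph_classes_eqI: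
  assumes "C \<in> multigraph_classes m" "C' \<in> multigraph_classes m'" "(rep C, rep C') \<in> graph_iso"
  shows "C = C'"
  using repD(4)[OF assms(1) assms(1)] repD(4)[OF assms(2) assms(2)]
    equiv_class_eq[OF equiv_graph_iso assms(3)] by simp

lemma simple_classes_subset: "simple_classes m \<subseteq> multigraph_classes m"
  unfolding simple_classes_def multigraph_classes_def quotient_def by auto

lemma simple_rep_imp_simple_class:
  assumes C: "C \<in> multigraph_classes m" "simple (rep C)"
  shows "C \<in> simple_classes m"
proof -
  have "graph_iso `` {rep C} \<in> simple_classes m"
    using repD[OF C(1) C(1)] C unfolding simple_classes_def by (intro quotientI) auto
  then show ?thesis using repD(4)[OF C(1) C(1)] by simp
qed

lemma multigraph_classes_disjoint:
  assumes "C \<in> multigraph_classes m" "C \<in> multigraph_classes n"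
  shows "m = n"
  using repD(3)[OF assms(1) assms(1)] repD(3)[OF assms(2) assms(2)] by simp

lemma no_isolated_Union:
  assumes "(V, E) \<in> multigraphs" "no_isolated (V, E)"
  shows "V = \<Union>(set_mset E)"
  using assms multigraphsD(2)[OF assms(1)] by (fastforce simp: no_isolated_def)

lemma card_Union_edges_le: "(\<And>e. e \<in># E \<Longrightarrow> card e = 2) \<Longrightarrow> card (\<Union>(set_mset E)) \<le> 2 * size E"
proof (induction E)
  case (add e E)
  then have "card (\<Union>(set_mset E)) \<le> 2 * size E" "card e = 2" by simp_all
  then show ?case using card_Un_le[of e "\<Union>(set_mset E)"] by simp
qed simp

text \<open>Without isolated vertices, m edges span at most 2m vertices, so every class has a
  representative on an initial segment {..<k} with k \<le> 2m, given by a list of m edges. Over an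
  infinite index set the sums in the Taylor series would be 0 by default.\<close>

lemma finite_multigraph_classes: "finite (multigraph_classes m)"
proof -
  define S where "S = (\<Union>k\<in>{..2 * m}. (\<lambda>xs. ({..<k}, mset xs)) ` {xs. set xs \<subseteq> Pow {..<k} \<and> length xs = m})"
  have fin: "finite S"
    unfolding S_def by (intro finite_UN_I finite_imageI finite_lists_length_eq) auto
  have "multigraph_classes m \<subseteq> (\<lambda>H. graph_iso `` {H}) ` S"
  proof
    fix C assume C: "C \<in> multigraph_classes m"
    obtain V E where VE: "rep C = (V, E)" by (cases "rep C")
    have H: "(V, E) \<in> multigraphs" "no_isolated (V, E)" "size E = m" "C = graph_iso `` {(V, E)}"
      using repD[OF C C] VE by simp_all
    note d = multigraphsD[OF H(1)]
    have k: "card V \<le> 2 * m"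
      using card_Union_edges_le[of E] d(3) H(3) no_isolated_Union[OF H(1,2)] by simp
    obtain \<phi> where b: "bij_betw \<phi> V {..<card V}"
      using ex_bij_betw_finite_nat[OF d(1)] by (auto simp: atLeast0LessThan)
    define E' where "E' = image_mset (image \<phi>) E"
    have sub: "\<phi> ` e \<subseteq> {..<card V}" if "e \<in># E" for e
      using d(2)[OF that] b by (auto simp: bij_betw_def)
    have c2: "card (\<phi> ` e) = 2" if "e \<in># E" for e
      using d(2,3)[OF that] b by (metis bij_betw_def card_image inj_on_subset)
    have "({..<card V}, E') \<in> multigraphs"
      using sub c2 by (auto simp: multigraphs_def E'_def)
    then have iso: "((V, E), ({..<card V}, E')) \<in> graph_iso"
      using H(1) b unfolding graph_iso_def E'_def by auto
    obtain xs where xs: "mset xs = E'" using ex_mset by blast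
    have "({..<card V}, E') \<in> S"
      unfolding S_def
    proof (intro UN_I[of "card V"] image_eqI[of _ _ xs])
      have "set xs = set_mset E'" using xs by (metis set_mset_mset)
      moreover have "length xs = m" using xs H(3) by (metis E'_def size_image_mset size_mset)
      ultimately show "xs \<in> {xs. set xs \<subseteq> Pow {..<card V} \<and> length xs = m}"
        using sub by (auto simp: E'_def)
    qed (use k xs in auto)
    then show "C \<in> (\<lambda>H. graph_iso `` {H}) ` S"
      using H(4) equiv_class_eq[OF equiv_graph_iso iso] by auto
  qed
  then show ?thesis using fin finite_surj by blast
qed

lemma simplification_props:
  assumes "H \<in> multigraphs" "no_isolated H"
  shows "simplification H \<in> multigraphs" "no_isolated (simplification H)" "simple (simplification H)"
    "size (snd (simplification H)) \<le> size (snd H)" "fst (simplification H) = fst H"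
proof -
  obtain V E where [simp]: "H = (V, E)" by (cases H)
  show "simplification H \<in> multigraphs" "no_isolated (simplification H)" 
    using assms by (auto simp: simplification_def multigraphs_def no_isolated_def)
  show "simple (simplification H)"
    by (auto simp: simplification_def simple_def count_mset_set')
  show "size (snd (simplification H)) \<le> size (snd H)"
    using mset_set_set_mset_msubset[of E] by (auto simp: simplification_def dest: size_mset_mono)
qed (auto simp: simplification_def split: prod.splits)

section \<open>Densities in step kernels\<close>

text \<open>The ceiling fits the cells of \<open>step_basis\<close>, which are open on the left,
  closed on the right and numbered from 1; \<open>nat\<close> sends x \<le> 0 to the number 0, which
  is no cell.\<close>

definition cell :: "nat \<Rightarrow> real \<Rightarrow> nat" where
  "cell p x = nat \<lceil>real p * x\<rceil>"

definition cell_interval :: "nat \<Rightarrow> nat \<Rightarrow> real set" where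
  "cell_interval p a = {(real a - 1) / real p <.. real a / real p}"

lemma cell_unique:
  assumes "p \<ge> 1" "x \<in> cell_interval p a"
  shows "cell p x = a"
proof -
  have "real a - 1 < real p * x" "real p * x \<le> real a"
    using assms by (auto simp: cell_interval_def field_simps)
  then have "\<lceil>real p * x\<rceil> = int a" by (intro ceiling_unique) auto
  then show ?thesis by (simp add: cell_def)
qed

lemma cell_range:
  assumes "p \<ge> 1" "0 < x" "x \<le> 1"
  shows "cell p x \<in> {1..p}" "x \<in> cell_interval p (cell p x)"
proof -
  have pos: "0 < real p * x" and le: "real p * x \<le> real p" using assms by auto
  have c: "real p * x \<le> of_int \<lceil>real p * x\<rceil>" "of_int \<lceil>real p * x\<rceil> < real p * x + 1" "\<lceil>real p * x\<rceil> \<ge> 1"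
    using pos by linarith+
  have r: "real (cell p x) = of_int \<lceil>real p * x\<rceil>" unfolding cell_def using c(3) by simp
  have "\<lceil>real p * x\<rceil> \<le> int p" using le by (simp add: ceiling_le_iff)
  then show "cell p x \<in> {1..p}" unfolding cell_def using c(3) by (simp only: atLeastAtMost_iff) linarith
  show "x \<in> cell_interval p (cell p x)"
    unfolding cell_interval_def r using c assms(1) by (auto simp: field_simps)
qed

lemma cell_interval_subset:
  assumes "p \<ge> 1" "a \<in> {1..p}"
  shows "cell_interval p a \<subseteq> {0<..1}"
proof
  fix x assume x: "x \<in> cell_interval p a"
  have "0 \<le> (real a - 1) / real p" "real a / real p \<le> 1" using assms by auto
  then show "x \<in> {0<..1}" using x unfolding cell_interval_def by auto
qed

lemma cell_interval_iff:
  assumes "p \<ge> 1" "a \<in> {1..p}"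
  shows "x \<in> cell_interval p a \<longleftrightarrow> x \<in> {0<..1} \<and> cell p x = a"
  using cell_unique[of p x a] cell_range(2)[of p x] cell_interval_subset[OF assms] assms by auto

text \<open>Indexing the weights by sets builds in symmetry, and a diagonal block has a singleton as
  its index. The point 0 belongs to no cell, hence the half-open square.\<close>

definition step_kernel :: "nat \<Rightarrow> (nat set \<Rightarrow> real) \<Rightarrow> kernel" where
  "step_kernel p w = (\<lambda>(x, y). if x \<in> {0<..1} \<and> y \<in> {0<..1} then w {cell p x, cell p y} else 0)"

text \<open>This makes the diagonal blocks vanish, as they do in \<open>step_graphons\<close>; a map
  that collapses an edge then contributes nothing to a density.\<close>

definition loopless :: "(nat set \<Rightarrow> real) \<Rightarrow> bool" where
  "loopless w \<longleftrightarrow> (\<forall>X. card X \<noteq> 2 \<longrightarrow> w X = 0)"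

definition edge_weights :: "(nat set \<Rightarrow> real) set" where
  "edge_weights = {w. loopless w \<and> (\<forall>X. 0 \<le> w X \<and> w X \<le> 1)}"

text \<open>The sum runs over ordered pairs although weights live on unordered ones: each summand is
  a function of x times a function of y, so integrals over rectangles factor.\<close>

lemma step_kernel_eq_sum:
  assumes "p \<ge> 1"
  shows "step_kernel p w (x, y) =
    (\<Sum>a=1..p. \<Sum>b=1..p. w {a, b} * (indicator (cell_interval p a) x * indicator (cell_interval p b) y))"
proof (cases "x \<in> {0<..1} \<and> y \<in> {0<..1}")
  case True
  have ind: "indicator (cell_interval p a) z = (if a = cell p z then 1 else 0 :: real)"
    if "a \<in> {1..p}" "z \<in> {0<..1}" for a z
    using cell_interval_iff[OF assms that(1), of z] that(2) by (auto simp: indicator_def)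
  have "(\<Sum>a=1..p. \<Sum>b=1..p. w {a, b} * (indicator (cell_interval p a) x * indicator (cell_interval p b) y))
    = (\<Sum>a=1..p. \<Sum>b=1..p. if b = cell p y then if a = cell p x then w {a, b} else 0 else 0)"
    using True by (intro sum.cong refl) (auto simp: ind)
  also have "\<dots> = w {cell p x, cell p y}"
    using cell_range(1)[OF assms] True by simp
  finally show ?thesis using True by (simp add: step_kernel_def)
next
  case False
  have "indicator (cell_interval p a) x * indicator (cell_interval p b) y = (0 :: real)"
    if "a \<in> {1..p}" "b \<in> {1..p}" for a b
    using cell_interval_subset[OF assms that(1)] cell_interval_subset[OF assms that(2)] False
    by (auto simp: indicator_def)
  then have "(\<Sum>a=1..p. \<Sum>b=1..p. w {a, b} * (indicator (cell_interval p a) x * indicator (cell_interval p b) y)) = 0"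
    by (intro sum.neutral ballI) simp
  then show ?thesis using False by (auto simp: step_kernel_def)
qed

lemma step_kernel_borel [measurable]:
  assumes "p \<ge> 1"
  shows "step_kernel p w \<in> borel_measurable borel"
proof -
  have "(\<lambda>(x, y). step_kernel p w (x, y)) \<in> borel_measurable (borel \<Otimes>\<^sub>M borel)"
    unfolding step_kernel_eq_sum[OF assms] cell_interval_def by measurable
  then show ?thesis by (simp add: borel_prod)
qed

lemma step_kernel_nonneg_le1:
  assumes "w \<in> edge_weights"
  shows "0 \<le> step_kernel p w z" "step_kernel p w z \<le> 1"
  using assms by (auto simp: edge_weights_def step_kernel_def split: prod.splits)

lemma step_kernel_bounded:
  assumes "\<And>X. \<bar>w X\<bar> \<le> B" "0 \<le> B"
  shows "\<bar>step_kernel p w z\<bar> \<le> B"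
  using assms by (auto simp: step_kernel_def split: prod.splits)

lemma step_kernel_in_kernels:
  assumes "p \<ge> 1" "\<And>X. \<bar>w X\<bar> \<le> B"
  shows "step_kernel p w \<in> kernels"
proof -
  have "0 \<le> B" using assms(2)[of "{}"] by linarith
  then have "bounded (range (step_kernel p w))"
    using step_kernel_bounded[of w B] assms(2) by (intro boundedI[of _ B]) auto
  moreover have "step_kernel p w \<in> borel_measurable lebesgue"
    using step_kernel_borel[OF assms(1), of w] by (intro measurable_completion) simp
  ultimately show ?thesis
    unfolding kernels_def by (auto simp: step_kernel_def insert_commute)
qed

lemma step_kernel_in_graphons:
  assumes "p \<ge> 1" "w \<in> edge_weights"
  shows "step_kernel p w \<in> graphons"
proof -
  have "step_kernel p w \<in> kernels"
    using assms by (intro step_kernel_in_kernels[of _ _ 1]) (auto simp: edge_weights_def)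
  then show ?thesis
    using step_kernel_nonneg_le1[OF assms(2)] by (simp add: graphons_def)
qed

lemma step_kernel_in_step_graphons:
  assumes "p \<ge> 1" "w \<in> edge_weights"
  shows "step_kernel p w \<in> step_graphons p"
proof -
  let ?P = "{(a, b). 1 \<le> a \<and> a < b \<and> b \<le> p}"
  have fin: "finite ?P" by (rule finite_subset[of _ "{1..p} \<times> {1..p}"]) auto
  define c where "c a b = w {a, b}" for a b
  have "step_kernel p w (x, y) = (\<Sum>(a, b)\<in>?P. c a b * step_basis p a b (x, y))" for x y
  proof -
    define g where "g a b = w {a, b} * (indicator (cell_interval p a) x * indicator (cell_interval p b) y)" for a b
    have "step_kernel p w (x, y) = (\<Sum>(a, b)\<in>{1..p} \<times> {1..p}. g a b)"
      unfolding step_kernel_eq_sum[OF assms(1)] g_def by (simp add: sum.cartesian_product)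
    \<comment> \<open>\<open>step_basis\<close> is used for a < b only, so the ordered sum is split
      into a triangle and its mirror image; the diagonal terms that drop out carry weight 0 by
      \<open>loopless\<close>.\<close>
    also have "\<dots> = (\<Sum>(a, b)\<in>?P \<union> (\<lambda>(a, b). (b, a)) ` ?P. g a b)"
    proof (rule sum.mono_neutral_right)
      show "\<forall>z\<in>{1..p} \<times> {1..p} - (?P \<union> (\<lambda>(a, b). (b, a)) ` ?P). (case z of (a, b) \<Rightarrow> g a b) = 0"
      proof
        fix z assume z: "z \<in> {1..p} \<times> {1..p} - (?P \<union> (\<lambda>(a, b). (b, a)) ` ?P)"
        obtain a b where ab: "z = (a, b)" by (cases z)
        have "a = b" using z unfolding ab by (cases a b rule: linorder_cases) (auto simp: image_iff)
        then show "(case z of (a, b) \<Rightarrow> g a b) = 0"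
          using assms(2) by (simp add: ab g_def edge_weights_def loopless_def)
      qed
    qed auto
    also have "\<dots> = (\<Sum>(a, b)\<in>?P. g a b) + (\<Sum>(a, b)\<in>(\<lambda>(a, b). (b, a)) ` ?P. g a b)"
      by (rule sum.union_disjoint) (use fin in auto)
    also have "(\<Sum>(a, b)\<in>(\<lambda>(a, b). (b, a)) ` ?P. g a b) = (\<Sum>(a, b)\<in>?P. g b a)"
      by (subst sum.reindex) (auto simp: inj_on_def case_prod_unfold)
    also have "(\<Sum>(a, b)\<in>?P. g a b) + (\<Sum>(a, b)\<in>?P. g b a) = (\<Sum>(a, b)\<in>?P. c a b * step_basis p a b (x, y))"
      unfolding sum.distrib[symmetric]
    proof (rule sum.cong[OF refl])
      fix z assume "z \<in> ?P"
      obtain a b where ab: "z = (a, b)" by (cases z)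
      have "{b, a} = {a, b}" by auto
      then show "(case z of (a, b) \<Rightarrow> g a b) + (case z of (a, b) \<Rightarrow> g b a)
          = (case z of (a, b) \<Rightarrow> c a b * step_basis p a b (x, y))"
        unfolding ab prod.case g_def c_def step_basis_def Let_def indicator_times cell_interval_def
          fst_conv snd_conv distrib_left by (simp only:)
    qed
    finally show ?thesis .
  qed
  then have "step_kernel p w = (\<lambda>z. \<Sum>(a, b)\<in>?P. c a b * step_basis p a b z)"
    by (simp add: fun_eq_iff)
  then have "step_kernel p w \<in> {f. \<exists>c. f = (\<lambda>z. \<Sum>(a, b)\<in>?P. c a b * step_basis p a b z)}"
    by (intro CollectI exI[of _ c])
  then show ?thesis
    using step_kernel_in_graphons[OF assms] by (simp add: step_graphons_def)
qed

lemma step_kernel_diff: "step_kernel p (\<lambda>X. v X - w X) z = step_kernel p v z - step_kernel p w z"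
  by (auto simp: step_kernel_def split: prod.splits)

lemma step_kernel_scale: "step_kernel p (\<lambda>X. s * w X) = (\<lambda>z. s * step_kernel p w z)"
  by (auto simp: step_kernel_def split: prod.splits)

text \<open>The homomorphism density of H in the finite weighted graph on {1..p} with weights w. All
  maps count, not only injective ones.\<close>

definition hom_avg :: "multigraph \<Rightarrow> nat \<Rightarrow> (nat set \<Rightarrow> real) \<Rightarrow> real" where
  "hom_avg = (\<lambda>(V, E) p w. (\<Sum>\<phi>\<in>V \<rightarrow>\<^sub>E {1..p}. \<Prod>e\<in>#E. w (\<phi> ` e)) / real p ^ card V)"

lemma prod_mset_zeroI: "x \<in># A \<Longrightarrow> f x = (0::'a::comm_semiring_1) \<Longrightarrow> (\<Prod>y\<in>#A. f y) = 0"
  by (auto dest!: multi_member_split)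

abbreviation unit_interval :: "real measure" where
  "unit_interval \<equiv> restrict_space lborel {0..1}"

lemma prob_space_unit_interval: "prob_space unit_interval"
  by (rule prob_space_restrict_space) auto

text \<open>Expanding the integrand over the assignments \<phi> of vertices to cells leaves products
  of indicators of separate coordinates; under the product measure each factor integrates to 1 /
  p.\<close>

lemma hom_density_step_kernel:
  assumes H: "H \<in> multigraphs" "no_isolated H" and p: "p \<ge> 1"
  shows "hom_density H (step_kernel p w) = hom_avg H p w"
proof -
  obtain V E where HVE: "H = (V, E)" by (cases H)
  note VE = multigraphsD[OF H(1)[unfolded HVE]]
  let ?M = "unit_interval"
  let ?N = "\<Pi>\<^sub>M v\<in>V. ?M"
  interpret M: prob_space ?M by (rule prob_space_unit_interval)
  interpret product_sigma_finite "\<lambda>_::nat. ?M" ..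
  let ?W = "\<lambda>\<phi>. \<Prod>e\<in>#E. w (\<phi> ` e)"
  have ME: "\<exists>s\<in>V. \<exists>t\<in>V. Min e = s \<and> Max e = t \<and> e = {s, t}" if "e \<in># E" for e
  proof -
    obtain s t where "e = {s, t}" "s \<noteq> t" using VE(3)[OF \<open>e \<in># E\<close>] by (auto simp: card_2_iff)
    then show ?thesis using VE(2)[OF \<open>e \<in># E\<close>]
      by (cases "s < t") (auto simp: min_def max_def insert_commute)
  qed
  have pointwise: "(\<Prod>e\<in>#E. step_kernel p w (x (Min e), x (Max e)))
      = (\<Sum>\<phi>\<in>V \<rightarrow>\<^sub>E {1..p}. ?W \<phi> * (\<Prod>v\<in>V. indicator (cell_interval p (\<phi> v)) (x v)))"
    if "x \<in> space ?N" for x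
  proof (cases "\<forall>v\<in>V. x v \<in> {0<..1}")
    case True
    define \<psi> where "\<psi> = (\<lambda>v\<in>V. cell p (x v))"
    have \<psi>: "\<psi> \<in> V \<rightarrow>\<^sub>E {1..p}" using True cell_range(1)[OF p] by (auto simp: \<psi>_def)
    have "(\<Prod>v\<in>V. indicator (cell_interval p (\<phi> v)) (x v)) = (if \<phi> = \<psi> then 1 else 0 :: real)"
      if \<phi>: "\<phi> \<in> V \<rightarrow>\<^sub>E {1..p}" for \<phi>
    proof (cases "\<phi> = \<psi>")
      case True
      then show ?thesis using \<open>\<forall>v\<in>V. x v \<in> {0<..1}\<close> cell_range(2)[OF p] by (simp add: \<psi>_def)
    next
      case False
      then obtain v where v: "v \<in> V" "\<phi> v \<noteq> \<psi> v" using \<phi> \<psi> by (metis PiE_ext)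
      then have "x v \<notin> cell_interval p (\<phi> v)"
        using cell_unique[OF p, of "x v" "\<phi> v"] by (auto simp: \<psi>_def)
      then show ?thesis using v(1) VE(1) False by (auto intro!: prod_zero bexI[of _ v])
    qed
    then have "(\<Sum>\<phi>\<in>V \<rightarrow>\<^sub>E {1..p}. ?W \<phi> * (\<Prod>v\<in>V. indicator (cell_interval p (\<phi> v)) (x v)))
      = (\<Sum>\<phi>\<in>V \<rightarrow>\<^sub>E {1..p}. if \<phi> = \<psi> then ?W \<phi> else 0)"
      by (intro sum.cong) auto
    also have "\<dots> = ?W \<psi>" using \<psi> VE(1) by (simp add: finite_PiE)
    also have "\<dots> = (\<Prod>e\<in>#E. step_kernel p w (x (Min e), x (Max e)))"
    proof (intro arg_cong[where f = prod_mset] image_mset_cong)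
      fix e assume "e \<in># E"
      from ME[OF this] have e: "Min e \<in> V" "Max e \<in> V" "e = {Min e, Max e}" by auto
      have "\<psi> ` e = {\<psi> (Min e), \<psi> (Max e)}" by (subst e(3)) simp
      then show "w (\<psi> ` e) = step_kernel p w (x (Min e), x (Max e))"
        using True e(1,2) by (simp add: step_kernel_def \<psi>_def)
    qed
    finally show ?thesis by simp
  next
    case False
    then obtain v where v: "v \<in> V" "x v \<notin> {0<..1}" by auto
    have "(\<Prod>v\<in>V. indicator (cell_interval p (\<phi> v)) (x v)) = (0::real)" if "\<phi> \<in> V \<rightarrow>\<^sub>E {1..p}" for \<phi>
    proof (rule prod_zero)
      have "\<phi> v \<in> {1..p}" using that v(1) by auto
      then have "x v \<notin> cell_interval p (\<phi> v)" using cell_interval_subset[OF p] v(2) by blast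
      then show "\<exists>v\<in>V. indicator (cell_interval p (\<phi> v)) (x v) = (0::real)" using v(1) by (auto intro!: bexI[of _ v])
    qed (use VE(1) in auto)
    \<comment> \<open>A coordinate at 0 lies in no cell. As v is not isolated, an edge at v kills
      this product too, so the two sides agree at every point and not just almost
      everywhere.\<close>
    moreover have "(\<Prod>e\<in>#E. step_kernel p w (x (Min e), x (Max e))) = 0"
    proof -
      obtain e where e: "e \<in># E" "v \<in> e" using H(2) v(1) by (auto simp: HVE no_isolated_def)
      from ME[OF e(1)] have "e = {Min e, Max e}" by auto
      then have "v = Min e \<or> v = Max e" using e(2) by (metis insert_iff singletonD)
      then have "step_kernel p w (x (Min e), x (Max e)) = 0"
        using v(2) by (auto simp: step_kernel_def)
      then show ?thesis using prod_mset_zeroI[OF e(1)] by fast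
    qed
    ultimately show ?thesis by simp
  qed
  have int1: "integrable ?M (indicator (cell_interval p a) :: real \<Rightarrow> real)" for a
    by (rule M.integrable_const_bound[of _ 1]) (auto simp: cell_interval_def intro!: measurable_restrict_space1)
  have val: "integral\<^sup>L ?M (indicator (cell_interval p a) :: real \<Rightarrow> real) = 1 / real p" if "a \<in> {1..p}" for a
  proof -
    have sub: "cell_interval p a \<subseteq> {0..1}" using cell_interval_subset[OF p that] by force
    have "integral\<^sup>L ?M (indicator (cell_interval p a) :: real \<Rightarrow> real) = measure ?M (cell_interval p a)"
      using sub by (simp add: Int_absorb2 space_restrict_space)
    also have "\<dots> = measure lborel (cell_interval p a)"
      by (rule measure_restrict_space) (use sub in auto)
    also have "\<dots> = 1 / real p"
      using p by (simp add: cell_interval_def divide_right_mono diff_divide_distrib)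
    finally show ?thesis .
  qed
  have int2: "integrable ?N (\<lambda>x. \<Prod>v\<in>V. indicator (cell_interval p (\<phi> v)) (x v) :: real)" for \<phi>
    by (rule product_integrable_prod) (use VE(1) int1 in auto)
  have "hom_density H (step_kernel p w) = integral\<^sup>L (completion ?N)
     (\<lambda>x. \<Sum>\<phi>\<in>V \<rightarrow>\<^sub>E {1..p}. ?W \<phi> * (\<Prod>v\<in>V. indicator (cell_interval p (\<phi> v)) (x v)))"
    unfolding HVE hom_density_def split by (rule Bochner_Integration.integral_cong) (simp_all add: pointwise)
  \<comment> \<open>The expanded integrand is measurable before completion, so completing the
    measure does not change its integral.\<close>
  also have "\<dots> = integral\<^sup>L ?N
     (\<lambda>x. \<Sum>\<phi>\<in>V \<rightarrow>\<^sub>E {1..p}. ?W \<phi> * (\<Prod>v\<in>V. indicator (cell_interval p (\<phi> v)) (x v)))"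
    by (rule integral_completion)
      (intro borel_measurable_sum borel_measurable_times borel_measurable_const borel_measurable_integrable[OF int2])
  also have "\<dots> = (\<Sum>\<phi>\<in>V \<rightarrow>\<^sub>E {1..p}. ?W \<phi> * (\<integral>x. (\<Prod>v\<in>V. indicator (cell_interval p (\<phi> v)) (x v)) \<partial>?N))"
    using int2 by (subst Bochner_Integration.integral_sum) auto
  also have "\<dots> = (\<Sum>\<phi>\<in>V \<rightarrow>\<^sub>E {1..p}. ?W \<phi> * (1 / real p) ^ card V)"
  proof (rule sum.cong[OF refl])
    fix \<phi> assume \<phi>: "\<phi> \<in> V \<rightarrow>\<^sub>E {1..p}"
    have "(\<integral>x. (\<Prod>v\<in>V. indicator (cell_interval p (\<phi> v)) (x v)) \<partial>?N)
      = (\<Prod>v\<in>V. integral\<^sup>L ?M (indicator (cell_interval p (\<phi> v)) :: real \<Rightarrow> real))"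
      by (rule product_integral_prod) (use VE(1) int1 in auto)
    also have "\<dots> = (\<Prod>v\<in>V. 1 / real p)"
      by (rule prod.cong[OF refl], rule val) (use \<phi> in auto)
    finally show "?W \<phi> * (\<integral>x. (\<Prod>v\<in>V. indicator (cell_interval p (\<phi> v)) (x v)) \<partial>?N) = ?W \<phi> * (1 / real p) ^ card V"
      by simp
  qed
  also have "\<dots> = hom_avg H p w"
    by (simp add: HVE hom_avg_def sum_distrib_right[symmetric] power_one_over divide_inverse power_inverse)
  finally show ?thesis .
qed

lemma prod_mset_nonneg_le1:
  fixes f :: "'a \<Rightarrow> real"
  assumes "\<And>x. x \<in># A \<Longrightarrow> 0 \<le> f x \<and> f x \<le> 1"
  shows "0 \<le> (\<Prod>x\<in>#A. f x)" "(\<Prod>x\<in>#A. f x) \<le> 1"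
proof -
  have "0 \<le> (\<Prod>x\<in>#A. f x) \<and> (\<Prod>x\<in>#A. f x) \<le> 1"
    using assms by (induction A) (auto intro: mult_nonneg_nonneg mult_le_one)
  then show "0 \<le> (\<Prod>x\<in>#A. f x)" "(\<Prod>x\<in>#A. f x) \<le> 1" by auto
qed

lemma hom_avg_bounds:
  assumes "w \<in> edge_weights" "p \<ge> 1" "H \<in> multigraphs"
  shows "0 \<le> hom_avg H p w" "hom_avg H p w \<le> 1"
proof -
  obtain V E where HVE: "H = (V, E)" by (cases H)
  have fin: "finite V" using multigraphsD(1) assms(3) HVE by auto
  have b: "0 \<le> (\<Prod>e\<in>#E. w (\<phi> ` e))" "(\<Prod>e\<in>#E. w (\<phi> ` e)) \<le> 1" for \<phi> :: "nat \<Rightarrow> nat"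
    using assms(1) by (intro prod_mset_nonneg_le1; simp add: edge_weights_def)+
  show "0 \<le> hom_avg H p w"
    unfolding HVE hom_avg_def split by (intro divide_nonneg_nonneg sum_nonneg b) auto
  have "(\<Sum>\<phi>\<in>V \<rightarrow>\<^sub>E {1..p}. \<Prod>e\<in>#E. w (\<phi> ` e)) \<le> (\<Sum>\<phi>\<in>V \<rightarrow>\<^sub>E {1..p}. 1)"
    by (intro sum_mono b)
  also have "\<dots> = real p ^ card V" using fin by (simp add: card_PiE)
  finally show "hom_avg H p w \<le> 1"
    unfolding HVE hom_avg_def split using assms(2) by (simp add: divide_le_eq_1)
qed

lemma hom_avg_scale: "hom_avg H p (\<lambda>X. s * w X) = s ^ size (snd H) * hom_avg H p w"
proof -
  obtain V E where HVE: "H = (V, E)" by (cases H)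
  have "(\<Prod>e\<in>#E. s * w (\<phi> ` e)) = s ^ size E * (\<Prod>e\<in>#E. w (\<phi> ` e))" for \<phi> :: "nat \<Rightarrow> nat"
    by (simp add: prod_mset.distrib)
  then show ?thesis by (simp add: HVE hom_avg_def sum_distrib_left)
qed

lemma hom_avg_iso:
  assumes "(H, H') \<in> graph_iso"
  shows "hom_avg H p w = hom_avg H' p w"
proof -
  obtain V E V' E' where HH: "H = (V, E)" "H' = (V', E')" by (cases H, cases H')
  obtain \<beta> where H: "(V, E) \<in> multigraphs" and b: "bij_betw \<beta> V V'"
    and E': "E' = image_mset (image \<beta>) E"
    using assms HH by (auto simp: graph_iso_def)
  let ?\<gamma> = "inv_into V \<beta>"
  have g: "bij_betw ?\<gamma> V' V" using b by (rule bij_betw_inv_into)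
  have gb: "?\<gamma> (\<beta> v) = v" if "v \<in> V" for v using b that by (simp add: bij_betw_def)
  have bg: "\<beta> (?\<gamma> v) = v" if "v \<in> V'" for v using b that by (simp add: bij_betw_def f_inv_into_f)
  have bV: "\<beta> v \<in> V'" if "v \<in> V" for v using b that by (auto simp: bij_betw_def)
  have gV: "?\<gamma> v \<in> V" if "v \<in> V'" for v using g that by (auto simp: bij_betw_def)
  have "(\<Sum>\<phi>\<in>V \<rightarrow>\<^sub>E {1..p}. \<Prod>e\<in>#E. w (\<phi> ` e)) = (\<Sum>\<phi>\<in>V' \<rightarrow>\<^sub>E {1..p}. \<Prod>e\<in>#E'. w (\<phi> ` e))"
  proof (rule sum.reindex_bij_witness[where i = "\<lambda>\<phi>. \<lambda>v\<in>V. \<phi> (\<beta> v)" and j = "\<lambda>\<phi>. \<lambda>v\<in>V'. \<phi> (?\<gamma> v)"])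
    fix \<phi> assume \<phi>: "\<phi> \<in> V \<rightarrow>\<^sub>E {1..p}"
    show "(\<lambda>v\<in>V. (\<lambda>v\<in>V'. \<phi> (?\<gamma> v)) (\<beta> v)) = \<phi>"
      using \<phi> by (intro PiE_ext[OF _ \<phi>]) (auto simp: gb bV)
    show "(\<lambda>v\<in>V'. \<phi> (?\<gamma> v)) \<in> V' \<rightarrow>\<^sub>E {1..p}" using \<phi> gV by auto
    show "(\<Prod>e\<in>#E'. w ((\<lambda>v\<in>V'. \<phi> (?\<gamma> v)) ` e)) = (\<Prod>e\<in>#E. w (\<phi> ` e))"
      unfolding E' multiset.map_comp comp_def
    proof (intro arg_cong[where f = prod_mset] image_mset_cong arg_cong[where f = w])
      fix e assume "e \<in># E"
      then have "e \<subseteq> V" using multigraphsD(2)[OF H] by blast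
      then show "(\<lambda>v\<in>V'. \<phi> (?\<gamma> v)) ` \<beta> ` e = \<phi> ` e"
        unfolding image_image by (intro image_cong) (auto simp: gb bV)
    qed
  next
    fix \<phi> assume \<phi>: "\<phi> \<in> V' \<rightarrow>\<^sub>E {1..p}"
    show "(\<lambda>v\<in>V'. (\<lambda>v\<in>V. \<phi> (\<beta> v)) (?\<gamma> v)) = \<phi>"
      using \<phi> by (intro PiE_ext[OF _ \<phi>]) (auto simp: bg gV)
    show "(\<lambda>v\<in>V. \<phi> (\<beta> v)) \<in> V \<rightarrow>\<^sub>E {1..p}" using \<phi> bV by auto
  qed
  then show ?thesis using bij_betw_same_card[OF b] by (simp add: HH hom_avg_def)
qed

lemma prod_mset_idempotent:
  fixes f :: "'a \<Rightarrow> 'b::comm_monoid_mult"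
  assumes "\<And>x. f x * f x = f x"
  shows "(\<Prod>x\<in>#A. f x) = (\<Prod>x\<in>set_mset A. f x)"
proof (induction A)
  case (add x A)
  show ?case
  proof (cases "x \<in># A")
    case True
    have "f x * (\<Prod>y\<in>set_mset A. f y) = f x * (f x * (\<Prod>y\<in>set_mset A - {x}. f y))"
      using True by (subst prod.remove[of _ x]) auto
    also have "\<dots> = f x * (\<Prod>y\<in>set_mset A - {x}. f y)"
      by (simp only: mult.assoc[symmetric] assms)
    also have "\<dots> = (\<Prod>y\<in>set_mset A. f y)"
      using True by (subst prod.remove[of "set_mset A" x]) auto
    finally show ?thesis using True add by (simp add: insert_absorb)
  qed (simp add: add)
qed simp

lemma hom_avg_simplification:
  assumes "\<And>X. w X \<in> {0, 1}"
  shows "hom_avg H p w = hom_avg (simplification H) p w"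
proof -
  obtain V E where HVE: "H = (V, E)" by (cases H)
  have idem: "w X * w X = w X" for X using assms[of X] by auto
  have "(\<Prod>e\<in>#E. w (\<phi> ` e)) = (\<Prod>e\<in>#mset_set (set_mset E). w (\<phi> ` e))" for \<phi> :: "nat \<Rightarrow> nat"
    by (subst (1 2) prod_mset_idempotent) (simp_all add: idem)
  then show ?thesis by (simp add: HVE hom_avg_def simplification_def)
qed

section \<open>Linear independence of homomorphism densities\<close>

text \<open>Dedekind's argument: subtracting two instances of the relation removes one character.\<close>

lemma characters_independent:
  fixes ch :: "'i \<Rightarrow> 'a \<Rightarrow> 'b::idom"
  assumes "finite I"
    and closed: "\<And>x y. x \<in> S \<Longrightarrow> y \<in> S \<Longrightarrow> mul x y \<in> S"
    and "\<And>i x y. i \<in> I \<Longrightarrow> x \<in> S \<Longrightarrow> y \<in> S \<Longrightarrow> ch i (mul x y) = ch i x * ch i y"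
    and "\<And>i. i \<in> I \<Longrightarrow> \<exists>x\<in>S. ch i x \<noteq> 0"
    and "\<And>i j. i \<in> I \<Longrightarrow> j \<in> I \<Longrightarrow> i \<noteq> j \<Longrightarrow> \<exists>x\<in>S. ch i x \<noteq> ch j x"
    and "\<And>x. x \<in> S \<Longrightarrow> (\<Sum>i\<in>I. c i * ch i x) = 0"
  shows "\<forall>i\<in>I. c i = 0"
  using assms(1,3-)
proof (induction I arbitrary: c rule: finite_induct)
  case (insert i I)
  have c0: "c j = 0" if j: "j \<in> I" for j
  proof -
    have "\<exists>y\<in>S. ch j y \<noteq> ch i y"
      by (rule insert.prems(3)) (use j insert.hyps(2) in auto)
    then obtain y where y: "y \<in> S" "ch j y \<noteq> ch i y" by blast
    have "\<forall>j\<in>I. c j * (ch j y - ch i y) = 0"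
    proof (rule insert.IH)
      fix x assume x: "x \<in> S"
      have "0 = (\<Sum>j\<in>insert i I. c j * ch j (mul x y)) - ch i y * (\<Sum>j\<in>insert i I. c j * ch j x)"
        using insert.prems(4)[OF x] insert.prems(4)[OF closed[OF x y(1)]] by simp
      also have "\<dots> = (\<Sum>j\<in>insert i I. c j * (ch j y - ch i y) * ch j x)"
        unfolding sum_distrib_left sum_subtractf[symmetric]
        by (rule sum.cong) (simp_all add: insert.prems(1) x y(1) algebra_simps)
      also have "\<dots> = (\<Sum>j\<in>I. c j * (ch j y - ch i y) * ch j x)"
        using insert.hyps by simp
      finally show "(\<Sum>j\<in>I. c j * (ch j y - ch i y) * ch j x) = 0" by simp
    next
      show "ch k (mul x y) = ch k x * ch k y" if "k \<in> I" "x \<in> S" "y \<in> S" for k x y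
        using insert.prems(1) that by simp
      show "\<exists>x\<in>S. ch k x \<noteq> 0" if "k \<in> I" for k
        using insert.prems(2) that by simp
      show "\<exists>x\<in>S. ch k x \<noteq> ch l x" if "k \<in> I" "l \<in> I" "k \<noteq> l" for k l
        using insert.prems(3) that by simp
    qed
    then have "c j * (ch j y - ch i y) = 0" using j by blast
    then show ?thesis using y(2) by simp
  qed
  obtain x where x: "x \<in> S" "ch i x \<noteq> 0" using insert.prems(2)[of i] by auto
  have "(\<Sum>j\<in>I. c j * ch j x) = 0" by (rule sum.neutral) (simp add: c0)
  then have "c i * ch i x = 0" using insert.prems(4)[OF x(1)] insert.hyps by simp
  then show ?case using x(2) c0 by simp
qed simp

text \<open>Monomials are multiplicative characters on \<open>edge_weights\<close>, which is closed
  under pointwise products. It remains to find weights that do not annihilate a given monomial and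
  weights that separate two of them.\<close>

lemma monomials_independent:
  fixes c :: "nat set multiset \<Rightarrow> real"
  assumes "finite T" "\<And>M X. M \<in> T \<Longrightarrow> X \<in># M \<Longrightarrow> card X = 2"
    and "\<And>w. w \<in> edge_weights \<Longrightarrow> (\<Sum>M\<in>T. c M * (\<Prod>X\<in>#M. w X)) = 0"
  shows "\<forall>M\<in>T. c M = 0"
proof (rule characters_independent[where S = edge_weights and mul = "\<lambda>v w X. v X * w X"
    and ch = "\<lambda>M w. \<Prod>X\<in>#M. w X", OF assms(1)])
  show "(\<lambda>X. v X * w X) \<in> edge_weights" if "v \<in> edge_weights" "w \<in> edge_weights" for v w
    using that by (auto simp: edge_weights_def loopless_def intro: mult_le_one)
  show "(\<Prod>X\<in>#M. v X * w X) = (\<Prod>X\<in>#M. v X) * (\<Prod>X\<in>#M. w X)" for M and v w :: "nat set \<Rightarrow> real"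
    by (rule prod_mset.distrib)
  \<comment> \<open>\<open>h X\<close> is 1 on all pairs except X, where it is 1 / 2, so a monomial
    takes the value 1 / 2 to the power of the multiplicity of X in it. The empty set is no pair, so
    \<open>h {}\<close> is 1 on every pair.\<close>
  define h :: "nat set \<Rightarrow> nat set \<Rightarrow> real" where
    "h X = (\<lambda>Y. if card Y = 2 then if Y = X then 1 / 2 else 1 else 0)" for X
  have h: "h X \<in> edge_weights" for X by (auto simp: h_def edge_weights_def loopless_def)
  have prod_h: "(\<Prod>Y\<in>#M. h X Y) = (1 / 2) ^ count M X" if "\<forall>Y\<in>#M. card Y = 2" for M X
    using that by (induction M) (auto simp: h_def)
  show "\<exists>w\<in>edge_weights. (\<Prod>X\<in>#M. w X) \<noteq> 0" if "M \<in> T" for M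
    using h[of "{}"] prod_h[of M "{}"] assms(2)[OF that] by (intro bexI[of _ "h {}"]) auto
  show "\<exists>w\<in>edge_weights. (\<Prod>X\<in>#M. w X) \<noteq> (\<Prod>X\<in>#N. w X)" if MN: "M \<in> T" "N \<in> T" "M \<noteq> N" for M N
  proof -
    obtain X where X: "count M X \<noteq> count N X" using MN(3) by (auto simp: multiset_eq_iff)
    then have "(1 / 2 :: real) ^ count M X \<noteq> (1 / 2) ^ count N X"
      by (subst power_inject_exp') auto
    then show ?thesis
      using h[of X] prod_h[of M X] prod_h[of N X] assms(2)[OF MN(1)] assms(2)[OF MN(2)]
      by (intro bexI[of _ "h X"]) auto
  qed
qed (rule assms(3))

lemma pushforward_graph_iso:
  assumes "(V, E) \<in> multigraphs" "inj_on \<phi> V"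
  shows "((V, E), (\<phi> ` V, image_mset (image \<phi>) E)) \<in> graph_iso"
proof -
  have "card (\<phi> ` e) = 2" if "e \<in># E" for e
    using multigraphsD(2,3)[OF assms(1) that] assms(2) by (metis card_image inj_on_subset)
  then have "(\<phi> ` V, image_mset (image \<phi>) E) \<in> multigraphs"
    using multigraphsD(1,2)[OF assms(1)] by (auto simp: multigraphs_def)
  then show ?thesis
    using assms by (auto simp: graph_iso_def bij_betw_def)
qed

text \<open>
  A homomorphism of multigraphs that is exact on edges and onto cannot increase the number of
  vertices, so for a coefficient of a class with the most vertices only isomorphisms contribute
  to the monomial of that class.
\<close>

lemma hom_avg_independent:
  fixes \<gamma> :: "multigraph set \<Rightarrow> real"
  assumes zero: "\<And>p w. p \<ge> 1 \<Longrightarrow> w \<in> edge_weights \<Longrightarrow>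
      (\<Sum>K\<in>multigraph_classes m. \<gamma> K * hom_avg (rep K) p w) = 0"
    and K: "K \<in> multigraph_classes m"
  shows "\<gamma> K = 0"
proof (rule ccontr)
  assume "\<gamma> K \<noteq> 0"
  define V where "V K = fst (rep K)" for K
  define E where "E K = snd (rep K)" for K
  let ?KK = "multigraph_classes m"
  have VE: "rep K = (V K, E K)" for K by (simp add: V_def E_def)
  note fin = finite_multigraph_classes[of m]
  have mg: "(V K, E K) \<in> multigraphs" and ni: "no_isolated (V K, E K)" if "K \<in> ?KK" for K
    using repD(1,2)[OF that that] by (simp_all add: VE)
  define B where "B = {K \<in> ?KK. \<gamma> K \<noteq> 0}"
  have B: "finite B" "B \<noteq> {}" using fin K \<open>\<gamma> K \<noteq> 0\<close> by (auto simp: B_def)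
  have "Max ((\<lambda>K. card (V K)) ` B) \<in> (\<lambda>K. card (V K)) ` B" using B by (intro Max_in) auto
  then obtain K0 where K0: "K0 \<in> B" and mx: "Max ((\<lambda>K. card (V K)) ` B) = card (V K0)" by auto
  have max: "card (V K) \<le> card (V K0)" if "K \<in> B" for K
    unfolding mx[symmetric] using that B(1) by (intro Max_ge) auto
  have K0': "K0 \<in> ?KK" "\<gamma> K0 \<noteq> 0" using K0 by (auto simp: B_def)
  note V0 = multigraphsD[OF mg[OF K0'(1)]]
  \<comment> \<open>The vertices of \<open>rep K0\<close> are arbitrary natural numbers, possibly 0;
    shifted by one they fit into {1..p}.\<close>
  define p where "p = Suc (Max (insert 0 (V K0)))"
  have p: "p \<ge> 1" by (simp add: p_def)
  define \<psi> where "\<psi> = (\<lambda>v\<in>V K0. Suc v)"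
  have \<psi>: "\<psi> \<in> V K0 \<rightarrow>\<^sub>E {1..p}" using V0(1) by (auto simp: \<psi>_def p_def)
  have \<psi>_inj: "inj_on \<psi> (V K0)" by (auto simp: \<psi>_def inj_on_def)
  \<comment> \<open>After the averages are multiplied out, the pair (K, \<phi>) contributes the
    monomial \<open>g (K, \<phi>)\<close> with coefficient \<open>\<kappa> (K, \<phi>)\<close>.
    Different pairs may share a monomial; \<open>\<kappa>'\<close> collects them.\<close>
  define D where "D = (SIGMA K:?KK. V K \<rightarrow>\<^sub>E {1..p})"
  define g where "g = (\<lambda>(K, \<phi>). image_mset (image \<phi>) (E K) :: nat set multiset)"
  define \<kappa> where "\<kappa> = (\<lambda>(K, \<phi> :: nat \<Rightarrow> nat). \<gamma> K / real p ^ card (V K))"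
  have finD: "finite D"
    unfolding D_def using fin multigraphsD(1)[OF mg] by (intro finite_SigmaI finite_PiE) auto
  have expand: "(\<Sum>d\<in>D. \<kappa> d * (\<Prod>X\<in>#g d. w X)) = 0" if w: "w \<in> edge_weights" for w
  proof -
    have "(\<Sum>d\<in>D. \<kappa> d * (\<Prod>X\<in>#g d. w X)) =
        (\<Sum>K\<in>?KK. \<Sum>\<phi>\<in>V K \<rightarrow>\<^sub>E {1..p}. \<kappa> (K, \<phi>) * (\<Prod>X\<in>#g (K, \<phi>). w X))"
      unfolding D_def using fin multigraphsD(1)[OF mg]
      by (subst sum.Sigma) (auto intro!: finite_PiE)
    also have "\<dots> = (\<Sum>K\<in>?KK. \<gamma> K * hom_avg (rep K) p w)"
      by (rule sum.cong[OF refl])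
        (simp add: \<kappa>_def g_def VE hom_avg_def multiset.map_comp comp_def sum_distrib_left sum_divide_distrib)
    finally show ?thesis using zero[OF p w] by simp
  qed
  \<comment> \<open>A map that collapses an edge produces a factor at a set that is not a pair. Such
    a monomial vanishes on loopless weights, so only the remaining ones can be compared.\<close>
  define T where "T = {M \<in> g ` D. \<forall>X\<in>#M. card X = 2}"
  define \<kappa>' where "\<kappa>' M = (\<Sum>d | d \<in> D \<and> g d = M. \<kappa> d)" for M
  have "\<forall>M\<in>T. \<kappa>' M = 0"
  proof (rule monomials_independent)
    show "finite T" unfolding T_def using finD by auto
    show "card X = 2" if "M \<in> T" "X \<in># M" for M X using that by (auto simp: T_def)
    fix w assume w: "w \<in> edge_weights"
    have "(\<Sum>M\<in>T. \<kappa>' M * (\<Prod>X\<in>#M. w X)) = (\<Sum>M\<in>g ` D. \<kappa>' M * (\<Prod>X\<in>#M. w X))"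
    proof (rule sum.mono_neutral_left)
      show "\<forall>M\<in>g ` D - T. \<kappa>' M * (\<Prod>X\<in>#M. w X) = 0"
      proof
        fix M assume "M \<in> g ` D - T"
        then obtain X where X: "X \<in># M" "card X \<noteq> 2" by (auto simp: T_def)
        then have "w X = 0" using w by (auto simp: edge_weights_def loopless_def)
        then have "(\<Prod>X\<in>#M. w X) = 0" by (rule prod_mset_zeroI[OF X(1)])
        then show "\<kappa>' M * (\<Prod>X\<in>#M. w X) = 0" by (simp only: mult_zero_right)
      qed
    qed (use finD in \<open>auto simp: T_def\<close>)
    also have "\<dots> = (\<Sum>M\<in>g ` D. \<Sum>d | d \<in> D \<and> g d = M. \<kappa> d * (\<Prod>X\<in>#g d. w X))"
      by (rule sum.cong[OF refl]) (simp add: \<kappa>'_def sum_distrib_right)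
    also have "\<dots> = (\<Sum>d\<in>D. \<kappa> d * (\<Prod>X\<in>#g d. w X))"
      by (rule sum.image_gen[OF finD, symmetric])
    finally show "(\<Sum>M\<in>T. \<kappa>' M * (\<Prod>X\<in>#M. w X)) = 0" using expand[OF w] by simp
  qed
  moreover
  define M0 where "M0 = g (K0, \<psi>)"
  have iso0: "(rep K0, (\<psi> ` V K0, M0)) \<in> graph_iso"
    using pushforward_graph_iso[OF mg[OF K0'(1)] \<psi>_inj] by (simp add: VE M0_def g_def)
  have d0: "(K0, \<psi>) \<in> D" using K0'(1) \<psi> by (simp add: D_def)
  have "M0 \<in> T"
  proof -
    have "(\<psi> ` V K0, M0) \<in> multigraphs" using iso0 by (auto simp: graph_iso_def)
    then show ?thesis using d0 multigraphsD(3) by (auto simp: T_def M0_def)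
  qed
  ultimately have "\<kappa>' M0 = 0" by blast
  have only: "K = K0" if d: "(K, \<phi>) \<in> D" "g (K, \<phi>) = M0" "\<gamma> K \<noteq> 0" for K \<phi>
  proof -
    have KK: "K \<in> ?KK" using d(1) by (auto simp: D_def)
    have "\<phi> ` V K = \<Union> (set_mset M0)"
      unfolding d(2)[symmetric] g_def using no_isolated_Union[OF mg[OF KK] ni[OF KK]] by auto
    also have "\<dots> = \<psi> ` V K0"
      unfolding M0_def g_def using no_isolated_Union[OF mg[OF K0'(1)] ni[OF K0'(1)]] by auto
    finally have im: "\<phi> ` V K = \<psi> ` V K0" .
    have finV: "finite (V K)" using multigraphsD(1)[OF mg[OF KK]] .
    have "card (\<phi> ` V K) = card (V K0)" unfolding im using \<psi>_inj by (rule card_image)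
    moreover have "card (V K) \<le> card (V K0)" using max KK d(3) by (auto simp: B_def)
    ultimately have "card (\<phi> ` V K) = card (V K)" using card_image_le[OF finV, of \<phi>] by simp
    then have "inj_on \<phi> (V K)" using finV by (rule eq_card_imp_inj_on[rotated])
    then have "(rep K, (\<phi> ` V K, image_mset (image \<phi>) (E K))) \<in> graph_iso"
      using pushforward_graph_iso[OF mg[OF KK]] by (simp add: VE)
    then have "(rep K, (\<psi> ` V K0, M0)) \<in> graph_iso"
      using d(2) im by (simp add: g_def)
    then have "(rep K, rep K0) \<in> graph_iso"
      using iso0 equiv_graph_iso by (metis equivE symE transE)
    then show ?thesis using multigraph_classes_eqI KK K0'(1) by blast
  qed
  \<comment> \<open>Among the classes with nonzero coefficient only K0 reaches M0, through maps that
    differ by automorphisms of \<open>rep K0\<close>. Multiplication by \<open>\<gamma> K0\<close>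
    turns all contributions into nonnegative numbers, so nothing cancels and the automorphisms need
    not be counted.\<close>
  have "0 < (\<Sum>d | d \<in> D \<and> g d = M0. \<kappa> d * \<gamma> K0)"
  proof (rule sum_pos2)
    show "finite {d. d \<in> D \<and> g d = M0}" using finD by simp
    show "(K0, \<psi>) \<in> {d. d \<in> D \<and> g d = M0}" using d0 by (simp add: M0_def)
    show "0 < \<kappa> (K0, \<psi>) * \<gamma> K0"
      using K0'(2) p by (auto simp: \<kappa>_def zero_less_mult_iff zero_less_divide_iff divide_less_0_iff)
    fix d assume d: "d \<in> {d. d \<in> D \<and> g d = M0}"
    obtain K \<phi> where K\<phi>: "d = (K, \<phi>)" by (cases d)
    show "0 \<le> \<kappa> d * \<gamma> K0"
    proof (cases "\<gamma> K = 0")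
      case False
      then have "K = K0" using only d K\<phi> by auto
      then show ?thesis using p by (simp add: K\<phi> \<kappa>_def)
    qed (simp add: K\<phi> \<kappa>_def)
  qed
  then show False using \<open>\<kappa>' M0 = 0\<close> by (simp add: \<kappa>'_def sum_distrib_right[symmetric])
qed

section \<open>Random refinements of step kernels\<close>

definition edge_sets :: "nat \<Rightarrow> nat set set" where
  "edge_sets N = {X. X \<subseteq> {1..N} \<and> card X = 2}"

lemma finite_edge_sets: "finite (edge_sets N)"
  by (rule finite_subset[of _ "Pow {1..N}"]) (auto simp: edge_sets_def)

text \<open>The probability of \<open>U\<close> when each \<open>X \<in> A\<close> is selected independently with probability \<open>w X\<close>.\<close>

definition selection_prob :: "'a set \<Rightarrow> ('a \<Rightarrow> real) \<Rightarrow> 'a set \<Rightarrow> real" where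
  "selection_prob A w U = (\<Prod>X\<in>U. w X) * (\<Prod>X\<in>A - U. 1 - w X)"

text \<open>Independence of the selections: a product of binomials over A expands into a sum over
  the subsets U from which the first summand is taken. Elements outside D contribute the factor w +
  (1 - w) = 1.\<close>

lemma selection_expectation_prod:
  fixes f :: "'a \<Rightarrow> bool \<Rightarrow> real"
  assumes "finite A" "D \<subseteq> A"
  shows "(\<Sum>U\<in>Pow A. selection_prob A w U * (\<Prod>X\<in>D. f X (X \<in> U)))
    = (\<Prod>X\<in>D. w X * f X True + (1 - w X) * f X False)"
proof -
  define h where "h X b = (if X \<in> D then f X b else 1)" for X b
  have finD: "finite D" using assms finite_subset by blast
  have restr: "(\<Prod>X\<in>A. if X \<in> D then k X else 1) = (\<Prod>X\<in>D. k X)" for k :: "'a \<Rightarrow> real"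
    using assms by (simp add: prod.If_cases Int_absorb1)
  have "(\<Prod>X\<in>D. w X * f X True + (1 - w X) * f X False)
      = (\<Prod>X\<in>A. if X \<in> D then w X * f X True + (1 - w X) * f X False else 1)"
    by (rule restr[symmetric])
  also have "\<dots> = (\<Prod>X\<in>A. w X * h X True + (1 - w X) * h X False)"
    by (rule prod.cong) (auto simp: h_def)
  also have "\<dots> = (\<Sum>U\<in>Pow A. (\<Prod>X\<in>U. w X * h X True) * (\<Prod>X\<in>A - U. (1 - w X) * h X False))"
    by (rule prod_add[OF assms(1)])
  also have "\<dots> = (\<Sum>U\<in>Pow A. selection_prob A w U * (\<Prod>X\<in>D. f X (X \<in> U)))"
  proof (rule sum.cong[OF refl])
    fix U assume "U \<in> Pow A"
    then have U: "A = U \<union> (A - U)" "finite U" using assms finite_subset by auto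
    have "(\<Prod>X\<in>D. f X (X \<in> U)) = (\<Prod>X\<in>A. h X (X \<in> U))"
      unfolding h_def by (rule restr[symmetric])
    also have "\<dots> = (\<Prod>X\<in>U. h X (X \<in> U)) * (\<Prod>X\<in>A - U. h X (X \<in> U))"
      by (subst U(1), rule prod.union_disjoint) (use U assms in auto)
    also have "\<dots> = (\<Prod>X\<in>U. h X True) * (\<Prod>X\<in>A - U. h X False)"
      by (intro arg_cong2[where f = "(*)"] prod.cong) auto
    finally show "(\<Prod>X\<in>U. w X * h X True) * (\<Prod>X\<in>A - U. (1 - w X) * h X False)
        = selection_prob A w U * (\<Prod>X\<in>D. f X (X \<in> U))"
      by (simp add: selection_prob_def prod.distrib)
  qed
  finally show ?thesis by simp
qed

lemma selection_prob_sum: "finite A \<Longrightarrow> (\<Sum>U\<in>Pow A. selection_prob A w U) = 1"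
  using selection_expectation_prod[of A "{}" w "\<lambda>_ _. 0"] by simp

lemma selection_prob_nonneg: "(\<And>X. 0 \<le> w X \<and> w X \<le> 1) \<Longrightarrow> 0 \<le> selection_prob A w U"
  unfolding selection_prob_def by (intro mult_nonneg_nonneg prod_nonneg) auto

lemma selection_expectation_mono:
  assumes "\<And>X. 0 \<le> w X \<and> w X \<le> 1" "\<And>U. U \<subseteq> A \<Longrightarrow> f U \<le> g U"
  shows "(\<Sum>U\<in>Pow A. selection_prob A w U * f U) \<le> (\<Sum>U\<in>Pow A. selection_prob A w U * g U)"
  by (intro sum_mono mult_left_mono selection_prob_nonneg assms) auto

lemma selection_expectation_const:
  "finite A \<Longrightarrow> (\<Sum>U\<in>Pow A. selection_prob A w U * c) = c"
  by (simp add: sum_distrib_right[symmetric] selection_prob_sum)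

lemma selection_expectation_dist_le:
  assumes "finite A" "\<And>X. 0 \<le> w X \<and> w X \<le> 1"
    and "(\<Sum>U\<in>Pow A. selection_prob A w U * \<bar>f U - c\<bar>) \<le> b"
  shows "\<bar>(\<Sum>U\<in>Pow A. selection_prob A w U * f U) - c\<bar> \<le> b"
proof -
  have "(\<Sum>U\<in>Pow A. selection_prob A w U * f U) - c = (\<Sum>U\<in>Pow A. selection_prob A w U * (f U - c))"
    using selection_expectation_const[OF assms(1), of w c] by (simp add: right_diff_distrib sum_subtractf)
  also have "\<bar>\<dots>\<bar> \<le> (\<Sum>U\<in>Pow A. \<bar>selection_prob A w U * (f U - c)\<bar>)" by (rule sum_abs)
  also have "\<dots> = (\<Sum>U\<in>Pow A. selection_prob A w U * \<bar>f U - c\<bar>)"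
    by (simp add: abs_mult selection_prob_nonneg assms(2))
  finally show ?thesis using assms(3) by linarith
qed

lemma edge_indicator_in_edge_weights:
  "U \<subseteq> edge_sets N \<Longrightarrow> (\<lambda>X. of_bool (X \<in> U)) \<in> edge_weights"
  by (auto simp: edge_weights_def loopless_def edge_sets_def)

text \<open>Cell \<open>i\<close> of the \<open>n\<close>-fold refined grid lies in cell \<open>\<lceil>i / n\<rceil>\<close> of the original one.\<close>

definition blowup :: "nat \<Rightarrow> (nat set \<Rightarrow> real) \<Rightarrow> nat set \<Rightarrow> real" where
  "blowup n w X = (if card X = 2 then w ((\<lambda>i. (i + n - 1) div n) ` X) else 0)"

lemma blowup_in_edge_weights: "w \<in> edge_weights \<Longrightarrow> blowup n w \<in> edge_weights"
  by (auto simp: edge_weights_def loopless_def blowup_def)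

lemma cell_coarsen:
  assumes "p \<ge> 1" "n \<ge> 1" "x \<in> {0<..1}"
  shows "cell p x = (cell (p * n) x + n - 1) div n"
proof (rule cell_unique[OF assms(1)])
  define b where "b = cell (p * n) x"
  have "p * n \<ge> 1" using assms by simp
  then have b: "b \<ge> 1" "x \<in> cell_interval (p * n) b"
    using cell_range[of "p * n" x] assms(3) by (auto simp: b_def)
  define a where "a = (b + n - 1) div n"
  have 1: "b \<le> a * n"
    using div_mult_mod_eq[of "b + n - 1" n] mod_less_divisor[of n "b + n - 1"] assms(2)
    unfolding a_def by linarith
  have 2: "a * n \<le> b + n - 1" unfolding a_def by simp
  have "real b \<le> real a * real n" using 1 by (metis of_nat_le_iff of_nat_mult)
  moreover have "real a * real n \<le> real b + real n - 1"
  proof -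
    have "real (a * n) \<le> real (b + n - 1)" using 2 by (simp only: of_nat_le_iff)
    then show ?thesis using b(1) by simp
  qed
  moreover have "real b - 1 < x * (real p * real n)" "x * (real p * real n) \<le> real b"
    using b(2) assms(1,2) by (auto simp: cell_interval_def field_simps)
  moreover have "x * (real p * real n) = x * real p * real n" "(real a - 1) * real n = real a * real n - real n"
    by (simp_all add: left_diff_distrib)
  ultimately have "x * real p * real n \<le> real a * real n" "(real a - 1) * real n < x * real p * real n"
    by linarith+
  then have "x * real p \<le> real a" "real a - 1 < x * real p"
    using assms(2) by (auto dest: mult_right_le_imp_le mult_right_less_imp_less)
  then show "x \<in> cell_interval p a" using assms(1) by (auto simp: cell_interval_def field_simps)
qed

lemma step_kernel_blowup:
  assumes "p \<ge> 1" "n \<ge> 1" "w \<in> edge_weights"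
  shows "step_kernel p w = step_kernel (p * n) (blowup n w)"
proof (rule ext, clarify)
  fix x y :: real
  show "step_kernel p w (x, y) = step_kernel (p * n) (blowup n w) (x, y)"
  proof (cases "x \<in> {0<..1} \<and> y \<in> {0<..1}")
    case True
    let ?i = "cell (p * n) x" and ?j = "cell (p * n) y"
    have c: "{cell p x, cell p y} = (\<lambda>i. (i + n - 1) div n) ` {?i, ?j}"
      using True cell_coarsen[OF assms(1,2)] by simp
    \<comment> \<open>Coinciding fine cells lie in a common coarse cell, where
      \<open>loopless\<close> gives 0, the value that \<open>blowup\<close> prescribes. Distinct
      fine cells inside one coarse cell also receive the weight of a singleton.\<close>
    have "w {cell p x, cell p y} = blowup n w {?i, ?j}"
    proof (cases "?i = ?j")
      case True
      then show ?thesis unfolding c using assms(3) by (simp add: blowup_def edge_weights_def loopless_def)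
    next
      case False
      then have "card {?i, ?j} = 2" by simp
      then show ?thesis unfolding c blowup_def by simp
    qed
    then show ?thesis using True by (simp add: step_kernel_def)
  qed (auto simp: step_kernel_def)
qed

section \<open>Cut norms of step kernels and four-cycles\<close>

text \<open>Expanding the square gives the sum over all closed walks a b a' b' of the product of the
  four weights: N^4 times the density of the four-cycle in d. Unlike the cut norm, which is a
  supremum over sets, it is a polynomial in the weights, so its expectation can be computed term by
  term.\<close>

definition four_cycle_sum :: "nat \<Rightarrow> (nat set \<Rightarrow> real) \<Rightarrow> real" where
  "four_cycle_sum N d = (\<Sum>b=1..N. \<Sum>b'=1..N. (\<Sum>a=1..N. d {a, b} * d {a, b'})\<^sup>2)"

lemma four_cycle_sum_nonneg: "0 \<le> four_cycle_sum N d"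
  unfolding four_cycle_sum_def by (intro sum_nonneg) auto

text \<open>Each of the two applications of the Cauchy-Schwarz inequality doubles one side of the cut.\<close>

lemma bilinear_le_four_cycle_sum:
  fixes x y :: "nat \<Rightarrow> real"
  assumes "N \<ge> 1" "\<And>a. a \<in> {1..N} \<Longrightarrow> 0 \<le> x a \<and> x a \<le> 1 / N" "\<And>a. a \<in> {1..N} \<Longrightarrow> 0 \<le> y a \<and> y a \<le> 1 / N"
  shows "(\<Sum>a=1..N. \<Sum>b=1..N. d {a, b} * (x a * y b)) ^ 4 \<le> four_cycle_sum N d / real N ^ 4"
proof -
  define r where "r a = (\<Sum>b=1..N. d {a, b} * y b)" for a
  define c where "c = (\<lambda>(b, b'). \<Sum>a=1..N. d {a, b} * d {a, b'})"
  let ?I = "\<Sum>a=1..N. \<Sum>b=1..N. d {a, b} * (x a * y b)"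
  let ?P = "{1..N} \<times> {1..N}"
  have N: "0 < real N" using assms(1) by simp
  have sq: "(\<Sum>a=1..N. (x a)\<^sup>2) \<le> 1 / N"
  proof -
    have "(\<Sum>a=1..N. (x a)\<^sup>2) \<le> (\<Sum>a=1..N. (1 / real N)\<^sup>2)"
      using assms(2) by (intro sum_mono power_mono) auto
    also have "\<dots> = 1 / N" using N by (simp add: power2_eq_square)
    finally show ?thesis .
  qed
  have "?I = (\<Sum>a=1..N. x a * r a)"
    unfolding r_def sum_distrib_left by (intro sum.cong refl) (simp add: algebra_simps)
  then have "?I\<^sup>2 \<le> (\<Sum>a=1..N. (x a)\<^sup>2) * (\<Sum>a=1..N. (r a)\<^sup>2)"
    using Cauchy_Schwarz_ineq_sum[of x r "{1..N}"] by simp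
  also have "\<dots> \<le> 1 / N * (\<Sum>a=1..N. (r a)\<^sup>2)"
    by (intro mult_right_mono sq sum_nonneg) auto
  finally have 1: "?I\<^sup>2 \<le> 1 / N * (\<Sum>a=1..N. (r a)\<^sup>2)" .
  have "(\<Sum>a=1..N. (r a)\<^sup>2) = (\<Sum>a=1..N. \<Sum>b=1..N. \<Sum>b'=1..N. (d {a, b} * y b) * (d {a, b'} * y b'))"
    unfolding r_def power2_eq_square sum_product by simp
  also have "\<dots> = (\<Sum>b=1..N. \<Sum>b'=1..N. \<Sum>a=1..N. (d {a, b} * y b) * (d {a, b'} * y b'))"
    by (subst sum.swap, rule sum.cong[OF refl], rule sum.swap)
  also have "\<dots> = (\<Sum>(b, b')\<in>?P. \<Sum>a=1..N. (d {a, b} * y b) * (d {a, b'} * y b'))"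
    by (rule sum.cartesian_product)
  also have "\<dots> = (\<Sum>z\<in>?P. (y (fst z) * y (snd z)) * c z)"
    unfolding c_def
    by (intro sum.cong refl) (auto simp: sum_distrib_left algebra_simps)
  finally have r: "(\<Sum>a=1..N. (r a)\<^sup>2) = (\<Sum>z\<in>?P. (y (fst z) * y (snd z)) * c z)" .
  have "(\<Sum>a=1..N. (r a)\<^sup>2)\<^sup>2 \<le> (\<Sum>z\<in>?P. (y (fst z) * y (snd z))\<^sup>2) * (\<Sum>z\<in>?P. (c z)\<^sup>2)"
    unfolding r by (rule Cauchy_Schwarz_ineq_sum)
  also have "(\<Sum>z\<in>?P. (c z)\<^sup>2) = four_cycle_sum N d"
    unfolding four_cycle_sum_def c_def sum.cartesian_product by (simp add: case_prod_unfold)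
  also have "(\<Sum>z\<in>?P. (y (fst z) * y (snd z))\<^sup>2) * four_cycle_sum N d \<le> 1 / N ^ 2 * four_cycle_sum N d"
  proof (rule mult_right_mono[OF _ four_cycle_sum_nonneg])
    have "(\<Sum>z\<in>?P. (y (fst z) * y (snd z))\<^sup>2) \<le> (\<Sum>z\<in>?P. ((1 / N) * (1 / N))\<^sup>2)"
      using assms(3) by (intro sum_mono power_mono mult_mono) auto
    also have "\<dots> = 1 / N ^ 2" using N by (simp add: power2_eq_square)
    finally show "(\<Sum>z\<in>?P. (y (fst z) * y (snd z))\<^sup>2) \<le> 1 / N ^ 2" .
  qed
  finally have 2: "(\<Sum>a=1..N. (r a)\<^sup>2)\<^sup>2 \<le> 1 / N ^ 2 * four_cycle_sum N d" .
  have "?I ^ 4 = (?I\<^sup>2)\<^sup>2" by simp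
  also have "\<dots> \<le> (1 / N * (\<Sum>a=1..N. (r a)\<^sup>2))\<^sup>2" using 1 by (intro power_mono) auto
  also have "\<dots> = 1 / N ^ 2 * (\<Sum>a=1..N. (r a)\<^sup>2)\<^sup>2" by (simp add: power_mult_distrib power_divide)
  also have "\<dots> \<le> 1 / N ^ 2 * (1 / N ^ 2 * four_cycle_sum N d)" using 2 by (intro mult_left_mono) auto
  finally show ?thesis by (simp add: power_add[symmetric] mult.commute divide_simps)
qed

text \<open>\<open>cut_norm\<close> ranges over Lebesgue sets, while the product measure is built
  from Borel sets. With each factor written as a Borel set plus a null part, the rectangle differs
  from a Borel rectangle only inside two null strips.\<close>

lemma lebesgue_Times:
  fixes A B :: "real set"
  assumes "A \<in> sets lebesgue" "B \<in> sets lebesgue"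
  shows "A \<times> B \<in> sets lebesgue" "emeasure lebesgue (A \<times> B) = emeasure lebesgue A * emeasure lebesgue B"
proof -
  obtain S M M' where A: "A = S \<union> M" "M \<subseteq> M'" "M' \<in> null_sets lborel" "S \<in> sets lborel"
    using assms(1) by (rule sets_completionE)
  obtain T N N' where B: "B = T \<union> N" "N \<subseteq> N'" "N' \<in> null_sets lborel" "T \<in> sets lborel"
    using assms(2) by (rule sets_completionE)
  define Q where "Q = A \<times> B - S \<times> T"
  have AB: "A \<times> B = S \<times> T \<union> Q" unfolding Q_def using A(1) B(1) by auto
  have "M' \<times> UNIV \<in> null_sets (lborel \<Otimes>\<^sub>M lborel)" "UNIV \<times> N' \<in> null_sets (lborel \<Otimes>\<^sub>M (lborel::real measure))"
    using A(3) B(3) by (auto simp: null_sets_def lborel.emeasure_pair_measure_Times)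
  then have "M' \<times> UNIV \<union> UNIV \<times> N' \<in> null_sets (lborel :: (real \<times> real) measure)"
    unfolding lborel_prod by (rule null_sets.Un)
  moreover have "Q \<subseteq> M' \<times> UNIV \<union> UNIV \<times> N'" unfolding Q_def using A B by auto
  ultimately have Q: "Q \<in> null_sets lebesgue"
    using null_sets_completion_subset null_sets_completionI by metis
  have ST: "S \<times> T \<in> sets (lborel \<Otimes>\<^sub>M lborel)" using A(4) B(4) by (rule pair_measureI)
  then have ST': "S \<times> T \<in> sets lborel" unfolding lborel_prod .
  show "A \<times> B \<in> sets lebesgue"
    unfolding AB using Q ST' by (metis null_setsD2 sets.Un sets_completionI_sets)
  have "emeasure lebesgue (A \<times> B) = emeasure lebesgue (S \<times> T)"
    unfolding AB using Q ST' by (intro emeasure_Un_null_set) auto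
  also have "\<dots> = emeasure (lborel \<Otimes>\<^sub>M lborel) (S \<times> T)" using ST' by (simp add: lborel_prod)
  also have "\<dots> = emeasure lborel S * emeasure lborel T"
    using A(4) B(4) by (rule lborel.emeasure_pair_measure_Times)
  also have "emeasure lborel S = emeasure lebesgue A"
    unfolding A(1) using A null_sets_completion_subset[OF A(2) null_sets_completionI[OF A(3)]]
    by (subst emeasure_Un_null_set) auto
  also have "emeasure lborel T = emeasure lebesgue B"
    unfolding B(1) using B null_sets_completion_subset[OF B(2) null_sets_completionI[OF B(3)]]
    by (subst emeasure_Un_null_set) auto
  finally show "emeasure lebesgue (A \<times> B) = emeasure lebesgue A * emeasure lebesgue B" .
qed

lemma cut_norm_leI:
  assumes "\<And>S T. S \<in> sets lebesgue \<Longrightarrow> T \<in> sets lebesgue \<Longrightarrow> S \<subseteq> {0..1} \<Longrightarrow> T \<subseteq> {0..1} \<Longrightarrow>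
      \<bar>LINT z : S \<times> T | lebesgue. f z\<bar> \<le> b"
  shows "cut_norm f \<le> b"
  unfolding cut_norm_def
proof (rule cSUP_least)
  show "{(S, T). S \<in> sets lebesgue \<and> T \<in> sets lebesgue \<and> S \<subseteq> {0..1::real} \<and> T \<subseteq> {0..1::real}} \<noteq> {}"
    by (auto intro!: exI[of _ "{}"])
qed (use assms in auto)

text \<open>The integral over S \<times> T depends only on the masses of S and T in the cells. These
  are at most 1 / N, so \<open>bilinear_le_four_cycle_sum\<close> bounds it uniformly in S and
  T.\<close>

lemma cut_norm_step_kernel_le:
  assumes "N \<ge> 1"
  shows "cut_norm (step_kernel N d) \<le> root 4 (four_cycle_sum N d / real N ^ 4)"
proof (rule cut_norm_leI)
  fix S T :: "real set" assume ST: "S \<in> sets lebesgue" "T \<in> sets lebesgue"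
  let ?I = "cell_interval N"
  define x where "x a = measure lebesgue (S \<inter> ?I a)" for a
  define y where "y a = measure lebesgue (T \<inter> ?I a)" for a
  have I: "?I a \<in> lmeasurable" "measure lebesgue (?I a) = 1 / N" for a
  proof -
    show "?I a \<in> lmeasurable" unfolding cell_interval_def
      by (rule bounded_set_imp_lmeasurable) auto
    show "measure lebesgue (?I a) = 1 / N"
      using assms by (simp add: cell_interval_def divide_right_mono diff_divide_distrib)
  qed
  have lm: "A \<inter> ?I a \<in> lmeasurable" if "A \<in> sets lebesgue" for A a
    using fmeasurable_Int_fmeasurable[OF I(1) that] by (simp add: Int_commute)
  have bound: "0 \<le> measure lebesgue (A \<inter> ?I a) \<and> measure lebesgue (A \<inter> ?I a) \<le> 1 / N"
    if "A \<in> sets lebesgue" for A a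
    using measure_mono_fmeasurable[OF Int_lower2 fmeasurableD[OF lm[OF that]] I(1)] by (simp add: I(2))
  have Times: "(S \<inter> ?I a) \<times> (T \<inter> ?I b) \<in> lmeasurable"
      "measure lebesgue ((S \<inter> ?I a) \<times> (T \<inter> ?I b)) = x a * y b" for a b
  proof -
    note lT = lebesgue_Times[OF fmeasurableD[OF lm[OF ST(1), of a]] fmeasurableD[OF lm[OF ST(2), of b]]]
    have fin: "emeasure lebesgue (S \<inter> ?I a) < \<infinity>" "emeasure lebesgue (T \<inter> ?I b) < \<infinity>"
      using lm[OF ST(1), of a] lm[OF ST(2), of b] by (auto simp: fmeasurable_def)
    then show "(S \<inter> ?I a) \<times> (T \<inter> ?I b) \<in> lmeasurable"
      using lT by (auto simp: fmeasurable_def ennreal_mult_less_top)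
    show "measure lebesgue ((S \<inter> ?I a) \<times> (T \<inter> ?I b)) = x a * y b"
      using lT(2) by (simp add: x_def y_def measure_def enn2real_mult)
  qed
  have "(LINT z : S \<times> T | lebesgue. step_kernel N d z)
    = (\<integral>z. (\<Sum>a=1..N. \<Sum>b=1..N. d {a, b} * indicator ((S \<inter> ?I a) \<times> (T \<inter> ?I b)) z) \<partial>lebesgue)"
    unfolding set_lebesgue_integral_def
  proof (rule Bochner_Integration.integral_cong[OF refl], clarify)
    fix u v :: real
    have "indicator (S \<times> T) (u, v) *\<^sub>R step_kernel N d (u, v) = (\<Sum>a=1..N. \<Sum>b=1..N.
        indicator (S \<times> T) (u, v) * (d {a, b} * (indicator (?I a) u * indicator (?I b) v)))"
      unfolding step_kernel_eq_sum[OF assms] by (simp add: sum_distrib_left)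
    also have "\<dots> = (\<Sum>a=1..N. \<Sum>b=1..N. d {a, b} * indicator ((S \<inter> ?I a) \<times> (T \<inter> ?I b)) (u, v))"
      by (intro sum.cong refl) (simp add: indicator_def)
    finally show "indicator (S \<times> T) (u, v) *\<^sub>R step_kernel N d (u, v) =
        (\<Sum>a=1..N. \<Sum>b=1..N. d {a, b} * indicator ((S \<inter> ?I a) \<times> (T \<inter> ?I b)) (u, v))" .
  qed
  also have "\<dots> = (\<Sum>a=1..N. \<Sum>b=1..N. d {a, b} * (x a * y b))"
  proof -
    have int: "integrable lebesgue (\<lambda>z. d {a, b} * indicator ((S \<inter> ?I a) \<times> (T \<inter> ?I b)) z :: real)" for a b
      using Times(1)[of a b] by (intro integrable_mult_right integrable_real_indicator) (auto simp: fmeasurable_def)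
    have "(\<integral>z. (\<Sum>a=1..N. \<Sum>b=1..N. d {a, b} * indicator ((S \<inter> ?I a) \<times> (T \<inter> ?I b)) z) \<partial>lebesgue)
        = (\<Sum>a=1..N. \<integral>z. (\<Sum>b=1..N. d {a, b} * indicator ((S \<inter> ?I a) \<times> (T \<inter> ?I b)) z) \<partial>lebesgue)"
      by (intro Bochner_Integration.integral_sum Bochner_Integration.integrable_sum int)
    also have "\<dots> = (\<Sum>a=1..N. \<Sum>b=1..N. \<integral>z. d {a, b} * indicator ((S \<inter> ?I a) \<times> (T \<inter> ?I b)) z \<partial>lebesgue)"
      by (intro sum.cong refl Bochner_Integration.integral_sum int)
    also have "\<dots> = (\<Sum>a=1..N. \<Sum>b=1..N. d {a, b} * (x a * y b))"
      by (intro sum.cong refl) (simp add: Times(2))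
    finally show ?thesis .
  qed
  finally have eq: "(LINT z : S \<times> T | lebesgue. step_kernel N d z) = (\<Sum>a=1..N. \<Sum>b=1..N. d {a, b} * (x a * y b))" .
  have "(LINT z : S \<times> T | lebesgue. step_kernel N d z) ^ 4 \<le> four_cycle_sum N d / real N ^ 4"
    unfolding eq using bound ST by (intro bilinear_le_four_cycle_sum[OF assms]) (auto simp: x_def y_def)
  then have "root 4 (\<bar>LINT z : S \<times> T | lebesgue. step_kernel N d z\<bar> ^ 4) \<le> root 4 (four_cycle_sum N d / real N ^ 4)"
    by (simp only: power_even_abs even_numeral) (rule real_root_le_mono[OF zero_less_numeral])
  moreover have "root 4 (\<bar>LINT z : S \<times> T | lebesgue. step_kernel N d z\<bar> ^ 4) = \<bar>LINT z : S \<times> T | lebesgue. step_kernel N d z\<bar>"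
    by (rule real_root_power_cancel) auto
  ultimately show "\<bar>LINT z : S \<times> T | lebesgue. step_kernel N d z\<bar> \<le> root 4 (four_cycle_sum N d / real N ^ 4)"
    by linarith
qed

text \<open>If a, a', b, b' are distinct, so are the four edges, and the product of independent
  centred variables has mean 0. Every other quadruple shows one of 6 coincidences, each of which
  leaves N^3 quadruples, and no product exceeds 1.\<close>

lemma expected_four_cycle_sum_le:
  assumes w: "w \<in> edge_weights" and N: "N \<ge> 1"
  shows "(\<Sum>U\<in>Pow (edge_sets N). selection_prob (edge_sets N) w U *
      four_cycle_sum N (\<lambda>X. of_bool (X \<in> U) - w X)) \<le> 6 * real N ^ 3"
proof -
  let ?A = "edge_sets N" and ?I = "{1..N}"
  note fA = finite_edge_sets[of N]
  have w01: "0 \<le> w X \<and> w X \<le> 1" for X using w by (auto simp: edge_weights_def)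
  define E where "E h = (\<Sum>U\<in>Pow ?A. selection_prob ?A w U * h U)" for h :: "nat set set \<Rightarrow> real"
  define d where "d U X = (of_bool (X \<in> U) - w X :: real)" for U X
  define q where "q a a' b b' U = d U {a, b} * d U {a, b'} * (d U {a', b} * d U {a', b'})" for a a' b b' U
  have E_sum: "E (\<lambda>U. \<Sum>i\<in>J. h i U) = (\<Sum>i\<in>J. E (h i))" for J :: "nat set" and h
    unfolding E_def sum_distrib_left by (rule sum.swap)
  have d1: "\<bar>d U X\<bar> \<le> 1" for U X using w01[of X] by (auto simp: d_def abs_le_iff of_bool_def)
  have q_le: "E (q a a' b b') \<le> 1" for a a' b b'
  proof -
    have "\<bar>q a a' b b' U\<bar> \<le> 1" for U
      unfolding q_def abs_mult by (intro mult_le_one d1 mult_nonneg_nonneg abs_ge_zero)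
    then have "E (q a a' b b') \<le> E (\<lambda>_. 1)"
      unfolding E_def by (intro selection_expectation_mono[OF w01]) (meson abs_le_D1)
    then show ?thesis unfolding E_def selection_expectation_const[OF fA] .
  qed
  have q_zero: "E (q a a' b b') = 0"
    if "a \<in> ?I" "a' \<in> ?I" "b \<in> ?I" "b' \<in> ?I" and dist: "distinct [a, a', b, b']" for a a' b b'
  proof -
    define D where "D = {{a, b}, {a, b'}, {a', b}, {a', b'}}"
    have D: "D \<subseteq> ?A" using that by (auto simp: D_def edge_sets_def)
    have "q a a' b b' U = (\<Prod>X\<in>D. of_bool (X \<in> U) - w X)" for U
      using dist by (simp add: D_def q_def d_def doubleton_eq_iff)
    then have "E (q a a' b b') = (\<Prod>X\<in>D. w X * (of_bool True - w X) + (1 - w X) * (of_bool False - w X))"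
      unfolding E_def using selection_expectation_prod[OF fA D, of w "\<lambda>X b. of_bool b - w X"] by simp
    \<comment> \<open>Each factor is the mean of a centred variable: w (1 - w) - (1 - w) w =
      0.\<close>
    also have "\<dots> = 0"
      by (rule prod_zero) (auto simp: D_def algebra_simps)
    finally show ?thesis .
  qed
  have q_bound: "E (q a a' b b') \<le> of_bool (a = a') + of_bool (a = b) + of_bool (a = b')
      + of_bool (a' = b) + of_bool (a' = b') + of_bool (b = b')"
    if "a \<in> ?I" "a' \<in> ?I" "b \<in> ?I" "b' \<in> ?I" for a a' b b'
  proof (cases "distinct [a, a', b, b']")
    case True
    then show ?thesis using q_zero[OF that] by simp
  next
    case False
    then have "1 \<le> (of_bool (a = a') + of_bool (a = b) + of_bool (a = b')
      + of_bool (a' = b) + of_bool (a' = b') + of_bool (b = b') :: real)"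
      by (auto simp: of_bool_def)
    then show ?thesis using q_le[of a a' b b'] by linarith
  qed
  have "E (\<lambda>U. four_cycle_sum N (d U)) = (\<Sum>b=1..N. \<Sum>b'=1..N. \<Sum>a=1..N. \<Sum>a'=1..N. E (q a a' b b'))"
    unfolding four_cycle_sum_def power2_eq_square sum_product E_sum q_def ..
  also have "\<dots> \<le> (\<Sum>b=1..N. \<Sum>b'=1..N. \<Sum>a=1..N. \<Sum>a'=1..N.
      of_bool (a = a') + of_bool (a = b) + of_bool (a = b')
      + of_bool (a' = b) + of_bool (a' = b') + of_bool (b = b'))"
    by (intro sum_mono q_bound)
  also have "\<dots> = 6 * real N ^ 3"
  proof -
    have del: "(\<Sum>i=1..N. of_bool (i = j)) = (1::real)" "(\<Sum>i=1..N. of_bool (j = i)) = (1::real)"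
      if "j \<in> ?I" for j using that by (simp_all add: of_bool_def)
    have dd: "(\<Sum>i=1..N. \<Sum>j=1..N. of_bool (i = j)) = real N" "(\<Sum>i=1..N. \<Sum>j=1..N. of_bool (j = i)) = real N"
      using sum.cong[OF refl del(2), of ?I] sum.cong[OF refl del(1), of ?I] by simp_all
    have "(\<Sum>b=1..N. \<Sum>b'=1..N. \<Sum>a=1..N. \<Sum>a'=1..N. of_bool (a = a')) = real N ^ 3"
      "(\<Sum>b=1..N. \<Sum>b'=1..N. \<Sum>a=1..N. \<Sum>a'=1..N. of_bool (a = b)) = real N ^ 3"
      "(\<Sum>b=1..N. \<Sum>b'=1..N. \<Sum>a=1..N. \<Sum>a'=1..N. of_bool (a = b')) = real N ^ 3"
      "(\<Sum>b=1..N. \<Sum>b'=1..N. \<Sum>a=1..N. \<Sum>a'=1..N. of_bool (a' = b)) = real N ^ 3"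
      "(\<Sum>b=1..N. \<Sum>b'=1..N. \<Sum>a=1..N. \<Sum>a'=1..N. of_bool (a' = b')) = real N ^ 3"
      "(\<Sum>b=1..N. \<Sum>b'=1..N. \<Sum>a=1..N. \<Sum>a'=1..N. of_bool (b = b')) = real N ^ 3"
      using dd by (simp_all add: sum_distrib_left[symmetric] power3_eq_cube del: sum_of_bool_eq sum_mult_of_bool_eq sum_of_bool_mult_eq)
    then show ?thesis by (simp only: sum.distrib)
  qed
  finally show ?thesis unfolding E_def d_def .
qed

section \<open>Expected densities of random refinements\<close>

text \<open>Such a map is determined by its restriction away from v.\<close>

lemma card_PiE_coincidence_le:
  assumes "finite V" "u \<in> V" "v \<in> V" "u \<noteq> v"
  shows "card {\<phi> \<in> V \<rightarrow>\<^sub>E {1..N::nat}. \<phi> u = \<phi> v} \<le> N ^ (card V - 1)"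
proof -
  let ?R = "\<lambda>\<phi>::'a \<Rightarrow> nat. restrict \<phi> (V - {v})"
  let ?S = "{\<phi> \<in> V \<rightarrow>\<^sub>E {1..N}. \<phi> u = \<phi> v}"
  have "card ?S \<le> card ((V - {v}) \<rightarrow>\<^sub>E {1..N})"
  proof (rule card_inj_on_le[of ?R])
    show "inj_on ?R ?S"
    proof (rule inj_onI)
      fix \<phi> \<psi> assume S: "\<phi> \<in> ?S" "\<psi> \<in> ?S" and eq: "?R \<phi> = ?R \<psi>"
      have *: "\<phi> x = \<psi> x" if "x \<in> V - {v}" for x
        using fun_cong[OF eq, of x] that by simp
      have "\<phi> x = \<psi> x" if "x \<in> V" for x
        using *[of x] *[of u] S assms that by (cases "x = v") auto
      then show "\<phi> = \<psi>" using S by (intro PiE_ext[of \<phi> V "\<lambda>_. {1..N}" \<psi>]) auto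
    qed
    show "?R ` ?S \<subseteq> (V - {v}) \<rightarrow>\<^sub>E {1..N}" by (auto simp: PiE_iff split: if_splits)
    show "finite ((V - {v}) \<rightarrow>\<^sub>E {1..N})" using assms(1) by (intro finite_PiE) auto
  qed
  also have "\<dots> = N ^ (card V - 1)" using assms by (simp add: card_PiE)
  finally show ?thesis .
qed

text \<open>Union bound over the ordered pairs of distinct vertices. The bound is written relative
  to the number of all maps, since only the share of noninjective maps matters.\<close>

lemma card_PiE_noninjective_le:
  assumes "finite V" "N \<ge> 1"
  shows "real (card {\<phi> \<in> V \<rightarrow>\<^sub>E {1..N::nat}. \<not> inj_on \<phi> V}) \<le> (real (card V))\<^sup>2 * real N ^ card V / real N"
proof (cases "V = {}")
  case False
  let ?P = "{(u, v). u \<in> V \<and> v \<in> V \<and> u \<noteq> v}"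
  have finP: "finite ?P" by (rule finite_subset[of _ "V \<times> V"]) (use assms in auto)
  have "card {\<phi> \<in> V \<rightarrow>\<^sub>E {1..N}. \<not> inj_on \<phi> V} \<le> card (\<Union>(u, v)\<in>?P. {\<phi> \<in> V \<rightarrow>\<^sub>E {1..N}. \<phi> u = \<phi> v})"
  proof (rule card_mono)
    show "finite (\<Union>(u, v)\<in>?P. {\<phi> \<in> V \<rightarrow>\<^sub>E {1..N}. \<phi> u = \<phi> v})"
      by (rule finite_subset[of _ "V \<rightarrow>\<^sub>E {1..N}"]) (use assms(1) in \<open>auto intro: finite_PiE\<close>)
  qed (auto simp: inj_on_def)
  also have "\<dots> \<le> (\<Sum>z\<in>?P. card (case z of (u, v) \<Rightarrow> {\<phi> \<in> V \<rightarrow>\<^sub>E {1..N}. \<phi> u = \<phi> v}))"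
    by (rule card_UN_le[OF finP])
  also have "\<dots> \<le> (\<Sum>z\<in>?P. N ^ (card V - 1))"
    using card_PiE_coincidence_le[OF assms(1)] by (intro sum_mono) auto
  also have "\<dots> = card ?P * N ^ (card V - 1)" by simp
  also have "\<dots> \<le> card (V \<times> V) * N ^ (card V - 1)"
    using assms(1) by (intro mult_right_mono card_mono) auto
  finally have "real (card {\<phi> \<in> V \<rightarrow>\<^sub>E {1..N}. \<not> inj_on \<phi> V}) \<le> real (card (V \<times> V) * N ^ (card V - 1))"
    by (rule of_nat_mono)
  also have "\<dots> = (real (card V))\<^sup>2 * real N ^ card V / real N"
  proof -
    have "card V = Suc (card V - 1)" using False assms(1) by (simp add: card_gt_0_iff)
    then have "real N ^ card V = real N * real N ^ (card V - 1)" by (metis power_Suc)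
    then show ?thesis using assms(2) by (simp add: power2_eq_square card_cartesian_product)
  qed
  finally show ?thesis .
qed simp

text \<open>For a single map \<phi> the expectation is the product of w over the set of edge images,
  as a repeated edge is sampled once. For injective \<phi> different edges have different images, so
  this is exactly the summand of the simplification. The other maps form a share of at most
  \<open>(real (card (fst H)))\<^sup>2 / real N\<close>, and each errs by at most 1.\<close>

lemma expected_hom_avg_approx:
  assumes H: "H \<in> multigraphs" and w: "w \<in> edge_weights" and N: "N \<ge> 1"
  shows "\<bar>(\<Sum>U\<in>Pow (edge_sets N). selection_prob (edge_sets N) w U *
        hom_avg H N (\<lambda>X. of_bool (X \<in> U))) - hom_avg (simplification H) N w\<bar>
      \<le> (real (card (fst H)))\<^sup>2 / real N"
proof -
  obtain V E where HVE: "H = (V, E)" by (cases H)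
  note VE = multigraphsD[OF H[unfolded HVE]]
  let ?A = "edge_sets N" and ?\<Phi> = "V \<rightarrow>\<^sub>E {1..N}"
  define D where "D \<phi> = image \<phi> ` set_mset E" for \<phi> :: "nat \<Rightarrow> nat"
  note fA = finite_edge_sets[of N]
  have fin\<Phi>: "finite ?\<Phi>" using VE(1) by (intro finite_PiE) auto
  have w01: "0 \<le> w X" "w X \<le> 1" for X using w by (auto simp: edge_weights_def)
  have prodU: "(\<Prod>e\<in>#E. of_bool (\<phi> ` e \<in> U) :: real) = (\<Prod>X\<in>D \<phi>. of_bool (X \<in> U))" for \<phi> U
  proof (cases "\<forall>e\<in>#E. \<phi> ` e \<in> U")
    case True
    then have "(\<Prod>e\<in>#E. of_bool (\<phi> ` e \<in> U) :: real) = (\<Prod>e\<in>#E. 1)"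
      by (intro arg_cong[where f = prod_mset] image_mset_cong) auto
    moreover have "(\<Prod>X\<in>D \<phi>. of_bool (X \<in> U) :: real) = 1"
      by (rule prod.neutral) (use True in \<open>auto simp: D_def\<close>)
    ultimately show ?thesis by simp
  next
    case False
    then obtain e where e: "e \<in># E" "\<phi> ` e \<notin> U" by auto
    then have "(\<Prod>e\<in>#E. of_bool (\<phi> ` e \<in> U) :: real) = 0" by (intro prod_mset_zeroI[of e]) auto
    moreover have "(\<Prod>X\<in>D \<phi>. of_bool (X \<in> U) :: real) = 0"
      using e by (intro prod_zero) (auto simp: D_def)
    ultimately show ?thesis by simp
  qed
  have exp\<phi>: "(\<Sum>U\<in>Pow ?A. selection_prob ?A w U * (\<Prod>e\<in>#E. of_bool (\<phi> ` e \<in> U))) = (\<Prod>X\<in>D \<phi>. w X)"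
    if \<phi>: "\<phi> \<in> ?\<Phi>" for \<phi>
  proof (cases "D \<phi> \<subseteq> ?A")
    case True
    show ?thesis
      unfolding prodU using selection_expectation_prod[OF fA True, of w "\<lambda>_ b. of_bool b"] by simp
  next
    case False
    \<comment> \<open>The image of e lies in {1..N}, so missing \<open>edge_sets N\<close> means
      that \<phi> collapses e; then both sides are 0.\<close>
    then obtain e where e: "e \<in># E" "\<phi> ` e \<notin> ?A" by (auto simp: D_def)
    have "\<phi> ` e \<subseteq> {1..N}" using \<phi> VE(2)[OF e(1)] by auto
    then have "card (\<phi> ` e) \<noteq> 2" using e(2) by (auto simp: edge_sets_def)
    then have w0: "w (\<phi> ` e) = 0" using w by (auto simp: edge_weights_def loopless_def)
    have "(\<Prod>X\<in>D \<phi>. of_bool (X \<in> U) :: real) = 0" if "U \<in> Pow ?A" for U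
      using e that by (intro prod_zero) (auto simp: D_def)
    moreover have "(\<Prod>X\<in>D \<phi>. w X) = 0"
      using e(1) w0 by (intro prod_zero) (auto simp: D_def)
    ultimately show ?thesis unfolding prodU by simp
  qed
  have "(\<Sum>U\<in>Pow ?A. selection_prob ?A w U * hom_avg H N (\<lambda>X. of_bool (X \<in> U)))
      = (\<Sum>U\<in>Pow ?A. \<Sum>\<phi>\<in>?\<Phi>. selection_prob ?A w U * (\<Prod>e\<in>#E. of_bool (\<phi> ` e \<in> U))) / real N ^ card V"
    unfolding HVE hom_avg_def prod.case sum_divide_distrib by (simp add: sum_distrib_left)
  also have "(\<Sum>U\<in>Pow ?A. \<Sum>\<phi>\<in>?\<Phi>. selection_prob ?A w U * (\<Prod>e\<in>#E. of_bool (\<phi> ` e \<in> U)))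
      = (\<Sum>\<phi>\<in>?\<Phi>. \<Prod>X\<in>D \<phi>. w X)"
    by (subst sum.swap, rule sum.cong[OF refl], rule exp\<phi>)
  finally have "(\<Sum>U\<in>Pow ?A. selection_prob ?A w U * hom_avg H N (\<lambda>X. of_bool (X \<in> U)))
        - hom_avg (simplification H) N w
      = (\<Sum>\<phi>\<in>?\<Phi>. (\<Prod>X\<in>D \<phi>. w X) - (\<Prod>e\<in>set_mset E. w (\<phi> ` e))) / real N ^ card V"
    by (simp add: HVE simplification_def hom_avg_def sum_subtractf diff_divide_distrib prod_unfold_prod_mset)
  also have "\<bar>\<dots>\<bar> \<le> (\<Sum>\<phi>\<in>?\<Phi>. of_bool (\<not> inj_on \<phi> V)) / real N ^ card V"
  proof -
    have "\<bar>(\<Prod>X\<in>D \<phi>. w X) - (\<Prod>e\<in>set_mset E. w (\<phi> ` e))\<bar> \<le> of_bool (\<not> inj_on \<phi> V)" for \<phi>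
    proof (cases "inj_on \<phi> V")
      case True
      have "inj_on (image \<phi>) (set_mset E)"
      proof (rule inj_onI)
        fix c d assume "c \<in># E" "d \<in># E" "\<phi> ` c = \<phi> ` d"
        then show "c = d" using True VE(2) inj_on_image_eq_iff[of \<phi> V c d] by simp
      qed
      then show ?thesis by (simp add: D_def prod.reindex)
    next
      case False
      have "0 \<le> (\<Prod>X\<in>D \<phi>. w X)" "(\<Prod>X\<in>D \<phi>. w X) \<le> 1"
        "0 \<le> (\<Prod>e\<in>set_mset E. w (\<phi> ` e))" "(\<Prod>e\<in>set_mset E. w (\<phi> ` e)) \<le> 1"
        using w01 by (auto intro!: prod_nonneg prod_le_1)
      then show ?thesis using False by simp
    qed
    then have "\<bar>\<Sum>\<phi>\<in>?\<Phi>. (\<Prod>X\<in>D \<phi>. w X) - (\<Prod>e\<in>set_mset E. w (\<phi> ` e))\<bar> \<le> (\<Sum>\<phi>\<in>?\<Phi>. of_bool (\<not> inj_on \<phi> V))"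
      by (intro order.trans[OF sum_abs] sum_mono)
    then show ?thesis using N by (simp add: divide_right_mono)
  qed
  also have "(\<Sum>\<phi>\<in>?\<Phi>. of_bool (\<not> inj_on \<phi> V)) = real (card {\<phi> \<in> ?\<Phi>. \<not> inj_on \<phi> V})"
    using fin\<Phi> by (simp add: Int_def)
  also have "\<dots> / real N ^ card V \<le> ((real (card V))\<^sup>2 * real N ^ card V / real N) / real N ^ card V"
    by (intro divide_right_mono card_PiE_noninjective_le VE(1) N) simp
  also have "\<dots> = (real (card (fst H)))\<^sup>2 / real N" using N by (simp add: HVE)
  finally show ?thesis .
qed

text \<open>Markov's inequality for the fourth power of the cut norm.\<close>

lemma expected_value_approx:
  assumes F: "cut_continuous F" and p: "p \<ge> 1" and w: "w \<in> edge_weights"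
    and bounded: "\<And>N U. N \<ge> 1 \<Longrightarrow> U \<subseteq> edge_sets N \<Longrightarrow> \<bar>F (step_kernel N (\<lambda>X. of_bool (X \<in> U)))\<bar> \<le> B"
  shows "(\<lambda>n. \<Sum>U\<in>Pow (edge_sets (p * Suc n)). selection_prob (edge_sets (p * Suc n)) (blowup (Suc n) w) U *
      F (step_kernel (p * Suc n) (\<lambda>X. of_bool (X \<in> U)))) \<longlonglongrightarrow> F (step_kernel p w)"
    (is "?E \<longlonglongrightarrow> _")
proof (rule LIMSEQ_I)
  fix r :: real assume r: "r > 0"
  let ?f = "step_kernel p w"
  have fk: "?f \<in> kernels" using step_kernel_in_graphons[OF p w] by (simp add: graphons_def)
  obtain \<delta> where \<delta>: "\<delta> > 0"
    and cont: "\<And>g. g \<in> kernels \<Longrightarrow> cut_norm (\<lambda>z. g z - ?f z) < \<delta> \<Longrightarrow> \<bar>F g - F ?f\<bar> < r / 2"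
    using F fk r unfolding cut_continuous_def by (meson half_gt_zero)
  have "0 \<le> B" using bounded[of 1 "{}"] by simp
  \<comment> \<open>C bounds the error on samples that are far from \<open>?f\<close> in cut norm,
    where continuity at \<open>?f\<close> gives no information.\<close>
  define C where "C = B + \<bar>F ?f\<bar>"
  have C: "0 \<le> C" using \<open>0 \<le> B\<close> by (simp add: C_def)
  have main: "\<bar>?E n - F ?f\<bar> \<le> r / 2 + 6 * C / \<delta> ^ 4 / real (p * Suc n)" for n
  proof -
    define N where "N = p * Suc n"
    define v where "v = blowup (Suc n) w"
    let ?A = "edge_sets N"
    have N: "N \<ge> 1" using p by (simp add: N_def)
    have v: "v \<in> edge_weights" unfolding v_def by (rule blowup_in_edge_weights[OF w])
    have v01: "0 \<le> v X \<and> v X \<le> 1" for X using v by (auto simp: edge_weights_def)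
    have fv: "?f = step_kernel N v"
      unfolding N_def v_def by (rule step_kernel_blowup) (use p w in auto)
    \<comment> \<open>Sample by sample: either the sample is \<delta>-close and continuity gives r /
      2, or the normalised four-cycle sum is at least \<delta>^4, so that C times their quotient is
      at least C.\<close>
    have pt: "\<bar>F (step_kernel N (\<lambda>X. of_bool (X \<in> U))) - F ?f\<bar>
        \<le> r / 2 + C / \<delta> ^ 4 / real N ^ 4 * four_cycle_sum N (\<lambda>X. of_bool (X \<in> U) - v X)"
      if U: "U \<subseteq> ?A" for U
    proof -
      let ?g = "step_kernel N (\<lambda>X. of_bool (X \<in> U))"
      let ?Q = "four_cycle_sum N (\<lambda>X. of_bool (X \<in> U) - v X)"
      have Q: "0 \<le> ?Q / real N ^ 4" using four_cycle_sum_nonneg by simp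
      show ?thesis
      proof (cases "cut_norm (\<lambda>z. ?g z - ?f z) < \<delta>")
        case True
        have "?g \<in> kernels"
          using step_kernel_in_graphons[OF N edge_indicator_in_edge_weights[OF U]] by (simp add: graphons_def)
        then have "\<bar>F ?g - F ?f\<bar> < r / 2" using cont True by blast
        moreover have "0 \<le> C / \<delta> ^ 4 / real N ^ 4 * ?Q"
          using C \<delta> four_cycle_sum_nonneg by (intro mult_nonneg_nonneg divide_nonneg_nonneg) auto
        ultimately show ?thesis by linarith
      next
        case False
        have "cut_norm (\<lambda>z. ?g z - ?f z) = cut_norm (step_kernel N (\<lambda>X. of_bool (X \<in> U) - v X))"
          unfolding fv step_kernel_diff[symmetric] ..
        also have "\<dots> \<le> root 4 (?Q / real N ^ 4)" by (rule cut_norm_step_kernel_le[OF N])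
        finally have "\<delta> \<le> root 4 (?Q / real N ^ 4)" using False by linarith
        then have "\<delta> ^ 4 \<le> root 4 (?Q / real N ^ 4) ^ 4" using \<delta> by (intro power_mono) auto
        also have "\<dots> = ?Q / real N ^ 4" using Q by simp
        finally have "1 \<le> ?Q / real N ^ 4 / \<delta> ^ 4" using \<delta> by (subst le_divide_eq_1_pos) auto
        then have "C * 1 \<le> C * (?Q / real N ^ 4 / \<delta> ^ 4)" using C by (rule mult_left_mono)
        moreover have "\<bar>F ?g - F ?f\<bar> \<le> C" using bounded[OF N U] by (simp add: C_def)
        ultimately show ?thesis using r by (simp add: mult.commute)
      qed
    qed
    have "\<bar>(\<Sum>U\<in>Pow ?A. selection_prob ?A v U * F (step_kernel N (\<lambda>X. of_bool (X \<in> U)))) - F ?f\<bar>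
        \<le> r / 2 + 6 * C / \<delta> ^ 4 / real N"
    proof (rule selection_expectation_dist_le[OF finite_edge_sets v01])
      have "(\<Sum>U\<in>Pow ?A. selection_prob ?A v U * \<bar>F (step_kernel N (\<lambda>X. of_bool (X \<in> U))) - F ?f\<bar>)
        \<le> (\<Sum>U\<in>Pow ?A. selection_prob ?A v U *
            (r / 2 + C / \<delta> ^ 4 / real N ^ 4 * four_cycle_sum N (\<lambda>X. of_bool (X \<in> U) - v X)))"
        by (rule selection_expectation_mono[OF v01 pt])
      also have "\<dots> = (\<Sum>U\<in>Pow ?A. selection_prob ?A v U * (r / 2)) + C / \<delta> ^ 4 / real N ^ 4 *
          (\<Sum>U\<in>Pow ?A. selection_prob ?A v U * four_cycle_sum N (\<lambda>X. of_bool (X \<in> U) - v X))"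
        unfolding sum_distrib_left sum.distrib[symmetric] by (rule sum.cong[OF refl]) (simp only: distrib_left mult.left_commute)
      also have "(\<Sum>U\<in>Pow ?A. selection_prob ?A v U * (r / 2)) = r / 2"
        by (rule selection_expectation_const[OF finite_edge_sets])
      also have "C / \<delta> ^ 4 / real N ^ 4 *
          (\<Sum>U\<in>Pow ?A. selection_prob ?A v U * four_cycle_sum N (\<lambda>X. of_bool (X \<in> U) - v X))
          \<le> C / \<delta> ^ 4 / real N ^ 4 * (6 * real N ^ 3)"
        using C \<delta> by (intro mult_left_mono expected_four_cycle_sum_le[OF v N]) auto
      \<comment> \<open>The expected four-cycle sum has order N^3 against the normalisation N^4,
        which leaves the factor 1 / N.\<close>
      also have "\<dots> = 6 * C / \<delta> ^ 4 / real N" using N by (simp add: power_numeral_reduce field_simps)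
      finally show "(\<Sum>U\<in>Pow ?A. selection_prob ?A v U * \<bar>F (step_kernel N (\<lambda>X. of_bool (X \<in> U))) - F ?f\<bar>)
        \<le> r / 2 + 6 * C / \<delta> ^ 4 / real N" by simp
    qed
    then show ?thesis unfolding N_def v_def .
  qed
  have swap: "K / M < t" if "K / t < M" "0 < t" "0 < M" for K t M :: real
    using that by (simp add: pos_divide_less_eq mult.commute)
  obtain n0 where n0: "6 * C / \<delta> ^ 4 / (r / 2) < real n0" using reals_Archimedean2 by blast
  show "\<exists>n0. \<forall>n\<ge>n0. norm (?E n - F ?f) < r"
  proof (intro exI[of _ n0] allI impI)
    fix n assume "n \<ge> n0"
    have "n0 \<le> 1 * Suc n" using \<open>n \<ge> n0\<close> by simp
    also have "\<dots> \<le> p * Suc n" using p by (rule mult_le_mono1)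
    finally have "real n0 \<le> real (p * Suc n)" by (rule of_nat_mono)
    then have "6 * C / \<delta> ^ 4 / (r / 2) < real (p * Suc n)" using n0 by linarith
    then have "6 * C / \<delta> ^ 4 / real (p * Suc n) < r / 2"
      by (rule swap) (use r p in \<open>auto intro: add_pos_nonneg\<close>)
    then show "norm (?E n - F ?f) < r" using main[of n] by simp
  qed
qed

section \<open>The Taylor series on step graphons\<close>

text \<open>The index m counts edges before simplification, as in the Taylor series. The summands
  are homogeneous in w of degrees at most m, and \<open>coeff_nonsimple_zero\<close> regroups them
  by these degrees.\<close>

definition simplified_term :: "(multigraph set \<Rightarrow> real) \<Rightarrow> nat \<Rightarrow> nat \<Rightarrow> (nat set \<Rightarrow> real) \<Rightarrow> real" where
  "simplified_term a m p w = (\<Sum>H\<in>multigraph_classes m. a H * hom_avg (simplification (rep H)) p w)"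

lemma class_density_unit_square:
  assumes "H \<in> multigraph_classes m"
  shows "class_density H (indicator ({0..1} \<times> {0..1})) = 1"
proof -
  obtain V E where VE: "rep H = (V, E)" by (cases "rep H")
  have mg: "(V, E) \<in> multigraphs" using repD(1)[OF assms assms] VE by simp
  let ?M = "unit_interval"
  interpret M: prob_space ?M by (rule prob_space_unit_interval)
  interpret N: prob_space "\<Pi>\<^sub>M v\<in>V. ?M" by (rule prob_space_PiM) (rule M.prob_space_axioms)
  have one: "(\<Prod>e\<in>#E. indicator ({0..1} \<times> {0..1}) (x (Min e), x (Max e)) :: real) = 1"
    if "x \<in> space (\<Pi>\<^sub>M v\<in>V. ?M)" for x
  proof -
    have x: "x v \<in> {0..1}" if "v \<in> V" for v
      using \<open>x \<in> space _\<close> that by (auto simp: space_PiM space_restrict_space)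
    have "indicator ({0..1} \<times> {0..1}) (x (Min e), x (Max e)) = (1 :: real)" if "e \<in># E" for e
    proof -
      show ?thesis using x edge_endpoints(1,2)[OF mg that] by (simp add: indicator_def)
    qed
    then have "(\<Prod>e\<in>#E. indicator ({0..1} \<times> {0..1}) (x (Min e), x (Max e)) :: real) = (\<Prod>e\<in>#E. 1)"
      by (intro arg_cong[where f = prod_mset] image_mset_cong)
    then show ?thesis by simp
  qed
  have "class_density H (indicator ({0..1} \<times> {0..1}))
      = integral\<^sup>L (completion (\<Pi>\<^sub>M v\<in>V. ?M)) (\<lambda>x. 1)"
    unfolding class_density_def VE hom_density_def prod.case
    by (rule Bochner_Integration.integral_cong[OF refl]) (use one in simp)
  also have "\<dots> = 1" by (simp add: N.prob_space)
  finally show ?thesis .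
qed

lemma unit_square_in_graphons: "indicator ({0..1} \<times> {0..1}) \<in> graphons"
  unfolding graphons_def kernels_def
  by (auto simp: indicator_def intro!: boundedI[of _ 1] borel_measurable_indicator lebesgue_Times(1)
      split: if_splits)

text \<open>At the constant graphon 1 all densities are 1, so absolute convergence there is plain
  summability of the coefficients. The resulting majorant serves every application of
  \<open>tannerys_theorem\<close>.\<close>

lemma summable_abs_coeffs:
  assumes "\<And>f. f \<in> graphons \<Longrightarrow> abs_convergent_at a f"
  shows "summable (\<lambda>m. \<Sum>H\<in>multigraph_classes m. \<bar>a H\<bar>)"
proof -
  have "summable (\<lambda>m. \<Sum>H\<in>multigraph_classes m. \<bar>a H\<bar> * class_density H (indicator ({0..1} \<times> {0..1})))"
    using assms[OF unit_square_in_graphons] by (simp add: abs_convergent_at_def)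
  then show ?thesis by (simp add: class_density_unit_square cong: sum.cong)
qed

lemma class_density_step_kernel:
  assumes "H \<in> multigraph_classes m" "p \<ge> 1"
  shows "class_density H (step_kernel p w) = hom_avg (rep H) p w"
  unfolding class_density_def by (rule hom_density_step_kernel) (use repD[OF assms(1) assms(1)] assms(2) in auto)

lemma id_in_mp_maps: "id \<in> mp_maps"
proof -
  have "distr M M id = M" for M :: "real measure" by (simp add: id_def)
  then show ?thesis by (simp add: mp_maps_def)
qed

lemma taylor_term_step_kernel:
  assumes "taylor_coeffs F a" "p \<ge> 1" "w \<in> edge_weights"
  shows "taylor_term F m (step_kernel p w) = (\<Sum>H\<in>multigraph_classes m. a H * hom_avg (rep H) p w)"
proof -
  have "step_kernel p w \<in> all_step_graphons"
    using step_kernel_in_step_graphons[OF assms(2,3)] assms(2) by (auto simp: all_step_graphons_def)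
  moreover have "pullback (step_kernel p w) id = step_kernel p w" by (auto simp: pullback_def)
  ultimately have "step_kernel p w \<in> (\<Union>\<sigma>\<in>mp_maps. {pullback g \<sigma> | g. g \<in> all_step_graphons})"
    using id_in_mp_maps by (intro UN_I[of id]) (auto intro!: exI[of _ "step_kernel p w"])
  moreover have "\<forall>f \<in> (\<Union>\<sigma>\<in>mp_maps. {pullback g \<sigma> | g. g \<in> all_step_graphons}).
      (\<Sum>H\<in>multigraph_classes m. a H * class_density H f) = taylor_term F m f"
    using assms(1) unfolding taylor_coeffs_def by (rule spec)
  ultimately have "(\<Sum>H\<in>multigraph_classes m. a H * class_density H (step_kernel p w)) = taylor_term F m (step_kernel p w)"
    by (rule bspec[rotated])
  then show ?thesis by (simp add: class_density_step_kernel[OF _ assms(2)] cong: sum.cong)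
qed

lemma abs_simplified_term_le:
  assumes "p \<ge> 1" "w \<in> edge_weights"
  shows "\<bar>simplified_term a m p w\<bar> \<le> (\<Sum>H\<in>multigraph_classes m. \<bar>a H\<bar>)"
proof -
  have "\<bar>a H * hom_avg (simplification (rep H)) p w\<bar> \<le> \<bar>a H\<bar>" if H: "H \<in> multigraph_classes m" for H
  proof -
    have "simplification (rep H) \<in> multigraphs" using simplification_props(1) repD(1,2)[OF H H] by blast
    then have "\<bar>hom_avg (simplification (rep H)) p w\<bar> \<le> 1" using hom_avg_bounds[OF assms(2,1)] by simp
    then show ?thesis by (simp add: abs_mult mult_left_le)
  qed
  then show ?thesis
    unfolding simplified_term_def by (intro order.trans[OF sum_abs] sum_mono)
qed

lemma simplification_idem: "simplification (simplification H) = simplification H"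
  by (cases H) (simp add: simplification_def)

locale taylor_convergent =
  fixes F :: "kernel \<Rightarrow> real" and a :: "multigraph set \<Rightarrow> real"
  assumes smooth: "gateaux_smooth F" and continuous: "cut_continuous F"
    and zero_one: "\<And>f. f \<in> graphons \<Longrightarrow> (\<forall>z. f z \<in> {0, 1}) \<Longrightarrow> (\<lambda>n. taylor_poly F n f) \<longlonglongrightarrow> F f"
    and coeffs: "taylor_coeffs F a"
    and abs_convergent: "\<And>f. f \<in> graphons \<Longrightarrow> abs_convergent_at a f"
begin

definition coeff_bound :: "nat \<Rightarrow> real" where
  "coeff_bound m = (\<Sum>H\<in>multigraph_classes m. \<bar>a H\<bar>)"

lemma summable_coeff_bound: "summable coeff_bound"
  using summable_abs_coeffs[OF abs_convergent] by (simp add: coeff_bound_def[abs_def])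

lemma zero_one_step_sums:
  assumes "N \<ge> 1" "U \<subseteq> edge_sets N"
  shows "(\<lambda>m. simplified_term a m N (\<lambda>X. of_bool (X \<in> U))) sums F (step_kernel N (\<lambda>X. of_bool (X \<in> U)))"
proof -
  let ?u = "\<lambda>X. of_bool (X \<in> U) :: real"
  note u = edge_indicator_in_edge_weights[OF assms(2)]
  have "\<forall>z. step_kernel N ?u z \<in> {0, 1}" by (auto simp: step_kernel_def)
  then have "(\<lambda>n. taylor_poly F n (step_kernel N ?u)) \<longlonglongrightarrow> F (step_kernel N ?u)"
    by (intro zero_one step_kernel_in_graphons assms u)
  moreover have "taylor_term F m (step_kernel N ?u) = simplified_term a m N ?u" for m
    unfolding taylor_term_step_kernel[OF coeffs assms(1) u] simplified_term_def
    by (subst hom_avg_simplification) auto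
  ultimately show ?thesis by (simp add: sums_def_le taylor_poly_def)
qed

text \<open>On a fixed grid the expectation is a finite sum, so the series for F at the samples may
  be averaged term by term. As the grid is refined, the average of F tends to F at the given kernel,
  each averaged term tends to its simplified term, and \<open>coeff_bound\<close> admits the limit
  under the sum.\<close>

lemma step_kernel_sums:
  assumes p: "p \<ge> 1" and w: "w \<in> edge_weights"
  shows "(\<lambda>m. simplified_term a m p w) sums F (step_kernel p w)"
proof -
  define N where "N n = p * Suc n" for n
  define v where "v n = blowup (Suc n) w" for n
  define E where "E n h = (\<Sum>U\<in>Pow (edge_sets (N n)). selection_prob (edge_sets (N n)) (v n) U * h U)"
    for n and h :: "nat set set \<Rightarrow> real"
  define u where "u U = (\<lambda>X. of_bool (X \<in> U) :: real)" for U :: "nat set set"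
  have N: "N n \<ge> 1" for n using p by (simp add: N_def)
  have v: "v n \<in> edge_weights" for n unfolding v_def by (rule blowup_in_edge_weights[OF w])
  have v01: "0 \<le> v n X \<and> v n X \<le> 1" for n X using v[of n] by (auto simp: edge_weights_def)
  have "Suc n \<le> N n" for n using mult_le_mono1[OF p, of "Suc n"] by (simp add: N_def)
  then have inf: "filterlim N at_top sequentially"
    by (intro filterlim_at_top_mono[OF filterlim_Suc] always_eventually allI)
  have sums: "(\<lambda>m. simplified_term a m (N n) (u U)) sums F (step_kernel (N n) (u U))" if "U \<subseteq> edge_sets (N n)" for n U
    unfolding u_def by (rule zero_one_step_sums[OF N that])
  have term_le: "\<bar>simplified_term a m (N n) (u U)\<bar> \<le> coeff_bound m" if "U \<subseteq> edge_sets (N n)" for m n U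
    unfolding u_def coeff_bound_def by (rule abs_simplified_term_le[OF N edge_indicator_in_edge_weights[OF that]])
  \<comment> \<open>\<open>expected_value_approx\<close> asks for a bound on F at all samples; it is
    read off the series.\<close>
  have F_bounded: "\<bar>F (step_kernel M (\<lambda>X. of_bool (X \<in> U)))\<bar> \<le> suminf coeff_bound"
    if "M \<ge> 1" "U \<subseteq> edge_sets M" for M U
  proof -
    let ?t = "\<lambda>m. simplified_term a m M (\<lambda>X. of_bool (X \<in> U))"
    have le: "\<bar>?t m\<bar> \<le> coeff_bound m" for m
      unfolding coeff_bound_def by (rule abs_simplified_term_le[OF that(1) edge_indicator_in_edge_weights[OF that(2)]])
    have "F (step_kernel M (\<lambda>X. of_bool (X \<in> U))) = (\<Sum>m. ?t m)"
      using zero_one_step_sums[OF that] by (rule sums_unique)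
    then show ?thesis
      using norm_suminf_le[of ?t coeff_bound] le summable_coeff_bound by simp
  qed
  have limF: "(\<lambda>n. E n (\<lambda>U. F (step_kernel (N n) (u U)))) \<longlonglongrightarrow> F (step_kernel p w)"
    unfolding E_def N_def v_def u_def by (rule expected_value_approx[OF continuous p w F_bounded])
  have E_sums: "(\<lambda>m. E n (\<lambda>U. simplified_term a m (N n) (u U))) sums E n (\<lambda>U. F (step_kernel (N n) (u U)))" for n
    unfolding E_def by (intro sums_sum sums_mult sums) auto
  have lim_term: "(\<lambda>n. E n (\<lambda>U. simplified_term a m (N n) (u U))) \<longlonglongrightarrow> simplified_term a m p w" for m
  proof -
    have "E n (\<lambda>U. simplified_term a m (N n) (u U))
        = (\<Sum>H\<in>multigraph_classes m. a H * E n (\<lambda>U. hom_avg (simplification (rep H)) (N n) (u U)))" for n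
      unfolding E_def simplified_term_def sum_distrib_left
      by (subst sum.swap) (simp only: mult.left_commute)
    moreover have "(\<lambda>n. E n (\<lambda>U. hom_avg (simplification (rep H)) (N n) (u U)))
        \<longlonglongrightarrow> hom_avg (simplification (rep H)) p w" if H: "H \<in> multigraph_classes m" for H
    proof -
      let ?S = "simplification (rep H)"
      have S: "?S \<in> multigraphs" "no_isolated ?S"
        using simplification_props(1,2)[of "rep H"] repD(1,2)[OF H H] by blast+
      have close: "\<bar>E n (\<lambda>U. hom_avg ?S (N n) (u U)) - hom_avg ?S p w\<bar> \<le> (real (card (fst ?S)))\<^sup>2 / real (N n)" for n
      proof -
        \<comment> \<open>Both averages are the density of one and the same kernel, described on the
          coarse and on the refined grid.\<close>
        have "hom_avg ?S p w = hom_avg ?S (N n) (v n)"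
          using hom_density_step_kernel[OF S p, of w] hom_density_step_kernel[OF S N[of n], of "v n"]
            step_kernel_blowup[OF p _ w, of "Suc n"] by (simp add: N_def v_def)
        \<comment> \<open>The approximation lemma produces the simplification of its graph, and
          \<open>?S\<close> is its own simplification.\<close>
        then show ?thesis
          using expected_hom_avg_approx[OF S(1) v N, of n n]
          by (simp add: simplification_idem E_def u_def)
      qed
      have to0: "(\<lambda>n. (real (card (fst ?S)))\<^sup>2 / real (N n)) \<longlonglongrightarrow> 0"
        by (intro tendsto_divide_0[OF tendsto_const] filterlim_at_top_imp_at_infinity
            filterlim_compose[OF filterlim_real_sequentially inf])
      have "(\<lambda>n. E n (\<lambda>U. hom_avg ?S (N n) (u U)) - hom_avg ?S p w) \<longlonglongrightarrow> 0"
        by (rule Lim_null_comparison[OF always_eventually to0]) (simp add: close)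
      then show ?thesis by (rule LIM_zero_cancel)
    qed
    then have "(\<lambda>n. \<Sum>H\<in>multigraph_classes m. a H * E n (\<lambda>U. hom_avg (simplification (rep H)) (N n) (u U)))
        \<longlonglongrightarrow> (\<Sum>H\<in>multigraph_classes m. a H * hom_avg (simplification (rep H)) p w)"
      by (intro tendsto_sum tendsto_mult tendsto_const)
    ultimately show ?thesis by (simp only: simplified_term_def[of a m p w])
  qed
  have "\<bar>E n (\<lambda>U. simplified_term a m (N n) (u U))\<bar> \<le> coeff_bound m" for n m
  proof -
    have "\<bar>E n (\<lambda>U. simplified_term a m (N n) (u U)) - 0\<bar> \<le> coeff_bound m"
      unfolding E_def
    proof (rule selection_expectation_dist_le[OF finite_edge_sets v01])
      have "(\<Sum>U\<in>Pow (edge_sets (N n)). selection_prob (edge_sets (N n)) (v n) U * \<bar>simplified_term a m (N n) (u U) - 0\<bar>)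
        \<le> (\<Sum>U\<in>Pow (edge_sets (N n)). selection_prob (edge_sets (N n)) (v n) U * coeff_bound m)"
        by (rule selection_expectation_mono[OF v01]) (use term_le in simp)
      then show "(\<Sum>U\<in>Pow (edge_sets (N n)). selection_prob (edge_sets (N n)) (v n) U * \<bar>simplified_term a m (N n) (u U) - 0\<bar>)
        \<le> coeff_bound m"
        by (simp only: selection_expectation_const[OF finite_edge_sets])
    qed
    then show ?thesis by simp
  qed
  then have "eventually (\<lambda>(m, n). norm (E n (\<lambda>U. simplified_term a m (N n) (u U))) \<le> coeff_bound m) (at_top \<times>\<^sub>F sequentially)"
    by (intro always_eventually) auto
  note tannery = tannerys_theorem[OF lim_term this summable_coeff_bound sequentially_bot]
  have "(\<lambda>n. E n (\<lambda>U. F (step_kernel (N n) (u U)))) \<longlonglongrightarrow> (\<Sum>m. simplified_term a m p w)"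
    using conjunct2[OF conjunct2[OF tannery]] by (simp only: sums_unique[OF E_sums, symmetric])
  then have "F (step_kernel p w) = (\<Sum>m. simplified_term a m p w)"
    using limF by (rule LIMSEQ_unique[rotated])
  moreover have "summable (\<lambda>m. simplified_term a m p w)"
    by (rule summable_norm_cancel[OF conjunct1[OF conjunct2[OF tannery]]])
  ultimately show ?thesis by (simp add: sums_iff)
qed

end

section \<open>Power series and Gateaux derivatives along rays\<close>

lemma funpow_diffs:
  fixes c :: "nat \<Rightarrow> real"
  shows "(diffs ^^ n) c k = fact (n + k) / fact k * c (n + k)"
proof (induction n arbitrary: k)
  case (Suc n)
  have "(diffs ^^ Suc n) c k = real (Suc k) * (fact (n + Suc k) / fact (Suc k) * c (n + Suc k))"
    by (simp add: diffs_def Suc)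
  also have "\<dots> = fact (n + Suc k) / fact k * c (n + Suc k)"
    by (simp only: fact_Suc[of k]) (simp del: of_nat_Suc fact_Suc)
  finally show ?case by simp
qed simp

text \<open>A ray through a graphon stays among the graphons for s in [0, 1] only, so the series
  represents \<phi> on one side of 0. On the open interval all derivatives of \<phi> are the
  termwise ones; both are continuous at 0, hence they agree there as well.\<close>

lemma one_sided_power_series_derivs:
  fixes \<phi> :: "real \<Rightarrow> real" and \<beta> :: "nat \<Rightarrow> real"
  assumes sums: "\<And>s. 0 \<le> s \<Longrightarrow> s \<le> 1 \<Longrightarrow> (\<lambda>k. \<beta> k * s ^ k) sums \<phi> s"
    and cont: "\<And>n. continuous_on UNIV ((deriv ^^ n) \<phi>)"
  shows "(deriv ^^ n) \<phi> 0 = fact n * \<beta> n"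
proof -
  define \<psi> where "\<psi> n s = (\<Sum>k. (diffs ^^ n) \<beta> k * s ^ k)" for n and s :: real
  have summable: "summable (\<lambda>k. (diffs ^^ n) \<beta> k * s ^ k)" if "norm s < 1" for n and s :: real
    using that
  proof (induction n arbitrary: s)
    case 0
    \<comment> \<open>Convergence at the endpoint s = 1 gives a radius of convergence of at least 1,
      so the series itself is smooth on both sides of 0.\<close>
    have "summable (\<lambda>k. \<beta> k * 1 ^ k)" using sums[of 1] by (auto simp: sums_iff)
    then show ?case using powser_inside[of \<beta> 1 s] 0 by simp
  next
    case (Suc n)
    then show ?case using termdiff_converges[of s 1 "(diffs ^^ n) \<beta>"] by simp
  qed
  have der: "(\<psi> n has_field_derivative \<psi> (Suc n) s) (at s)" if "norm s < 1" for n and s :: real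
    unfolding \<psi>_def using termdiffs_strong'[OF summable that, of n] by simp
  have eq: "(deriv ^^ n) \<phi> s = \<psi> n s" if "s \<in> {0<..<1}" for n s
    using that
  proof (induction n arbitrary: s)
    case 0
    then show ?case using sums[of s] by (simp add: \<psi>_def sums_iff)
  next
    case (Suc n)
    have "(\<psi> n has_field_derivative \<psi> (Suc n) s) (at s)" using Suc.prems by (intro der) auto
    then have "((deriv ^^ n) \<phi> has_field_derivative \<psi> (Suc n) s) (at s)"
      by (rule has_field_derivative_transform_within_open[of _ _ _ "{0<..<1}"]) (use Suc in auto)
    then show ?case by (simp add: DERIV_imp_deriv)
  qed
  have "((deriv ^^ n) \<phi> \<longlongrightarrow> (deriv ^^ n) \<phi> 0) (at_right 0)"
    using cont[of n] by (meson UNIV_I continuous_on_def tendsto_within_subset subset_UNIV)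
  moreover have "eventually (\<lambda>s::real. s \<in> {0<..<1}) (at_right 0)"
    by (rule eventually_at_right_real) simp
  then have "eventually (\<lambda>s. (deriv ^^ n) \<phi> s = \<psi> n s) (at_right 0)"
    by eventually_elim (rule eq)
  ultimately have "(\<psi> n \<longlongrightarrow> (deriv ^^ n) \<phi> 0) (at_right 0)"
    by (rule Lim_transform_eventually)
  moreover have "isCont (\<psi> n) 0" by (rule DERIV_isCont[OF der]) simp
  then have "(\<psi> n \<longlongrightarrow> \<psi> n 0) (at_right 0)"
    by (simp add: isCont_def filterlim_at_split)
  ultimately have "(deriv ^^ n) \<phi> 0 = \<psi> n 0"
    by (intro tendsto_unique[of "at_right (0::real)"]) auto
  also have "\<psi> n 0 = fact n * \<beta> n" unfolding \<psi>_def powser_zero funpow_diffs by simp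
  finally show ?thesis .
qed

lemma iter_partial_first_coordinate:
  "iter_partial (replicate n 0) (\<lambda>l. \<phi> (l 0)) x = (deriv ^^ n) \<phi> (x 0)"
  by (induction n arbitrary: x) simp_all

lemma gateaux_smooth_along_ray:
  assumes "gateaux_smooth F" "f \<in> kernels"
  defines "\<phi> \<equiv> \<lambda>s. F (\<lambda>z. s * f z)"
  shows "continuous_on UNIV ((deriv ^^ n) \<phi>)" "(deriv ^^ n) \<phi> field_differentiable at s"
proof -
  have zero: "(\<lambda>_. 0) \<in> kernels" by (auto simp: kernels_def)
  have "smooth_on_coords 1 (\<lambda>l. F (\<lambda>z. 0 + (\<Sum>i<1. l i * f z)))"
    using assms(1)[unfolded gateaux_smooth_def, rule_format, OF zero, of 1 "\<lambda>_. f"] assms(2) by simp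
  then have sm: "smooth_on_coords 1 (\<lambda>l. \<phi> (l 0))" by (simp add: \<phi>_def)
  have "set (replicate n 0) \<subseteq> {..<1::nat}" by auto
  then have "continuous_on UNIV (iter_partial (replicate n 0) (\<lambda>l. \<phi> (l 0)))"
    and d: "\<And>x. (\<lambda>s. iter_partial (replicate n 0) (\<lambda>l. \<phi> (l 0)) (x(0 := s))) field_differentiable at (x 0)"
    using sm unfolding smooth_on_coords_def by auto
  then have c: "continuous_on UNIV (\<lambda>x::nat \<Rightarrow> real. (deriv ^^ n) \<phi> (x 0))"
    by (simp add: iter_partial_first_coordinate[abs_def])
  \<comment> \<open>Constant sequences embed the line into the space of sequences on which
    \<open>smooth_on_coords\<close> states continuity.\<close>
  have "continuous_on UNIV (\<lambda>s::real. (\<lambda>_::nat. s))"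
    by (intro continuous_on_coordinatewise_then_product continuous_intros)
  from continuous_on_compose2[OF c this] show "continuous_on UNIV ((deriv ^^ n) \<phi>)" by simp
  show "(deriv ^^ n) \<phi> field_differentiable at s"
    using d[of "\<lambda>_. s"] by (simp add: iter_partial_first_coordinate)
qed

text \<open>A step in direction f from a point of the ray stays on the ray, so the iterated
  difference quotients are those of a function of one variable. The claim is made for all s because
  order n + 1 uses order n at neighbouring points.\<close>

lemma gateaux_along_ray:
  assumes "gateaux_smooth F" "f \<in> kernels"
  shows "gateaux F n (\<lambda>_. f) (\<lambda>z. s * f z) = (deriv ^^ n) (\<lambda>s. F (\<lambda>z. s * f z)) s"
proof (induction n arbitrary: s)
  case (Suc n)
  let ?D = "(deriv ^^ n) (\<lambda>s. F (\<lambda>z. s * f z))"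
  have "(\<lambda>z. s * f z + l * f z) = (\<lambda>z. (s + l) * f z)" for l by (simp add: distrib_right)
  then have "gateaux F (Suc n) (\<lambda>_. f) (\<lambda>z. s * f z) = Lim (at 0) (\<lambda>l. (?D (s + l) - ?D s) / l)"
    by (simp add: Suc)
  \<comment> \<open>\<open>Lim\<close> is meaningful only where the limit exists; differentiability
    of \<open>?D\<close> provides it.\<close>
  also have "\<dots> = deriv ?D s"
    using gateaux_smooth_along_ray(2)[OF assms, of n s]
    by (intro tendsto_Lim) (simp_all add: DERIV_deriv_iff_field_differentiable[symmetric] DERIV_def)
  finally show ?case by simp
qed simp

lemma taylor_term_power_series:
  assumes "gateaux_smooth F" "f \<in> kernels"
    and "\<And>s. 0 \<le> s \<Longrightarrow> s \<le> 1 \<Longrightarrow> (\<lambda>k. \<beta> k * s ^ k) sums F (\<lambda>z. s * f z)"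
  shows "taylor_term F n f = \<beta> n"
proof -
  have "gateaux F n (\<lambda>_. f) (\<lambda>_. 0) = (deriv ^^ n) (\<lambda>s. F (\<lambda>z. s * f z)) 0"
    using gateaux_along_ray[OF assms(1,2), of n 0] by simp
  also have "\<dots> = fact n * \<beta> n"
    by (rule one_sided_power_series_derivs[OF assms(3) gateaux_smooth_along_ray(1)[OF assms(1,2)]])
  finally show ?thesis by (simp add: taylor_term_def)
qed

section \<open>Vanishing of the nonsimple coefficients\<close>

abbreviation simplified_class :: "multigraph set \<Rightarrow> multigraph set" where
  "simplified_class H \<equiv> graph_iso `` {simplification (rep H)}"

lemma simplified_class:
  assumes "H \<in> multigraph_classes m"
  shows "simplified_class H \<in> multigraph_classes (size (snd (simplification (rep H))))"
    "hom_avg (simplification (rep H)) p w = hom_avg (rep (simplified_class H)) p w"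
    "simple (rep (simplified_class H))"
    "size (snd (simplification (rep H))) \<le> m"
proof -
  note s = simplification_props[OF repD(1,2)[OF assms assms]]
  show c: "simplified_class H \<in> multigraph_classes (size (snd (simplification (rep H))))"
    by (rule graph_iso_class_in[OF s(1,2)])
  have iso: "(simplification (rep H), rep (simplified_class H)) \<in> graph_iso"
    using rep_in[OF c] by simp
  show "hom_avg (simplification (rep H)) p w = hom_avg (rep (simplified_class H)) p w"
    by (rule hom_avg_iso[OF iso])
  show "simple (rep (simplified_class H))" by (rule graph_iso_invariants(3)[OF iso s(3)])
  show "size (snd (simplification (rep H))) \<le> m"
    using s(4) repD(3)[OF assms assms] by simp
qed

context taylor_convergent
begin

text \<open>The work lies in a rearrangement: a series ordered by the number m of edges is reordered
  by the number k of edges left after simplification, and a single k may receive contributions from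
  infinitely many m.\<close>

lemma coeff_nonsimple_zero:
  assumes K: "K \<in> multigraph_classes k" and "\<not> simple (rep K)"
  shows "a K = 0"
proof -
  define e where "e H = size (snd (simplification (rep H)))" for H
  \<comment> \<open>The homogeneous part of degree k of the m-th simplified term.\<close>
  define c where "c p w m k = (\<Sum>H | H \<in> multigraph_classes m \<and> e H = k. a H * hom_avg (simplification (rep H)) p w)"
    for p w m k
  note fin = finite_multigraph_classes
  have e_le: "e H \<le> m" if "H \<in> multigraph_classes m" for H m
    unfolding e_def by (rule simplified_class(4)[OF that])
  have S: "simplification (rep H) \<in> multigraphs" if "H \<in> multigraph_classes m" for H m
    using simplification_props(1) repD(1,2)[OF that that] by blast
  have hom_le: "\<bar>a H * hom_avg (simplification (rep H)) p w\<bar> \<le> \<bar>a H\<bar>"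
    if "H \<in> multigraph_classes m" "p \<ge> 1" "w \<in> edge_weights" for H m p w
    using hom_avg_bounds[OF that(3,2) S[OF that(1)]] by (simp add: abs_mult mult_left_le)
  have c_zero: "c p w m k = 0" if "k > m" for p w m k
    unfolding c_def using e_le that by (intro sum.neutral) fastforce
  \<comment> \<open>The bound does not depend on J: \<open>e\<close> partitions the classes with m
    edges, so each coefficient is counted at most once. This makes truncation in k uniform.\<close>
  have sum_abs_c: "(\<Sum>k\<in>J. \<bar>c p w m k\<bar>) \<le> coeff_bound m"
    if "p \<ge> 1" "w \<in> edge_weights" "finite J" for p w m J
  proof -
    have "(\<Sum>k\<in>J. \<bar>c p w m k\<bar>) \<le> (\<Sum>k\<in>J. \<Sum>H | H \<in> multigraph_classes m \<and> e H = k. \<bar>a H\<bar>)"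
      unfolding c_def
      by (intro sum_mono order.trans[OF sum_abs] hom_le[OF _ that(1,2), of _ m]) auto
    also have "\<dots> \<le> (\<Sum>k\<in>J \<union> e ` multigraph_classes m. \<Sum>H | H \<in> multigraph_classes m \<and> e H = k. \<bar>a H\<bar>)"
      using that(3) fin by (intro sum_mono2) (auto intro: sum_nonneg)
    also have "\<dots> = coeff_bound m"
      unfolding coeff_bound_def using that(3) fin by (intro sum.group) auto
    finally show ?thesis .
  qed
  have abs_c: "\<bar>c p w m k\<bar> \<le> coeff_bound m" if "p \<ge> 1" "w \<in> edge_weights" for p w m k
    using sum_abs_c[OF that, of "{k}" m] by simp
  have c_summable: "summable (\<lambda>m. c p w m k)" if "p \<ge> 1" "w \<in> edge_weights" for p w k
    by (rule summable_comparison_test[OF _ summable_coeff_bound]) (use abs_c[OF that] in auto)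
  define \<beta> where "\<beta> p w k = (\<Sum>m. c p w m k)" for p w k
  have term_scale: "simplified_term a m p (\<lambda>X. s * w X) = (\<Sum>k\<le>M. c p w m k * s ^ k)" if "M \<ge> m" for m M p w s
  proof -
    have "(\<Sum>k\<le>M. c p w m k * s ^ k) =
        (\<Sum>k\<le>M. \<Sum>H | H \<in> multigraph_classes m \<and> e H = k. a H * hom_avg (simplification (rep H)) p (\<lambda>X. s * w X))"
      unfolding c_def sum_distrib_right
      by (intro sum.cong refl) (auto simp: hom_avg_scale e_def)
    also have "\<dots> = simplified_term a m p (\<lambda>X. s * w X)"
      unfolding simplified_term_def using e_le that fin
      by (intro sum.group) (auto intro: order.trans)
    finally show ?thesis ..
  qed
  have power_series: "(\<lambda>k. \<beta> p w k * s ^ k) sums F (\<lambda>z. s * step_kernel p w z)"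
    if pw: "p \<ge> 1" "w \<in> edge_weights" and s: "0 \<le> s" "s \<le> 1" for p w s
  proof -
    \<comment> \<open>\<open>g m M\<close> is the truncation at degree M and equals the m-th
      simplified term once M \<ge> m. Summed over m it is a partial sum of the power series in s;
      Tannery's theorem in M identifies the limit of these partial sums with F.\<close>
    define g where "g m M = (\<Sum>k\<le>M. c p w m k * s ^ k)" for m M
    have sw: "(\<lambda>X. s * w X) \<in> edge_weights"
      using pw(2) s by (auto simp: edge_weights_def loopless_def mult_le_one)
    have g_le: "\<bar>g m M\<bar> \<le> coeff_bound m" for m M
    proof -
      have "\<bar>c p w m k * s ^ k\<bar> \<le> \<bar>c p w m k\<bar>" for k
        using s by (simp add: abs_mult mult_left_le power_le_one)
      then have "\<bar>g m M\<bar> \<le> (\<Sum>k\<le>M. \<bar>c p w m k\<bar>)"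
        unfolding g_def by (intro order.trans[OF sum_abs] sum_mono)
      then show ?thesis using sum_abs_c[OF pw, of "{..M}" m] by simp
    qed
    have lim: "(\<lambda>M. g m M) \<longlonglongrightarrow> simplified_term a m p (\<lambda>X. s * w X)" for m
      by (rule tendsto_eventually, rule eventually_sequentiallyI[of m]) (simp add: g_def term_scale)
    have "eventually (\<lambda>(m, M). norm (g m M) \<le> coeff_bound m) (at_top \<times>\<^sub>F sequentially)"
      using g_le by (intro always_eventually) auto
    note tannery = tannerys_theorem[OF lim this summable_coeff_bound sequentially_bot]
    have "(\<Sum>m. g m M) = (\<Sum>k\<le>M. \<beta> p w k * s ^ k)" for M
    proof -
      have "(\<Sum>m. g m M) = (\<Sum>k\<le>M. \<Sum>m. c p w m k * s ^ k)"
        unfolding g_def using c_summable[OF pw] by (intro suminf_sum summable_mult2)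
      also have "\<dots> = (\<Sum>k\<le>M. \<beta> p w k * s ^ k)"
        unfolding \<beta>_def using c_summable[OF pw] by (simp add: suminf_mult2)
      finally show ?thesis .
    qed
    moreover have "(\<Sum>m. simplified_term a m p (\<lambda>X. s * w X)) = F (\<lambda>z. s * step_kernel p w z)"
      using step_kernel_sums[OF pw(1) sw] by (simp add: sums_iff step_kernel_scale)
    ultimately show ?thesis using tannery by (simp add: sums_def_le)
  qed
  \<comment> \<open>The total coefficient with which multigraphs of m edges reach the density of K
    after simplification. Summed over m it is the coefficient of K in the regrouped series.\<close>
  define b where "b K m = (\<Sum>H | H \<in> multigraph_classes m \<and> simplified_class H = K. a H)" for K m
  have b_summable: "summable (b K)" for K
  proof (rule summable_comparison_test[OF _ summable_coeff_bound], intro exI allI impI)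
    fix m
    have "\<bar>b K m\<bar> \<le> (\<Sum>H | H \<in> multigraph_classes m \<and> simplified_class H = K. \<bar>a H\<bar>)"
      unfolding b_def by (rule sum_abs)
    also have "\<dots> \<le> coeff_bound m"
      unfolding coeff_bound_def using fin by (intro sum_mono2) auto
    finally show "norm (b K m) \<le> coeff_bound m" by simp
  qed
  have "a K - (\<Sum>m. b K m) = 0"
  proof (rule hom_avg_independent[OF _ K, of "\<lambda>K. a K - (\<Sum>m. b K m)"])
    fix p w assume pw: "p \<ge> (1::nat)" "w \<in> edge_weights"
    have "c p w m k = (\<Sum>L\<in>multigraph_classes k. b L m * hom_avg (rep L) p w)" for m
    proof -
      \<comment> \<open>Sets of classes with different numbers of edges are disjoint, so the degree
        after simplification can be read off the simplified class.\<close>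
      have e_iff: "e H = k \<longleftrightarrow> simplified_class H \<in> multigraph_classes k" if "H \<in> multigraph_classes m" for H
        using simplified_class(1)[OF that] multigraph_classes_disjoint unfolding e_def by blast
      have "(\<Sum>L\<in>multigraph_classes k. b L m * hom_avg (rep L) p w)
          = (\<Sum>L\<in>multigraph_classes k. \<Sum>H\<in>{H \<in> {H. H \<in> multigraph_classes m \<and> e H = k}. simplified_class H = L}.
              a H * hom_avg (simplification (rep H)) p w)"
      proof (rule sum.cong[OF refl])
        fix L assume L: "L \<in> multigraph_classes k"
        have "{H. H \<in> multigraph_classes m \<and> simplified_class H = L}
            = {H \<in> {H. H \<in> multigraph_classes m \<and> e H = k}. simplified_class H = L}"
          using L e_iff by blast
        then show "b L m * hom_avg (rep L) p w =
            (\<Sum>H\<in>{H \<in> {H. H \<in> multigraph_classes m \<and> e H = k}. simplified_class H = L}.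
              a H * hom_avg (simplification (rep H)) p w)"
          unfolding b_def sum_distrib_right
          by (intro sum.cong) (auto simp: simplified_class(2))
      qed
      also have "\<dots> = c p w m k"
        unfolding c_def using fin e_iff by (intro sum.group) auto
      finally show ?thesis ..
    qed
    then have "\<beta> p w k = (\<Sum>m. \<Sum>L\<in>multigraph_classes k. b L m * hom_avg (rep L) p w)"
      by (simp add: \<beta>_def)
    also have "\<dots> = (\<Sum>L\<in>multigraph_classes k. \<Sum>m. b L m * hom_avg (rep L) p w)"
      using b_summable by (intro suminf_sum summable_mult2)
    also have "\<dots> = (\<Sum>L\<in>multigraph_classes k. (\<Sum>m. b L m) * hom_avg (rep L) p w)"
      using b_summable by (simp add: suminf_mult2)
    finally have 1: "\<beta> p w k = (\<Sum>L\<in>multigraph_classes k. (\<Sum>m. b L m) * hom_avg (rep L) p w)" .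
    have "step_kernel p w \<in> kernels" using step_kernel_in_graphons[OF pw] by (simp add: graphons_def)
    then have "taylor_term F k (step_kernel p w) = \<beta> p w k"
      by (rule taylor_term_power_series[OF smooth _ power_series[OF pw]])
    then have "(\<Sum>L\<in>multigraph_classes k. a L * hom_avg (rep L) p w) = \<beta> p w k"
      by (simp add: taylor_term_step_kernel[OF coeffs pw])
    then show "(\<Sum>L\<in>multigraph_classes k. (a L - (\<Sum>m. b L m)) * hom_avg (rep L) p w) = 0"
      using 1 by (simp add: left_diff_distrib sum_subtractf)
  qed
  \<comment> \<open>Simplification only produces simple classes, so for the nonsimple K the sum is
    empty.\<close>
  moreover have "b K m = 0" for m
    unfolding b_def using simplified_class(3) assms(2) by (intro sum.neutral) blast
  ultimately show ?thesis by simp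
qed

text \<open>Once the nonsimple coefficients vanish, passing to simplifications changes no term, so
  the simplified series is the Taylor series itself.\<close>

lemma step_kernel_density_sums:
  assumes "p \<ge> 1" "w \<in> edge_weights"
  shows "(\<lambda>m. \<Sum>H\<in>multigraph_classes m. a H * class_density H (step_kernel p w)) sums F (step_kernel p w)"
proof -
  have "a H * class_density H (step_kernel p w) = a H * hom_avg (simplification (rep H)) p w"
    if H: "H \<in> multigraph_classes m" for H m
  proof (cases "simple (rep H)")
    case True
    obtain V E where VE: "rep H = (V, E)" by (cases "rep H")
    have "mset_set (set_mset E) = E"
    proof (rule multiset_eqI)
      fix e show "count (mset_set (set_mset E)) e = count E e"
        using True by (auto simp: VE simple_def count_mset_set' count_eq_zero_iff le_Suc_eq dest: spec[of _ e])
    qed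
    then have "simplification (rep H) = rep H" by (simp add: VE simplification_def)
    then show ?thesis by (simp add: class_density_step_kernel[OF H assms(1)])
  qed (simp add: coeff_nonsimple_zero[OF H])
  then have "(\<Sum>H\<in>multigraph_classes m. a H * class_density H (step_kernel p w)) = simplified_term a m p w" for m
    unfolding simplified_term_def by (intro sum.cong refl)
  then show ?thesis using step_kernel_sums[OF assms] by (simp only:)
qed

end

section \<open>Approximation of graphons by step graphons\<close>

text \<open>The preimage of a rectangle is a box whose other sides are the whole space. The indices
  must differ: with a = b the pair would live on the diagonal.\<close>

lemma coordinate_pair_distr:
  assumes V: "finite V" "a \<in> V" "b \<in> V" "a \<noteq> b" and M: "prob_space M"
  shows "distr (\<Pi>\<^sub>M v\<in>V. M) (M \<Otimes>\<^sub>M M) (\<lambda>x. (x a, x b)) = M \<Otimes>\<^sub>M M"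
proof (rule pair_measure_eqI[symmetric])
  interpret M: prob_space M by (rule M)
  interpret product_sigma_finite "\<lambda>_. M" ..
  show "sigma_finite_measure M" "sigma_finite_measure M" by unfold_locales
  fix A B assume AB: "A \<in> sets M" "B \<in> sets M"
  let ?C = "\<lambda>v. if v = a then A else if v = b then B else space M"
  have meas: "(\<lambda>x. (x a, x b)) \<in> (\<Pi>\<^sub>M v\<in>V. M) \<rightarrow>\<^sub>M M \<Otimes>\<^sub>M M"
    using V by (intro measurable_Pair measurable_component_singleton)
  have "A \<subseteq> space M" "B \<subseteq> space M" using AB[THEN sets.sets_into_space] .
  then have "(\<lambda>x. (x a, x b)) -` (A \<times> B) \<inter> space (\<Pi>\<^sub>M v\<in>V. M) = (\<Pi>\<^sub>E v\<in>V. ?C v)"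
    using V by (auto simp: space_PiM PiE_iff split: if_splits) (metis subsetD)
  then have "emeasure (distr (\<Pi>\<^sub>M v\<in>V. M) (M \<Otimes>\<^sub>M M) (\<lambda>x. (x a, x b))) (A \<times> B)
      = emeasure (\<Pi>\<^sub>M v\<in>V. M) (\<Pi>\<^sub>E v\<in>V. ?C v)"
    using AB by (subst emeasure_distr[OF meas]) auto
  also have "\<dots> = (\<Prod>v\<in>V. emeasure M (?C v))"
    using V(1) AB by (intro emeasure_PiM) auto
  also have "\<dots> = (\<Prod>v\<in>{a, b}. emeasure M (?C v))"
    using V by (intro prod.mono_neutral_right) (auto simp: M.emeasure_space_1)
  also have "\<dots> = emeasure M A * emeasure M B" using V(4) by simp
  finally show "emeasure M A * emeasure M B = emeasure (distr (\<Pi>\<^sub>M v\<in>V. M) (M \<Otimes>\<^sub>M M) (\<lambda>x. (x a, x b))) (A \<times> B)"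
    by simp
qed simp

text \<open>Kernels are only Lebesgue measurable, so composing one with a pair of coordinates
  requires preimages of null sets to be null, beyond Borel measurability of the coordinates.
  \<open>measurable_completion2\<close> combines the two facts.\<close>

lemma coordinate_pair_null_sets:
  assumes V: "finite V" "a \<in> V" "b \<in> V" "a \<noteq> b"
  defines "P \<equiv> \<Pi>\<^sub>M v\<in>V. unit_interval"
  shows "(\<lambda>x. (x a, x b)) \<in> completion P \<rightarrow>\<^sub>M lborel"
    "null_sets lborel \<subseteq> null_sets (distr (completion P) lborel (\<lambda>x. (x a, x b)))"
proof -
  let ?I = "unit_interval"
  interpret I: prob_space ?I by (rule prob_space_unit_interval)
  interpret II: pair_sigma_finite ?I ?I ..
  have measI: "(\<lambda>x. (x a, x b)) \<in> P \<rightarrow>\<^sub>M ?I \<Otimes>\<^sub>M ?I"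
    unfolding P_def using V by (intro measurable_Pair measurable_component_singleton)
  have idm: "(\<lambda>z. z) \<in> ?I \<Otimes>\<^sub>M ?I \<rightarrow>\<^sub>M lborel \<Otimes>\<^sub>M lborel"
  proof -
    have "(\<lambda>x. x) \<in> ?I \<rightarrow>\<^sub>M lborel" by (rule measurable_restrict_space1) simp
    then have "(\<lambda>z. (fst z, snd z)) \<in> ?I \<Otimes>\<^sub>M ?I \<rightarrow>\<^sub>M lborel \<Otimes>\<^sub>M lborel"
      by (intro measurable_Pair measurable_compose[OF measurable_fst] measurable_compose[OF measurable_snd])
    then show ?thesis by simp
  qed
  have "(\<lambda>x. (x a, x b)) \<in> P \<rightarrow>\<^sub>M lborel \<Otimes>\<^sub>M lborel"
    using measurable_compose[OF measI idm] by simp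
  then show meas: "(\<lambda>x. (x a, x b)) \<in> completion P \<rightarrow>\<^sub>M lborel"
    unfolding lborel_prod by (rule measurable_completion)
  show "null_sets lborel \<subseteq> null_sets (distr (completion P) lborel (\<lambda>x. (x a, x b)))"
  proof
    fix Z :: "(real \<times> real) set" assume Z: "Z \<in> null_sets lborel"
    have "AE z in lborel \<Otimes>\<^sub>M lborel. z \<notin> Z"
      using AE_not_in[OF Z] unfolding lborel_prod .
    \<comment> \<open>Slicing permits restriction to the unit interval one variable at a time;
      \<open>AE_pair_measure\<close> reassembles the slices.\<close>
    then have "AE x in lborel. AE y in lborel. (x, y) \<notin> Z"
      by (rule lborel_pair.AE_pair)
    then have AE2: "AE x in ?I. AE y in ?I. (x, y) \<notin> Z"
      by (auto simp: AE_restrict_space_iff elim!: eventually_mono)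
    have Zs: "Z \<in> sets (lborel \<Otimes>\<^sub>M lborel)" using Z unfolding lborel_prod by auto
    have "{z \<in> space (?I \<Otimes>\<^sub>M ?I). z \<notin> Z} \<in> sets (?I \<Otimes>\<^sub>M ?I)"
    proof -
      have "(\<lambda>z. z) -` (space (lborel \<Otimes>\<^sub>M lborel) - Z) \<inter> space (?I \<Otimes>\<^sub>M ?I) \<in> sets (?I \<Otimes>\<^sub>M ?I)"
        by (rule measurable_sets[OF idm sets.compl_sets[OF Zs]])
      moreover have "(\<lambda>z. z) -` (space (lborel \<Otimes>\<^sub>M lborel) - Z) \<inter> space (?I \<Otimes>\<^sub>M ?I) = {z \<in> space (?I \<Otimes>\<^sub>M ?I). z \<notin> Z}"
        by (auto simp: space_pair_measure)
      ultimately show ?thesis by simp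
    qed
    then have "AE z in ?I \<Otimes>\<^sub>M ?I. z \<notin> Z" using AE2 by (rule II.AE_pair_measure)
    then have "AE z in distr P (?I \<Otimes>\<^sub>M ?I) (\<lambda>x. (x a, x b)). z \<notin> Z"
      unfolding P_def coordinate_pair_distr[OF V prob_space_unit_interval] .
    then have "AE x in P. (x a, x b) \<notin> Z" by (rule AE_distrD[OF measI])
    then have ae: "AE x in completion P. (x a, x b) \<notin> Z" by (rule AE_completion)
    have vs: "(\<lambda>x. (x a, x b)) -` Z \<inter> space (completion P) \<in> sets (completion P)"
      by (rule measurable_sets[OF meas]) (use Z in auto)
    have "emeasure (completion P) ((\<lambda>x. (x a, x b)) -` Z \<inter> space (completion P)) = 0"
      using AE_iff_measurable[OF vs, of "\<lambda>x. (x a, x b) \<notin> Z"] ae by auto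
    then have "emeasure (distr (completion P) lborel (\<lambda>x. (x a, x b))) Z = 0"
      using Z by (subst emeasure_distr[OF meas]) auto
    then show "Z \<in> null_sets (distr (completion P) lborel (\<lambda>x. (x a, x b)))"
      using Z by (auto simp: null_sets_def)
  qed
qed

lemma coordinate_pair_measurable:
  assumes V: "finite V" "a \<in> V" "b \<in> V" "a \<noteq> b" and f: "f \<in> borel_measurable lebesgue"
  shows "(\<lambda>x. f (x a, x b)) \<in> borel_measurable (completion (\<Pi>\<^sub>M v\<in>V. unit_interval))"
  using completion.measurable_completion2[OF coordinate_pair_null_sets[OF V]] f
  by (rule measurable_compose)

lemma coordinate_pair_AE:
  assumes V: "finite V" "a \<in> V" "b \<in> V" "a \<noteq> b" and N: "negligible N"
  shows "AE x in completion (\<Pi>\<^sub>M v\<in>V. unit_interval). (x a, x b) \<notin> N"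
proof -
  let ?P = "completion (\<Pi>\<^sub>M v\<in>V. unit_interval)"
  have "AE z in lborel. z \<notin> N"
  proof -
    have "N \<in> null_sets lebesgue" using N by (simp add: negligible_iff_null_sets)
    then have "AE z in lebesgue. z \<notin> N" by (rule AE_not_in)
    then show ?thesis by (simp add: AE_completion_iff)
  qed
  then obtain Z where Z: "Z \<in> null_sets lborel" "{z \<in> space lborel. \<not> z \<notin> N} \<subseteq> Z"
    by (auto simp: eventually_ae_filter)
  then have "Z \<in> null_sets (distr ?P lborel (\<lambda>x. (x a, x b)))"
    using coordinate_pair_null_sets(2)[OF V] by blast
  then have "AE z in distr ?P lborel (\<lambda>x. (x a, x b)). z \<notin> Z" by (rule AE_not_in)
  then have "AE x in ?P. (x a, x b) \<notin> Z" by (rule AE_distrD[OF coordinate_pair_null_sets(1)[OF V]])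
  then show ?thesis using Z(2) by (auto elim!: eventually_mono)
qed

lemma borel_measurable_prod_mset:
  fixes f :: "'i \<Rightarrow> 'a \<Rightarrow> real"
  shows "(\<And>i. i \<in># I \<Longrightarrow> f i \<in> borel_measurable M) \<Longrightarrow> (\<lambda>x. \<Prod>i\<in>#I. f i x) \<in> borel_measurable M"
  by (induction I) auto

lemma tendsto_prod_mset:
  fixes f :: "'i \<Rightarrow> 'a \<Rightarrow> real"
  shows "(\<And>i. i \<in># I \<Longrightarrow> (f i \<longlongrightarrow> l i) F) \<Longrightarrow> ((\<lambda>x. \<Prod>i\<in>#I. f i x) \<longlongrightarrow> (\<Prod>i\<in>#I. l i)) F"
  by (induction I) (auto intro: tendsto_mult)

lemma graphon_bounds: "f \<in> graphons \<Longrightarrow> 0 \<le> f z \<and> f z \<le> 1"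
  by (cases z) (simp add: graphons_def)

lemma graphon_borel: "f \<in> graphons \<Longrightarrow> f \<in> borel_measurable lebesgue"
  by (auto simp: graphons_def kernels_def)

lemma hom_density_integrand:
  assumes H: "(V, E) \<in> multigraphs" and f: "f \<in> graphons"
  shows "(\<lambda>x. \<Prod>e\<in>#E. f (x (Min e), x (Max e))) \<in> borel_measurable (completion (\<Pi>\<^sub>M v\<in>V. unit_interval))"
    "norm (\<Prod>e\<in>#E. f (x (Min e), x (Max e))) \<le> 1"
proof -
  show "(\<lambda>x. \<Prod>e\<in>#E. f (x (Min e), x (Max e))) \<in> borel_measurable (completion (\<Pi>\<^sub>M v\<in>V. unit_interval))"
    by (intro borel_measurable_prod_mset coordinate_pair_measurable multigraphsD(1)[OF H]
        edge_endpoints[OF H] graphon_borel[OF f])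
  show "norm (\<Prod>e\<in>#E. f (x (Min e), x (Max e))) \<le> 1"
    using prod_mset_nonneg_le1[of E "\<lambda>e. f (x (Min e), x (Max e))"] graphon_bounds[OF f] by simp
qed

lemma prob_space_completion_PiM_unit_interval:
  "prob_space (completion (\<Pi>\<^sub>M v\<in>V. unit_interval))"
proof -
  interpret N: prob_space "\<Pi>\<^sub>M v\<in>V. unit_interval"
    by (rule prob_space_PiM) (rule prob_space_unit_interval)
  show ?thesis by (rule prob_spaceI) (simp add: N.emeasure_space_1)
qed

lemma hom_density_abs_le_1:
  assumes H: "H \<in> multigraphs" and f: "f \<in> graphons"
  shows "\<bar>hom_density H f\<bar> \<le> 1"
proof -
  obtain V E where VE: "H = (V, E)" by (cases H)
  interpret P: prob_space "completion (\<Pi>\<^sub>M v\<in>V. unit_interval)"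
    by (rule prob_space_completion_PiM_unit_interval)
  note i = hom_density_integrand[OF H[unfolded VE] f]
  have "integrable (completion (\<Pi>\<^sub>M v\<in>V. unit_interval)) (\<lambda>x. \<Prod>e\<in>#E. f (x (Min e), x (Max e)))"
    by (rule P.integrable_const_bound[of _ 1]) (use i in auto)
  then have "norm (hom_density H f) \<le> (\<integral>x. 1 \<partial>completion (\<Pi>\<^sub>M v\<in>V. unit_interval))"
    unfolding VE hom_density_def prod.case
    by (intro order.trans[OF integral_norm_bound] integral_mono integrable_norm i(2)) auto
  also have "\<dots> = 1" using P.prob_space by (simp del: measure_completion space_completion)
  finally show ?thesis by simp
qed

text \<open>The null set of the plane is pulled back along each of the finitely many edges.
  Elsewhere the integrands converge, and they are bounded by 1, so dominated convergence
  applies.\<close>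

lemma hom_density_tendsto:
  assumes H: "H \<in> multigraphs" and f: "f \<in> graphons" and s: "\<And>n. s n \<in> graphons"
    and N: "negligible N" and lim: "\<And>z. z \<notin> N \<Longrightarrow> (\<lambda>n. s n z) \<longlonglongrightarrow> f z"
  shows "(\<lambda>n. hom_density H (s n)) \<longlonglongrightarrow> hom_density H f"
proof -
  obtain V E where VE: "H = (V, E)" by (cases H)
  note mg = H[unfolded VE]
  interpret P: prob_space "completion (\<Pi>\<^sub>M v\<in>V. unit_interval)"
    by (rule prob_space_completion_PiM_unit_interval)
  show ?thesis
    unfolding VE hom_density_def prod.case
  proof (rule integral_dominated_convergence[where w = "\<lambda>_. 1"])
    have "AE x in completion (\<Pi>\<^sub>M v\<in>V. unit_interval). \<forall>e\<in>set_mset E. (x (Min e), x (Max e)) \<notin> N"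
      by (intro AE_finite_allI coordinate_pair_AE multigraphsD(1)[OF mg] edge_endpoints[OF mg] N) auto
    then show "AE x in completion (\<Pi>\<^sub>M v\<in>V. unit_interval).
        (\<lambda>n. \<Prod>e\<in>#E. s n (x (Min e), x (Max e))) \<longlonglongrightarrow> (\<Prod>e\<in>#E. f (x (Min e), x (Max e)))"
      by eventually_elim (intro tendsto_prod_mset lim, blast)
    show "AE x in completion (\<Pi>\<^sub>M v\<in>V. unit_interval). norm (\<Prod>e\<in>#E. s n (x (Min e), x (Max e))) \<le> 1" for n
      using hom_density_integrand(2)[OF mg s] by simp
  qed (use hom_density_integrand(1)[OF mg f] hom_density_integrand(1)[OF mg s] in auto)
qed

text \<open>The cut norm is at most the L1 norm. Since graphons vanish off the unit square, its
  indicator is an integrable majorant on the plane for dominated convergence.\<close>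

lemma cut_norm_tendsto_0:
  assumes f: "f \<in> graphons" and s: "\<And>n. s n \<in> graphons"
    and N: "negligible N" and lim: "\<And>z. z \<notin> N \<Longrightarrow> (\<lambda>n. s n z) \<longlonglongrightarrow> f z"
  obtains b where "b \<longlonglongrightarrow> 0" "\<And>n. cut_norm (\<lambda>z. s n z - f z) \<le> b n"
proof
  define b where "b n = (\<integral>z. norm (s n z - f z) \<partial>lebesgue)" for n
  let ?Q = "indicator ({0..1} \<times> {0..1}) :: real \<times> real \<Rightarrow> real"
  have Q: "integrable lebesgue ?Q"
  proof -
    have "{0..1::real} \<times> {0..1::real} \<in> lmeasurable"
      by (intro bounded_set_imp_lmeasurable bounded_Times lebesgue_Times) auto
    then show ?thesis by (intro integrable_real_indicator) (auto simp: fmeasurable_def)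
  qed
  have zero: "g z = 0" if "g \<in> graphons" "z \<notin> {0..1} \<times> {0..1}" for g z
    using that by (cases z) (auto simp: graphons_def kernels_def)
  have meas: "(\<lambda>z. s n z - f z) \<in> borel_measurable lebesgue" for n
    using graphon_borel[OF f] graphon_borel[OF s] by (intro borel_measurable_diff)
  have le: "norm (s n z - f z) \<le> ?Q z" for n z
    using graphon_bounds[OF f, of z] graphon_bounds[OF s, of n z] zero[OF f, of z] zero[OF s, of z n]
    by (auto simp: indicator_def abs_le_iff)
  have int: "integrable lebesgue (\<lambda>z. s n z - f z)" for n
    by (rule Bochner_Integration.integrable_bound[OF Q meas]) (use le in \<open>auto simp: abs_le_iff\<close>)
  have "(\<lambda>n. b n) \<longlonglongrightarrow> (\<integral>z. norm (0::real) \<partial>(lebesgue :: (real \<times> real) measure))"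
    unfolding b_def
  proof (rule integral_dominated_convergence[where w = ?Q])
    have "AE z in lebesgue. z \<notin> N" using N by (intro AE_not_in) (simp add: negligible_iff_null_sets)
    then show "AE z in lebesgue. (\<lambda>n. norm (s n z - f z)) \<longlonglongrightarrow> norm (0::real)"
      by eventually_elim (intro tendsto_norm, rule LIM_zero[OF lim])
    show "AE z in lebesgue. norm (norm (s n z - f z)) \<le> ?Q z" for n using le by simp
  qed (use Q meas in auto)
  then show "b \<longlonglongrightarrow> 0" by simp
  show "cut_norm (\<lambda>z. s n z - f z) \<le> b n" for n
  proof (rule cut_norm_leI)
    fix S T :: "real set" assume ST: "S \<in> sets lebesgue" "T \<in> sets lebesgue"
    have "integrable lebesgue (\<lambda>z. indicator (S \<times> T) z *\<^sub>R (s n z - f z))"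
      by (rule integrable_mult_indicator[OF lebesgue_Times(1)[OF ST] int])
    then have "norm (LINT z : S \<times> T | lebesgue. s n z - f z) \<le> (\<integral>z. norm (s n z - f z) \<partial>lebesgue)"
      unfolding set_lebesgue_integral_def
      by (intro order.trans[OF integral_norm_bound] integral_mono integrable_norm int) (auto simp: indicator_def)
    then show "\<bar>LINT z : S \<times> T | lebesgue. s n z - f z\<bar> \<le> b n" by (simp add: b_def)
  qed
qed

section \<open>Almost everywhere approximation by step kernels\<close>

text \<open>Lebesgue measurability yields continuous functions that converge off a negligible set.
  Averaging them with their reflections and clamping to [0, 1] preserves continuity, and the limit
  is unchanged because f is itself symmetric with values in [0, 1]. The exceptional set grows by its
  mirror image.\<close>

lemma symmetric_continuous_approx:
  assumes f: "f \<in> graphons"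
  obtains h :: "nat \<Rightarrow> kernel" and N where "negligible N" "\<And>n. continuous_on UNIV (h n)"
    "\<And>n x y. h n (x, y) = h n (y, x)" "\<And>n z. 0 \<le> h n z \<and> h n z \<le> 1"
    "\<And>z. z \<notin> N \<Longrightarrow> (\<lambda>n. h n z) \<longlonglongrightarrow> f z"
proof -
  have "f measurable_on UNIV"
    by (rule lebesgue_measurable_imp_measurable_on_real[OF graphon_borel[OF f]]) simp
  then obtain N g where N: "negligible N" and g: "\<And>n. continuous_on UNIV (g n :: kernel)"
    and lim: "\<And>z. z \<notin> N \<Longrightarrow> (\<lambda>n. g n z) \<longlonglongrightarrow> f z"
    by (auto simp: measurable_on_def)
  let ?sw = "\<lambda>z :: real \<times> real. (snd z, fst z)"
  define h where "h n z = max 0 (min 1 ((g n z + g n (?sw z)) / 2))" for n z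
  \<comment> \<open>Differentiability of the reflection makes the mirror image of N
    negligible.\<close>
  have "?sw differentiable_on N"
    unfolding differentiable_on_def differentiable_def
    by (intro ballI exI) (rule derivative_intros has_derivative_ident)+
  then have neg: "negligible (N \<union> ?sw ` N)"
    using N by (intro negligible_Un negligible_differentiable_image_negligible) auto
  show thesis
  proof (rule that[OF neg, of h])
    have "continuous_on UNIV (\<lambda>z. g n (?sw z))" for n
      by (rule continuous_on_compose2[OF g]) (auto intro!: continuous_intros)
    then show "continuous_on UNIV (h n)" for n
      unfolding h_def using g by (intro continuous_intros) auto
    show "h n (x, y) = h n (y, x)" for n x y by (simp add: h_def add.commute)
    show "0 \<le> h n z \<and> h n z \<le> 1" for n z by (simp add: h_def)
    fix z assume z: "z \<notin> N \<union> ?sw ` N"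
    have "?sw z \<notin> N"
    proof
      assume "?sw z \<in> N"
      then have "?sw (?sw z) \<in> ?sw ` N" by (rule imageI)
      then show False using z by simp
    qed
    have "f (?sw z) = f z" using f by (cases z) (auto simp: graphons_def kernels_def)
    then have "(\<lambda>n. g n (?sw z)) \<longlonglongrightarrow> f z" using lim[OF \<open>?sw z \<notin> N\<close>] by simp
    then have "(\<lambda>n. h n z) \<longlonglongrightarrow> max 0 (min 1 ((f z + f z) / 2))"
      unfolding h_def using lim[of z] z by (intro tendsto_intros) auto
    then show "(\<lambda>n. h n z) \<longlonglongrightarrow> f z" using graphon_bounds[OF f, of z] by simp
  qed
qed

text \<open>Sample h at the upper right corners of the cells and use uniform continuity on the
  square. Diagonal cells are excluded because step kernels with loopless weights vanish
  there.\<close>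

lemma step_kernel_near_continuous:
  fixes h :: kernel
  assumes cont: "continuous_on UNIV h" and sym: "\<And>x y. h (x, y) = h (y, x)"
    and h01: "\<And>z. 0 \<le> h z \<and> h z \<le> 1" and \<epsilon>: "\<epsilon> > 0"
  obtains p w where "p \<ge> Suc n" "w \<in> edge_weights"
    "\<And>x y. x \<in> {0<..1} \<Longrightarrow> y \<in> {0<..1} \<Longrightarrow> cell p x \<noteq> cell p y \<Longrightarrow> \<bar>step_kernel p w (x, y) - h (x, y)\<bar> < \<epsilon>"
proof -
  have "uniformly_continuous_on ({0..1} \<times> {0..1}) h"
    by (intro compact_uniformly_continuous continuous_on_subset[OF cont] compact_Times) auto
  then obtain d where d: "d > 0"
    and close: "\<And>z z'. z \<in> {0..1} \<times> {0..1} \<Longrightarrow> z' \<in> {0..1} \<times> {0..1} \<Longrightarrow> dist z' z < d \<Longrightarrow> dist (h z') (h z) < \<epsilon>"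
    using \<epsilon> unfolding uniformly_continuous_on_def by meson
  \<comment> \<open>The corner differs from the point by at most 1 / p in each coordinate, so 2 / p
    < d suffices.\<close>
  obtain m :: nat where m: "2 / d < real m" using reals_Archimedean2 by blast
  define p where "p = max (Suc n) m"
  \<comment> \<open>A weight sees only the unordered pair, so h is read at the sorted corner;
    symmetry of h makes the order immaterial.\<close>
  define w where "w X = (if card X = 2 then h (real (Min X) / real p, real (Max X) / real p) else 0)" for X
  have p1: "p \<ge> 1" by (simp add: p_def)
  have "2 / d < real p" using m by (simp add: p_def)
  then have pd: "2 / real p < d" using d p1 by (simp add: field_simps)
  have w: "w \<in> edge_weights" using h01 by (auto simp: w_def edge_weights_def loopless_def)
  show thesis
  proof (rule that[OF _ w])
    show "p \<ge> Suc n" by (simp add: p_def)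
    fix x y :: real assume xy: "x \<in> {0<..1}" "y \<in> {0<..1}" and ne: "cell p x \<noteq> cell p y"
    have grid: "\<bar>real (cell p t) / real p - t\<bar> \<le> 1 / real p" "real (cell p t) / real p \<in> {0..1}"
      if "t \<in> {0<..1}" for t
    proof -
      have "t \<in> cell_interval p (cell p t)" "cell p t \<in> {1..p}" using cell_range[OF p1] that by auto
      then show "\<bar>real (cell p t) / real p - t\<bar> \<le> 1 / real p" "real (cell p t) / real p \<in> {0..1}"
        using p1 by (auto simp: cell_interval_def diff_divide_distrib abs_le_iff)
    qed
    let ?z' = "(real (cell p x) / real p, real (cell p y) / real p)"
    have "step_kernel p w (x, y) = w {cell p x, cell p y}" using xy by (simp add: step_kernel_def)
    also have "\<dots> = h ?z'"
      using ne sym by (cases "cell p x < cell p y") (auto simp: w_def min_def max_def)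
    finally have eq: "step_kernel p w (x, y) = h ?z'" .
    have "dist ?z' (x, y) \<le> \<bar>real (cell p x) / real p - x\<bar> + \<bar>real (cell p y) / real p - y\<bar>"
      unfolding dist_prod_def by (simp add: dist_real_def sqrt_sum_squares_le_sum_abs)
    also have "\<dots> \<le> 2 / real p" using grid(1)[OF xy(1)] grid(1)[OF xy(2)] by simp
    finally have "dist ?z' (x, y) < d" using pd by linarith
    then have "dist (h ?z') (h (x, y)) < \<epsilon>"
      using grid(2)[OF xy(1)] grid(2)[OF xy(2)] xy by (intro close) auto
    then show "\<bar>step_kernel p w (x, y) - h (x, y)\<bar> < \<epsilon>" unfolding eq by (simp add: dist_real_def)
  qed
qed

text \<open>The zero blocks along the diagonal are harmless in the limit: points x \<noteq> y lie in
  different cells as soon as the grid is finer than their distance.\<close>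

lemma graphon_ae_limit_of_step_kernels:
  assumes f: "f \<in> graphons"
  obtains p w N where "\<And>n. p n \<ge> 1" "\<And>n. w n \<in> edge_weights" "negligible N"
    "\<And>z. z \<notin> N \<Longrightarrow> (\<lambda>n. step_kernel (p n) (w n) z) \<longlonglongrightarrow> f z"
proof -
  obtain h :: "nat \<Rightarrow> kernel" and N where N: "negligible N" and h: "\<And>n. continuous_on UNIV (h n)"
    "\<And>n x y. h n (x, y) = h n (y, x)" "\<And>n z. 0 \<le> h n z \<and> h n z \<le> 1"
    and lim: "\<And>z. z \<notin> N \<Longrightarrow> (\<lambda>n. h n z) \<longlonglongrightarrow> f z"
    using symmetric_continuous_approx[OF f] by metis
  have "\<exists>p w. p \<ge> Suc n \<and> w \<in> edge_weights \<and> (\<forall>x y. x \<in> {0<..1} \<longrightarrow> y \<in> {0<..1} \<longrightarrow>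
      cell p x \<noteq> cell p y \<longrightarrow> \<bar>step_kernel p w (x, y) - h n (x, y)\<bar> < 1 / real (Suc n))" for n
    by (rule step_kernel_near_continuous[OF h(1)[of n] h(2,3), of "1 / real (Suc n)" n]) (simp, blast)
  then obtain p w where p: "\<And>n. p n \<ge> Suc n" and w: "\<And>n. w n \<in> edge_weights"
    and near: "\<And>n x y. x \<in> {0<..1} \<Longrightarrow> y \<in> {0<..1} \<Longrightarrow> cell (p n) x \<noteq> cell (p n) y \<Longrightarrow>
      \<bar>step_kernel (p n) (w n) (x, y) - h n (x, y)\<bar> < 1 / real (Suc n)"
    by metis
  \<comment> \<open>The axes carry the points of the square that lie in no cell, the diagonal those
    that stay in a zero block on every grid.\<close>
  define B where "B = {z :: real \<times> real. (1, 0) \<bullet> z = 0} \<union> {z. (0, 1) \<bullet> z = 0} \<union> {z. (1, -1) \<bullet> z = 0}"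
  have B: "negligible B"
    unfolding B_def by (intro negligible_Un negligible_hyperplane) (auto simp: zero_prod_def)
  show thesis
  proof (rule that[of p w "N \<union> B"])
    show "p n \<ge> 1" for n using p[of n] by simp
    show "negligible (N \<union> B)" using N B by (rule negligible_Un)
    fix z assume z: "z \<notin> N \<union> B"
    obtain x y where xy: "z = (x, y)" by (cases z)
    have ne: "x \<noteq> 0" "y \<noteq> 0" "x \<noteq> y" using z by (auto simp: B_def xy)
    show "(\<lambda>n. step_kernel (p n) (w n) z) \<longlonglongrightarrow> f z"
    proof (cases "x \<in> {0<..1} \<and> y \<in> {0<..1}")
      case False
      then have "f z = 0" using f ne by (auto simp: xy graphons_def kernels_def)
      moreover have "step_kernel (p n) (w n) z = 0" for n using False by (auto simp: xy step_kernel_def)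
      ultimately show ?thesis by simp
    next
      case True
      obtain n0 :: nat where n0: "1 / \<bar>x - y\<bar> < real n0" using reals_Archimedean2 by blast
      have ev: "norm (step_kernel (p n) (w n) z - h n z) \<le> 1 / real (Suc n)" if "n \<ge> n0" for n
      proof -
        have pn: "p n \<ge> 1" using p[of n] by simp
        have "cell (p n) x \<noteq> cell (p n) y"
        proof
          assume "cell (p n) x = cell (p n) y"
          then have "x \<in> cell_interval (p n) (cell (p n) x)" "y \<in> cell_interval (p n) (cell (p n) x)"
            using cell_range(2)[OF pn, of x] cell_range(2)[OF pn, of y] True by simp_all
          then have "\<bar>x - y\<bar> < 1 / real (p n)"
            by (auto simp: cell_interval_def diff_divide_distrib abs_less_iff)
          moreover have "1 / \<bar>x - y\<bar> < real (p n)" using n0 p[of n] that by linarith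
          ultimately show False using ne(3) pn by (simp add: field_simps)
        qed
        then show ?thesis using near[of x y n] True by (simp add: xy)
      qed
      have "(\<lambda>n. step_kernel (p n) (w n) z - h n z) \<longlonglongrightarrow> 0"
        by (rule Lim_null_comparison[OF eventually_sequentiallyI[OF ev] LIMSEQ_Suc[OF lim_inverse_n']])
      then have "(\<lambda>n. step_kernel (p n) (w n) z - h n z + h n z) \<longlonglongrightarrow> 0 + f z"
        using lim[of z] z by (intro tendsto_add) auto
      then show ?thesis by simp
    qed
  qed (rule w)
qed

context taylor_convergent
begin

text \<open>Along the approximating step kernels F converges by cut continuity and each density by
  dominated convergence; \<open>coeff_bound\<close> carries the limit through the series.\<close>

lemma graphon_sums:
  assumes f: "f \<in> graphons"
  shows "(\<lambda>m. \<Sum>H\<in>multigraph_classes m. a H * class_density H f) sums F f"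
proof -
  obtain p w N where p: "\<And>n. p n \<ge> 1" and w: "\<And>n. w n \<in> edge_weights" and N: "negligible N"
    and lim: "\<And>z. z \<notin> N \<Longrightarrow> (\<lambda>n. step_kernel (p n) (w n) z) \<longlonglongrightarrow> f z"
    using graphon_ae_limit_of_step_kernels[OF f] by metis
  define s where "s n = step_kernel (p n) (w n)" for n
  have s: "s n \<in> graphons" for n unfolding s_def by (rule step_kernel_in_graphons[OF p w])
  have slim: "(\<lambda>n. s n z) \<longlonglongrightarrow> f z" if "z \<notin> N" for z unfolding s_def by (rule lim[OF that])
  have kern: "f \<in> kernels" "\<And>n. s n \<in> kernels" using f s by (simp_all add: graphons_def)
  obtain b where b: "b \<longlonglongrightarrow> 0" "\<And>n. cut_norm (\<lambda>z. s n z - f z) \<le> b n"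
    using cut_norm_tendsto_0[OF f s N slim] by metis
  have limF: "(\<lambda>n. F (s n)) \<longlonglongrightarrow> F f"
  proof (rule LIMSEQ_I)
    fix r :: real assume "r > 0"
    then obtain \<delta> where \<delta>: "\<delta> > 0" "\<And>g. g \<in> kernels \<Longrightarrow> cut_norm (\<lambda>z. g z - f z) < \<delta> \<Longrightarrow> \<bar>F g - F f\<bar> < r"
      using continuous kern(1) unfolding cut_continuous_def by meson
    have "eventually (\<lambda>n. b n < \<delta>) sequentially" using b(1) \<delta>(1) by (rule order_tendstoD)
    then obtain n0 where "\<And>n. n \<ge> n0 \<Longrightarrow> b n < \<delta>" by (auto simp: eventually_sequentially)
    then show "\<exists>n0. \<forall>n\<ge>n0. norm (F (s n) - F f) < r"
      using \<delta>(2)[OF kern(2)] b(2) by (metis order.strict_trans1 real_norm_def)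
  qed
  have bound: "\<bar>\<Sum>H\<in>multigraph_classes m. a H * class_density H (s n)\<bar> \<le> coeff_bound m" for m n
  proof -
    have "\<bar>a H * class_density H (s n)\<bar> \<le> \<bar>a H\<bar>" if H: "H \<in> multigraph_classes m" for H
      using hom_density_abs_le_1[OF repD(1)[OF H H] s] by (simp add: abs_mult class_density_def mult_left_le)
    then show ?thesis unfolding coeff_bound_def by (intro order.trans[OF sum_abs] sum_mono)
  qed
  have term_lim: "(\<lambda>n. \<Sum>H\<in>multigraph_classes m. a H * class_density H (s n))
      \<longlonglongrightarrow> (\<Sum>H\<in>multigraph_classes m. a H * class_density H f)" for m
    unfolding class_density_def
    by (intro tendsto_sum tendsto_mult tendsto_const hom_density_tendsto[OF _ f s N slim] repD(1))
  have "eventually (\<lambda>(m, n). norm (\<Sum>H\<in>multigraph_classes m. a H * class_density H (s n)) \<le> coeff_bound m)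
      (at_top \<times>\<^sub>F sequentially)"
    using bound by (intro always_eventually) auto
  note tannery = tannerys_theorem[OF term_lim this summable_coeff_bound sequentially_bot]
  have F_s: "F (s n) = (\<Sum>m. \<Sum>H\<in>multigraph_classes m. a H * class_density H (s n))" for n
    unfolding s_def by (rule sums_unique[OF step_kernel_density_sums[OF p w]])
  have "(\<lambda>n. F (s n)) \<longlonglongrightarrow> (\<Sum>m. \<Sum>H\<in>multigraph_classes m. a H * class_density H f)"
    unfolding F_s by (rule conjunct2[OF conjunct2[OF tannery]])
  then have "F f = (\<Sum>m. \<Sum>H\<in>multigraph_classes m. a H * class_density H f)"
    using limF by (rule LIMSEQ_unique[rotated])
  moreover have "summable (\<lambda>m. \<Sum>H\<in>multigraph_classes m. a H * class_density H f)"
    by (rule summable_norm_cancel[OF conjunct1[OF conjunct2[OF tannery]]])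
  ultimately show ?thesis by (simp add: sums_iff)
qed

lemma coeff_zero_outside_simple_classes:
  assumes "H \<in> multigraph_classes m" "H \<notin> simple_classes m"
  shows "a H = 0"
  using coeff_nonsimple_zero simple_rep_imp_simple_class assms by blast

lemma simple_sums:
  assumes "f \<in> graphons"
  shows "(\<lambda>m. \<Sum>H\<in>simple_classes m. a H * class_density H f) sums F f"
proof -
  have "(\<Sum>H\<in>simple_classes m. a H * class_density H f) = (\<Sum>H\<in>multigraph_classes m. a H * class_density H f)" for m
    using finite_multigraph_classes simple_classes_subset coeff_zero_outside_simple_classes
    by (intro sum.mono_neutral_left) auto
  then show ?thesis using graphon_sums[OF assms] by (simp only:)
qed

end

theorem theorem4p30:
  fixes F :: "kernel \<Rightarrow> real" and a :: "multigraph set \<Rightarrow> real"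
  assumes "gateaux_smooth F" and "cut_continuous F" and "class_function F"
    and "\<And>f. f \<in> graphons \<Longrightarrow> (\<forall>z. f z \<in> {0, 1}) \<Longrightarrow> (\<lambda>n. taylor_poly F n f) \<longlonglongrightarrow> F f"
    and "taylor_coeffs F a"
    and "\<And>f. f \<in> graphons \<Longrightarrow> abs_convergent_at a f"
  shows "(\<forall>H \<in> (\<Union>m. multigraph_classes m) - (\<Union>m. simple_classes m). a H = 0)
    \<and> (\<forall>f\<in>graphons.
         (\<lambda>m. \<Sum>H\<in>multigraph_classes m. a H * class_density H f) sums F f
       \<and> (\<lambda>m. \<Sum>H\<in>simple_classes m. a H * class_density H f) sums F f)"
proof -
  interpret taylor_convergent F a
    by unfold_locales (rule assms; assumption)+
  show ?thesis
    using coeff_zero_outside_simple_classes graphon_sums simple_sums by blast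
qed

end
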